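(* Let $E$, $E_1$, $F$, $G$ be Banach spaces, $B\colon E\times E\to E_1$ a bounded bilinear map, $(A,X)\colon\mathbb{R}_{\ge 0}\to F\times E$ a càdlàg path, and $\Pi=(\pi_n)_{n\in\mathbb{N}}$ a sequence of partitions of $\mathbb{R}_{\ge 0}$ that satisfies Condition (C) for $(A,X)$ and approximates $(A,X)$ from the left. Suppose that $X$ has weak $B$-quadratic variation $Q_B(X,X)$ and finite $2$-variation along $(\pi_n)$, and that $A$ has finite variation. Let $f\colon F\times E\to G$ be a function such that: (i) the map $a\mapsto f(a,x)$ is Gâteaux differentiable on $F$ for all $x\in E$, and $D_af\colon F\times E\to\mathcal{L}_{\mathrm{c}}(F,G)$ is continuous; (ii) the map $x\mapsto f(a,x)$ is twice Gâteaux differentiable on $E$ for all $a\in F$, and $D_xf\colon F\times E\to\mathcal{L}_{\mathrm{c}}(E,G)$ is continuous; (iii) there is a continuous function $D_B^2f\colon F\times E\to\mathcal{L}_{\mathrm{c}}(E_1,G)$ such that $D_x^2f(a,x)(u\otimes v)=D_B^2f(a,x)\,B(u,v)$ for all $(a,x)\in F\times E$ and $u,v\in E$. Then for every $t\ge 0$ the Itô–Föllmer integral $$\int_0^tD_xf(A_{s-},X_{s-})\,\mathrm{d}X_s=\lim_{n\to\infty}\sum_{(r,s]\in\pi_n}D_xf(A_r,X_r)(X_{s\wedge t}-X_{r\wedge t})$$ exists as a limit in the weak topology of $G$, and $$f(A_t,X_t)-f(A_0,X_0)=\int_0^tD_af(A_{s-},X_{s-})\,\mathrm{d}A^{\mathrm{c}}_s+\int_0^tD_xf(A_{s-},X_{s-})\,\mathrm{d}X_s+\frac12\int_0^tD_B^2f(A_{s-},X_{s-})\,\mathrm{d}Q_B(X,X)^{\mathrm{c}}_s+\sum_{0<s\le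 t}\bigl\{\Delta f(A_s,X_s)-D_xf(A_{s-},X_{s-})\Delta X_s\bigr\}.$$ Moreover, if $Q_B(X,X)$ is the strong $B$-quadratic variation of $X$, then the limit defining the Itô–Föllmer integral holds in the norm topology of $G$.
   Context: All Banach spaces are real. $\mathcal{L}(E,G)$ is the space of bounded linear maps. $\mathcal{L}_{\mathrm{c}}(E,G)$ is $\mathcal{L}(E,G)$ with the locally convex topology generated by the seminorms $\rho_K(L)=\inf\{C>0: \|Lx\|\le C\|x\|\ \forall x\in K\}$, $K$ ranging over all compact subsets of $E$. Gâteaux differentiability of $g$ at $x$ means that there is a bounded linear $L$ with $\lim_{t\to0}t^{-1}(g(x+th)-g(x))=Lh$ for all $h$; $D_af,D_xf$ are partial Gâteaux derivatives, and $D_x^2f(a,x)$ (the derivative of $D_xf(a,\cdot)\colon E\to\mathcal{L}(E,G)$) is regarded as an element of $\mathcal{L}(E\widehat\otimes E,G)\cong\mathcal{L}(E,\mathcal{L}(E,G))$, $\widehat\otimes$ being the projective tensor product. Paths. A càdlàg path is right continuous on $[0,\infty)$ with left limits $X_{t-}$ at $t>0$; $\Delta X_t=X_t-X_{t-}$, $\Delta X_0=0$; $\Delta f(A_s,X_s)=f(A_s,X_s)-f(A_{s-},X_{s-})$. $D(X)=\{t:\Delta X_t\ne0\}$, $D_\varepsilon(X)=\{t:\|\Delta X_t\|\ge\varepsilon\}$, $J_\varepsilon(X)_t=\sum_{0<s\le t}\Delta X_s1_{D_\varepsilon(X)}(s)$. $F\times E$ carries the norm $\|\cdot\|_F+\|\cdot\|_E$.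 A path has finite variation if it has bounded variation on each compact interval; for a càdlàg path $g$ of finite variation, $g^{\mathrm{c}}_t=g_t-\sum_{0<s\le t}\Delta g_s$. Partitions. A partition of $\mathbb{R}_{\ge0}$ is a set $\pi=\{(t_i,t_{i+1}]:i\in\mathbb{N}\}$ with $0=t_0<t_1<\cdots\to\infty$. For $t>0$, $\pi(t)$ is the unique element of $\pi$ containing $t$, $\underline\pi(t)=\inf\pi(t)$, $\overline\pi(t)=\sup\pi(t)$. For a path $X$, $O_t^+(X;\pi)=\sup_{(r,s]\in\pi}\sup_{u,v\in(r,s]\cap[0,t]}\|X_u-X_v\|$. $(\pi_n)$ satisfies Condition (C) for a càdlàg path $X$ if: (C1) for all $t\ge0$, $\varepsilon>0$ there is $N$ such that for all $n\ge N$, $I\in\pi_n$, the set $I\cap[0,t]\cap D_\varepsilon(X)$ has at most one element; (C2) for all $s\in D(X)$ and $t\ge s$, $\lim_n\{X(\overline{\pi_n}(s)\wedge t)-X(\underline{\pi_n}(s)\wedge t)\}=\Delta X_s$; (C3) for all $t\ge0$, $\limsup_{\varepsilon\downarrow0}\limsup_{n\to\infty}O_t^+(X-J_\varepsilon(X);\pi_n)=0$. $(\pi_n)$ approximates $X$ from the left if $\lim_nX(\underline{\pi_n}(t))=X(t-)$ for all $t>0$. $X$ has strong (resp. weak) $B$-quadratic variation along $(\pi_n)$ if there is a càdlàg path $Q_B(X,X)\colon\mathbb{R}_{\ge0}\to E_1$ of finite variation such that for all $t\ge0$: $\sum_{(r,s]\in\pi_n}B(X_{s\wedge t}-X_{r\wedge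 t},X_{s\wedge t}-X_{r\wedge t})\to Q_B(X,X)_t$ in the norm (resp. weak) topology of $E_1$, and $\Delta Q_B(X,X)_t=B(\Delta X_t,\Delta X_t)$. $X$ has finite $2$-variation along $(\pi_n)$ if $V^2(X;\Pi)_t=\sup_n\sum_{(r,s]\in\pi_n}\|X_{s\wedge t}-X_{r\wedge t}\|^2<\infty$ for all $t\ge0$. Stieltjes integrals. For a càdlàg path $g$ of finite variation in a Banach space $H$ and $t\ge0$, the map $\varphi\mapsto\int_0^t\varphi\,\mathrm{d}g=\int_{(0,t]}\varphi\,\mathrm{d}g$ is defined on step functions $\varphi=1_{\{0\}}c_0+\sum_{i=1}^m1_{(a_i,b_i]}c_i$ ($c_i\in\mathcal{L}(H,G)$) by $\sum_ic_i(g_{b_i\wedge t}-g_{a_i\wedge t})$, and extended by linearity and continuity to all left-continuous functions with right limits (càglàd) $\varphi\colon\mathbb{R}_{\ge0}\to\mathcal{L}_{\mathrm{c}}(H,G)$, with respect to uniform convergence on compacts (seminorms $\sup_{s\le T}\rho_K(\varphi(s))$). *)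

theory Defs
  imports "HOL-Analysis.Analysis"
begin

subsection \<open>Topologies and derivatives\<close>

definition weak_topology :: "'a::real_normed_vector topology" where
  "weak_topology =
     topology_generated_by {blinfun_apply \<phi> -` U | (\<phi> :: 'a \<Rightarrow>\<^sub>L real) U. open U}"

text \<open>The factor \<open>norm x\<close> on the right makes these seminorms stronger than those of uniform
  convergence on compact sets.\<close>

definition rho ::
    "'a::real_normed_vector set \<Rightarrow> ('a \<Rightarrow>\<^sub>L 'b::real_normed_vector) \<Rightarrow> real" where
  "rho K L = Inf {C. 0 < C \<and> (\<forall>x\<in>K. norm (blinfun_apply L x) \<le> C * norm x)}"

definition Lc_topology :: "('a::real_normed_vector \<Rightarrow>\<^sub>L 'b::real_normed_vector) topology" where
  "Lc_topology =
     topology_generated_by {{M. rho K (M - L) < r} | K L r. compact K \<and> 0 < r}"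

definition has_gateaux_derivative ::
    "('a::real_normed_vector \<Rightarrow> 'b::real_normed_vector) \<Rightarrow> ('a \<Rightarrow>\<^sub>L 'b) \<Rightarrow> 'a \<Rightarrow> bool" where
  "has_gateaux_derivative g L x \<longleftrightarrow>
     (\<forall>h. ((\<lambda>t. inverse t *\<^sub>R (g (x + t *\<^sub>R h) - g x)) \<longlongrightarrow> blinfun_apply L h) (at 0))"

subsection \<open>Paths\<close>

text \<open>Paths on the half-line \<open>[0,\<infinity>)\<close> are functions on \<^typ>\<open>real\<close> whose values at negative
  arguments are never used.\<close>

definition cadlag :: "(real \<Rightarrow> 'a::topological_space) \<Rightarrow> bool" where
  "cadlag X \<longleftrightarrow> (\<forall>t\<ge>0. (X \<longlongrightarrow> X t) (at_right t)) \<and> (\<forall>t>0. \<exists>l. (X \<longlongrightarrow> l) (at_left t))"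

text \<open>The value at \<open>0\<close> is chosen such that there is no jump at \<open>0\<close>.\<close>

definition left_lim :: "(real \<Rightarrow> 'a::t2_space) \<Rightarrow> real \<Rightarrow> 'a" where
  "left_lim X t = (if 0 < t then Lim (at_left t) X else X t)"

definition jump :: "(real \<Rightarrow> 'a::real_normed_vector) \<Rightarrow> real \<Rightarrow> 'a" where
  "jump X t = X t - left_lim X t"

definition jump_times :: "(real \<Rightarrow> 'a::real_normed_vector) \<Rightarrow> real set" where
  "jump_times X = {t. 0 \<le> t \<and> jump X t \<noteq> 0}"

text \<open>The library norm of a product type is Euclidean, whereas here the product carries the sum
  of the norms. The notions that depend on the size of jumps or oscillations therefore take the
  norm \<open>N\<close> as an argument.\<close>

definition sum_norm :: "'f::real_normed_vector \<times> 'e::real_normed_vector \<Rightarrow> real" where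
  "sum_norm p = norm (fst p) + norm (snd p)"

definition big_jump_times ::
    "('a::real_normed_vector \<Rightarrow> real) \<Rightarrow> real \<Rightarrow> (real \<Rightarrow> 'a) \<Rightarrow> real set" where
  "big_jump_times N \<epsilon> X = {t. 0 \<le> t \<and> \<epsilon> \<le> N (jump X t)}"

text \<open>For \<open>\<epsilon> > 0\<close> and a right continuous path with left limits, the index set is finite.\<close>

definition big_jump_part ::
    "('a::real_normed_vector \<Rightarrow> real) \<Rightarrow> real \<Rightarrow> (real \<Rightarrow> 'a) \<Rightarrow> real \<Rightarrow> 'a" where
  "big_jump_part N \<epsilon> X t = (\<Sum>s\<in>{0<..t} \<inter> big_jump_times N \<epsilon> X. jump X s)"

definition finite_variation :: "(real \<Rightarrow> 'a::real_normed_vector) \<Rightarrow> bool" where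
  "finite_variation g \<longleftrightarrow>
     (\<forall>a b. 0 \<le> a \<and> a \<le> b \<longrightarrow>
        (\<exists>C. \<forall>(n::nat) \<tau>. mono_on {..n} \<tau> \<and> \<tau> ` {..n} \<subseteq> {a..b} \<longrightarrow>
           (\<Sum>i<n. norm (g (\<tau> (Suc i)) - g (\<tau> i))) \<le> C))"

definition continuous_part :: "(real \<Rightarrow> 'a::real_normed_vector) \<Rightarrow> real \<Rightarrow> 'a" where
  "continuous_part g t = g t - (\<Sum>\<^sub>\<infinity>s\<in>{0<..t}. jump g s)"

subsection \<open>Partitions\<close>

text \<open>A partition is a set of intervals \<open>I = (r,s]\<close>, so that \<open>r = Inf I\<close> and \<open>s = Sup I\<close>. Sums
  over a partition are written with \<^const>\<open>infsum\<close>; those below have only finitely many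
  nonzero terms.\<close>

definition is_partition :: "real set set \<Rightarrow> bool" where
  "is_partition \<pi> \<longleftrightarrow>
     (\<exists>\<tau> :: nat \<Rightarrow> real. \<tau> 0 = 0 \<and> strict_mono \<tau> \<and> filterlim \<tau> at_top sequentially \<and>
        \<pi> = range (\<lambda>i. {\<tau> i<..\<tau> (Suc i)}))"

definition part_interval :: "real set set \<Rightarrow> real \<Rightarrow> real set" where
  "part_interval \<pi> t = (THE I. I \<in> \<pi> \<and> t \<in> I)"

definition part_lower :: "real set set \<Rightarrow> real \<Rightarrow> real" where
  "part_lower \<pi> t = Inf (part_interval \<pi> t)"

definition part_upper :: "real set set \<Rightarrow> real \<Rightarrow> real" where
  "part_upper \<pi> t = Sup (part_interval \<pi> t)"

definition increment :: "(real \<Rightarrow> 'a::real_normed_vector) \<Rightarrow> real \<Rightarrow> real set \<Rightarrow> 'a" where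
  "increment X t I = X (min (Sup I) t) - X (min (Inf I) t)"

definition oscillation ::
    "('a::real_normed_vector \<Rightarrow> real) \<Rightarrow> (real \<Rightarrow> 'a) \<Rightarrow> real set set \<Rightarrow> real \<Rightarrow> ennreal" where
  "oscillation N X \<pi> t =
     (SUP I\<in>\<pi>. SUP u\<in>I \<inter> {0..t}. SUP v\<in>I \<inter> {0..t}. ennreal (N (X u - X v)))"

definition condition_C ::
    "('a::real_normed_vector \<Rightarrow> real) \<Rightarrow> (nat \<Rightarrow> real set set) \<Rightarrow> (real \<Rightarrow> 'a) \<Rightarrow> bool" where
  "condition_C N \<pi>s X \<longleftrightarrow>
     (\<forall>t\<ge>0. \<forall>\<epsilon>>0. \<exists>n0. \<forall>n\<ge>n0. \<forall>I\<in>\<pi>s n.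
        \<forall>u\<in>I \<inter> {0..t} \<inter> big_jump_times N \<epsilon> X.
        \<forall>v\<in>I \<inter> {0..t} \<inter> big_jump_times N \<epsilon> X. u = v) \<and>
     (\<forall>s\<in>jump_times X. \<forall>t\<ge>s.
        (\<lambda>n. X (min (part_upper (\<pi>s n) s) t) - X (min (part_lower (\<pi>s n) s) t))
          \<longlonglongrightarrow> jump X s) \<and>
     (\<forall>t\<ge>0. Limsup (at_right 0)
        (\<lambda>\<epsilon>. limsup (\<lambda>n. oscillation N (\<lambda>u. X u - big_jump_part N \<epsilon> X u) (\<pi>s n) t)) = 0)"

definition approximates_from_left ::
    "(nat \<Rightarrow> real set set) \<Rightarrow> (real \<Rightarrow> 'a::real_normed_vector) \<Rightarrow> bool" where
  "approximates_from_left \<pi>s X \<longleftrightarrow>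
     (\<forall>t>0. (\<lambda>n. X (part_lower (\<pi>s n) t)) \<longlonglongrightarrow> left_lim X t)"

subsection \<open>Quadratic variation\<close>

text \<open>\<open>Q\<close> is the weak (strong) \<open>B\<close>-quadratic variation of \<open>X\<close> when \<open>T\<close> is the weak
  (norm) topology.\<close>

definition has_quadratic_variation ::
    "'b::real_normed_vector topology \<Rightarrow> ('a::real_normed_vector \<Rightarrow> 'a \<Rightarrow> 'b) \<Rightarrow>
     (nat \<Rightarrow> real set set) \<Rightarrow> (real \<Rightarrow> 'a) \<Rightarrow> (real \<Rightarrow> 'b) \<Rightarrow> bool" where
  "has_quadratic_variation T B \<pi>s X Q \<longleftrightarrow>
     cadlag Q \<and> finite_variation Q \<and>
     (\<forall>t\<ge>0.
        limitin T (\<lambda>n. \<Sum>\<^sub>\<infinity>I\<in>\<pi>s n. B (increment X t I) (increment X t I)) (Q t) sequentially \<and>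
        jump Q t = B (jump X t) (jump X t))"

abbreviation has_weak_quadratic_variation where
  "has_weak_quadratic_variation \<equiv> has_quadratic_variation weak_topology"

abbreviation has_strong_quadratic_variation where
  "has_strong_quadratic_variation \<equiv> has_quadratic_variation euclidean"

definition finite_2_variation ::
    "(nat \<Rightarrow> real set set) \<Rightarrow> (real \<Rightarrow> 'a::real_normed_vector) \<Rightarrow> bool" where
  "finite_2_variation \<pi>s X \<longleftrightarrow>
     (\<forall>t\<ge>0. (SUP n. \<Sum>\<^sub>\<infinity>I\<in>\<pi>s n. ennreal ((norm (increment X t I))\<^sup>2)) < \<infinity>)"

subsection \<open>Integrals\<close>

definition ito_foellmer_sum ::
    "real set set \<Rightarrow> (real \<Rightarrow> 'e::real_normed_vector \<Rightarrow>\<^sub>L 'g::real_normed_vector) \<Rightarrow>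
     (real \<Rightarrow> 'e) \<Rightarrow> real \<Rightarrow> 'g" where
  "ito_foellmer_sum \<pi> H X t = (\<Sum>\<^sub>\<infinity>I\<in>\<pi>. blinfun_apply (H (Inf I)) (increment X t I))"


text \<open>A representation of a step function consists of the value \<open>c0\<close> at \<open>0\<close> and of a list of
  triples \<open>(a,b,c)\<close>, each standing for the value \<open>c\<close> on the interval \<open>(a,b]\<close>.\<close>

type_synonym 'c step = "'c \<times> (real \<times> real \<times> 'c) list"

definition is_step :: "'c step \<Rightarrow> bool" where
  "is_step \<sigma> \<longleftrightarrow> (\<forall>(a, b, c)\<in>set (snd \<sigma>). 0 \<le> a \<and> a \<le> b)"

definition step_fun :: "'c::real_vector step \<Rightarrow> real \<Rightarrow> 'c" where
  "step_fun \<sigma> s =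
     indicat_real {0} s *\<^sub>R fst \<sigma> + (\<Sum>(a, b, c)\<leftarrow>snd \<sigma>. indicat_real {a<..b} s *\<^sub>R c)"

definition step_integral ::
    "real \<Rightarrow> (real \<Rightarrow> 'h::real_normed_vector) \<Rightarrow>
     ('h \<Rightarrow>\<^sub>L 'g::real_normed_vector) step \<Rightarrow> 'g" where
  "step_integral t g \<sigma> = (\<Sum>(a, b, c)\<leftarrow>snd \<sigma>. blinfun_apply c (g (min b t) - g (min a t)))"

text \<open>Neighbourhoods of \<open>\<phi>\<close> for the seminorms \<open>sup\<^bsub>s \<le> T\<^esub> \<rho>\<^sub>K(\<phi>(s))\<close>. Since
  \<^const>\<open>rho\<close> is monotone in \<open>K\<close>, these sets form a filter base.\<close>

definition nhds_ucp ::
    "(real \<Rightarrow> 'h::real_normed_vector \<Rightarrow>\<^sub>L 'g::real_normed_vector) \<Rightarrow>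
     (real \<Rightarrow> 'h \<Rightarrow>\<^sub>L 'g) filter" where
  "nhds_ucp \<phi> =
     (INF (K, T, \<delta>)\<in>{K. compact K} \<times> {0..} \<times> {0<..}.
        principal {\<psi>. \<forall>s\<in>{0..T}. rho K (\<psi> s - \<phi> s) < \<delta>})"

text \<open>The continuous extension of \<^const>\<open>step_integral\<close>: its value at \<open>\<phi>\<close> is the limit along
  step functions tending to \<open>\<phi>\<close>. For left-continuous integrands with right limits (in
  \<^const>\<open>Lc_topology\<close>) and integrators of finite variation with values in a Banach space the
  limit exists and is unique.\<close>

definition stieltjes_integral ::
    "real \<Rightarrow> (real \<Rightarrow> 'h::real_normed_vector \<Rightarrow>\<^sub>L 'g::real_normed_vector) \<Rightarrow>
     (real \<Rightarrow> 'h) \<Rightarrow> 'g" where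
  "stieltjes_integral t \<phi> g =
     Lim (inf (filtercomap step_fun (nhds_ucp \<phi>)) (principal {\<sigma>. is_step \<sigma>}))
       (step_integral t g)"

end

theory Submission
  imports Defs
begin

text \<open>Write \<open>Z = (A, X)\<close>. The increment \<open>f (Z t) - f (Z 0)\<close> is telescoped along the \<open>n\<close>-th partition, and
  each increment is expanded to first order in \<open>A\<close> and to second order in \<open>X\<close>. For every \<open>n\<close> this
  expresses it as the sum of four terms: the Ito--Foellmer sum, a Riemann sum of \<open>Daf\<close> against the
  increments of \<open>A\<close>, half of a Riemann sum of \<open>DBf\<close> against the squares \<open>B(\<Delta>X, \<Delta>X)\<close>, and a sum of Taylor
  remainders. The first sum therefore converges as soon as the three others do, and its limit can
  be read off.

  The remainders are small compared with \<open>\<bar>\<Delta>A\<bar> + \<bar>\<Delta>X\<bar>\<^sup>2\<close>, uniformly near the relatively compact range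
  of \<open>Z\<close>, and the sums of this gauge are bounded because \<open>A\<close> has finite variation and \<open>X\<close> has finite
  2-variation. So the intervals without a big jump contribute arbitrarily little, while an
  interval around a big jump contributes the remainder of that jump. The limit, in norm, is the
  sum of the remainders over all jumps (\<open>sum_little_o\<close>).

  The Riemann sums need more care, since the mesh of the partitions need not tend to zero. They are
  compared with sums over finitely many fixed knots, between which the integrand oscillates
  little (\<open>sum_minus_riemann_sum_eventually_le\<close>). The comparison is in norm. What is left is the
  convergence of the quadratic sums at the knots, and this is the only place where the weak and
  the strong topology make a difference (\<open>riemann_sums_tendsto\<close>).

  The limits of the Riemann sums are Stieltjes integrals against \<open>A\<close> and \<open>Q\<close>. Splitting off the jumps of
  these integrators (\<open>stieltjes_integral_split_jumps\<close>) yields the integrals against the continuous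
  parts, and the jump terms obtained in this way cancel the corresponding terms of the remainders, so
  that only \<open>\<Delta>f - Dxf \<Delta>X\<close> survives.

  Throughout, the derivatives are continuous in norm: on a metric space, continuity into
  \<^const>\<open>Lc_topology\<close> is already norm continuity (\<open>Lc_continuous_imp_continuous\<close>).\<close>

section \<open>The topologies\<close>

lemma rho_lessD:
  assumes "rho K L < r"
  obtains C where "0 < C" "C < r" "\<And>x. x \<in> K \<Longrightarrow> norm (blinfun_apply L x) \<le> C * norm x"
proof -
  have "norm L + 1 \<in> {C. 0 < C \<and> (\<forall>x\<in>K. norm (blinfun_apply L x) \<le> C * norm x)}"
    by (auto intro!: order_trans[OF norm_blinfun] mult_right_mono simp: add_nonneg_pos)
  then show ?thesis
    using assms that cInf_lessD[of "{C. 0 < C \<and> (\<forall>x\<in>K. norm (blinfun_apply L x) \<le> C * norm x)}" r]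
    unfolding rho_def by blast
qed

lemma rho_le_norm: "rho K L \<le> norm L"
proof (rule field_le_epsilon)
  fix e :: real assume "0 < e"
  then have "norm L + e \<in> {C. 0 < C \<and> (\<forall>x\<in>K. norm (blinfun_apply L x) \<le> C * norm x)}"
    by (auto intro!: order_trans[OF norm_blinfun] mult_right_mono simp: add_nonneg_pos)
  then show "rho K L \<le> norm L + e"
    unfolding rho_def by (rule cInf_lower) (auto intro!: bdd_belowI[of _ 0])
qed

text \<open>If norm continuity failed along a sequence, there would be unit vectors \<open>h n\<close> on which the operators
  do not converge. The set of all \<open>h n / (n + 1)\<close> together with \<open>0\<close> is compact, and because of the
  factor \<open>norm x\<close> in \<^const>\<open>rho\<close> its seminorm does not notice that the vectors have been shrunk.\<close>

lemma Lc_continuous_imp_continuous: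
  fixes \<Phi> :: "'a::metric_space \<Rightarrow> 'b::real_normed_vector \<Rightarrow>\<^sub>L 'c::real_normed_vector"
  assumes "continuous_map euclidean Lc_topology \<Phi>"
  shows "continuous_on UNIV \<Phi>"
proof -
  have "(\<lambda>n. \<Phi> (y n)) \<longlonglongrightarrow> \<Phi> x" if y: "y \<longlonglongrightarrow> x" for x y
  proof (rule ccontr)
    assume "\<not> (\<lambda>n. \<Phi> (y n)) \<longlonglongrightarrow> \<Phi> x"
    then obtain e where e: "0 < e" and "\<not> (\<forall>\<^sub>F n in sequentially. dist (\<Phi> (y n)) (\<Phi> x) < e)"
      unfolding tendsto_iff by blast
    then have "\<exists>\<^sub>F n in sequentially. e \<le> dist (\<Phi> (y n)) (\<Phi> x)"
      by (simp add: frequently_def not_le)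
    then have inf: "infinite {n. e \<le> dist (\<Phi> (y n)) (\<Phi> x)}"
      by (simp add: frequently_cofinite cofinite_eq_sequentially[symmetric])
    define k where "k = enumerate {n. e \<le> dist (\<Phi> (y n)) (\<Phi> x)}"
    have k: "strict_mono k" "\<And>n. e \<le> dist (\<Phi> (y (k n))) (\<Phi> x)"
      using strict_mono_enumerate[OF inf] enumerate_in_set[OF inf] by (auto simp: k_def)
    have "\<exists>h. norm h = 1 \<and> e/2 < norm (blinfun_apply (\<Phi> (y (k n)) - \<Phi> x) h)" for n
    proof (rule ccontr)
      assume H: "\<nexists>h. norm h = 1 \<and> e/2 < norm (blinfun_apply (\<Phi> (y (k n)) - \<Phi> x) h)"
      have "norm (\<Phi> (y (k n)) - \<Phi> x) \<le> e/2"
      proof (rule norm_blinfun_bound)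
        fix h :: 'b
        show "norm (blinfun_apply (\<Phi> (y (k n)) - \<Phi> x) h) \<le> e/2 * norm h"
        proof (cases "h = 0")
          case False
          then have "norm (blinfun_apply (\<Phi> (y (k n)) - \<Phi> x) (inverse (norm h) *\<^sub>R h)) \<le> e/2"
            using H[simplified, rule_format, of "inverse (norm h) *\<^sub>R h"] by simp
          then show ?thesis
            using False by (simp add: blinfun.scaleR_right field_simps)
        qed simp
      qed (use e in simp)
      with k(2)[of n] e show False
        by (simp add: dist_norm)
    qed
    then obtain h where h: "\<And>n. norm (h n) = 1"
        "\<And>n. e/2 < norm (blinfun_apply (\<Phi> (y (k n)) - \<Phi> x) (h n))"
      by metis
    define z where "z n = inverse (real (Suc n)) *\<^sub>R h n" for n
    have "z \<longlonglongrightarrow> 0"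
    proof (rule tendsto_norm_zero_cancel)
      show "(\<lambda>n. norm (z n)) \<longlonglongrightarrow> 0"
        using LIMSEQ_inverse_real_of_nat by (simp add: z_def h)
    qed
    then have K: "compact (insert 0 (range z))"
      using compactin_sequence_with_limit[of euclidean z 0 "range z"] by simp
    define V where "V = {M. rho (insert 0 (range z)) (M - \<Phi> x) < e/2}"
    have "openin Lc_topology V"
      unfolding Lc_topology_def V_def
      using K e by (intro topology_generated_by_Basis) (auto intro!: exI[of _ "insert 0 (range z)"] exI[of _ "\<Phi> x"] exI[of _ "e/2"])
    then have op: "open {w. \<Phi> w \<in> V}"
      using openin_continuous_map_preimage[OF assms, of V] by simp
    have "\<Phi> x \<in> V"
      using rho_le_norm[of "insert 0 (range z)" "\<Phi> x - \<Phi> x"] e by (simp add: V_def)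
    then have "\<forall>\<^sub>F n in sequentially. \<Phi> (y n) \<in> V"
      using topological_tendstoD[OF y op] by simp
    then obtain n where "\<Phi> (y (k n)) \<in> V"
      using eventually_happens'[OF sequentially_bot eventually_subseq[OF k(1)]] by blast
    then obtain C where C: "C < e/2"
        "\<And>w. w \<in> insert 0 (range z) \<Longrightarrow> norm (blinfun_apply (\<Phi> (y (k n)) - \<Phi> x) w) \<le> C * norm w"
      unfolding V_def using rho_lessD by blast
    have "inverse (real (Suc n)) * norm (blinfun_apply (\<Phi> (y (k n)) - \<Phi> x) (h n)) \<le> inverse (real (Suc n)) * C"
      using C(2)[of "z n"] by (simp add: z_def blinfun.scaleR_right h mult.commute[of C] del: of_nat_Suc)
    then have "norm (blinfun_apply (\<Phi> (y (k n)) - \<Phi> x) (h n)) \<le> C"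
      by (rule mult_left_le_imp_le) simp
    with h(2)[of n] C(1) show False
      by simp
  qed
  then show ?thesis
    by (simp add: continuous_on_sequentially comp_def)
qed

lemma limitin_weak_topology:
  fixes x :: "'b \<Rightarrow> 'a::real_normed_vector"
  shows "limitin weak_topology x l F \<longleftrightarrow>
    (\<forall>\<psi> :: 'a \<Rightarrow>\<^sub>L real. ((\<lambda>n. blinfun_apply \<psi> (x n)) \<longlongrightarrow> blinfun_apply \<psi> l) F)"
proof
  assume L: "limitin weak_topology x l F"
  show "\<forall>\<psi> :: 'a \<Rightarrow>\<^sub>L real. ((\<lambda>n. blinfun_apply \<psi> (x n)) \<longlongrightarrow> blinfun_apply \<psi> l) F"
  proof (intro allI topological_tendstoI)
    fix \<psi> :: "'a \<Rightarrow>\<^sub>L real" and S assume S: "open S" "blinfun_apply \<psi> l \<in> S"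
    have "openin weak_topology (blinfun_apply \<psi> -` S)"
      unfolding weak_topology_def using S by (intro topology_generated_by_Basis) blast
    then show "\<forall>\<^sub>F n in F. blinfun_apply \<psi> (x n) \<in> S"
      using L S unfolding limitin_def by fastforce
  qed
next
  assume R: "\<forall>\<psi> :: 'a \<Rightarrow>\<^sub>L real. ((\<lambda>n. blinfun_apply \<psi> (x n)) \<longlongrightarrow> blinfun_apply \<psi> l) F"
  have "l \<in> V \<longrightarrow> (\<forall>\<^sub>F n in F. x n \<in> V)" if "generate_topology_on {blinfun_apply \<phi> -` U | (\<phi> :: 'a \<Rightarrow>\<^sub>L real) U. open U} V" for V
    using that
  proof induction
    case (UN K)
    show ?case
    proof
      assume "l \<in> \<Union> K"
      then obtain k where k: "k \<in> K" "l \<in> k" by blast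
      with UN have "\<forall>\<^sub>F n in F. x n \<in> k" by blast
      then show "\<forall>\<^sub>F n in F. x n \<in> \<Union> K"
        by (rule eventually_mono) (use k in blast)
    qed
  next
    case (Basis V)
    then show ?case using R by (auto simp: tendsto_def)
  qed (auto simp: eventually_conj_iff)
  moreover have "l \<in> topspace weak_topology"
    unfolding weak_topology_def topology_generated_by_topspace
    by (auto intro!: exI[of _ UNIV])
  ultimately show "limitin weak_topology x l F"
    unfolding limitin_def weak_topology_def openin_topology_generated_by_iff by blast
qed

section \<open>Stieltjes integrals\<close>

lemma finite_set_enumeration:
  fixes P :: "real set" and a b :: real
  assumes "finite P" "P \<subseteq> {a..b}" "a \<in> P" "b \<in> P"
  obtains p :: "nat \<Rightarrow> real" and m where "strict_mono_on {..m} p" "p ` {..m} = P" "p 0 = a" "p m = b"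
proof -
  define xs where "xs = sorted_list_of_set P"
  have xs: "sorted_wrt (<) xs" "set xs = P"
    using assms by (auto simp: xs_def)
  define m where "m = length xs - 1"
  have len: "length xs = Suc m"
    using xs assms by (cases xs) (auto simp: m_def)
  have mono: "strict_mono_on {..m} ((!) xs)"
    using xs len by (auto simp: strict_mono_on_def sorted_wrt_iff_nth_less)
  have img: "(!) xs ` {..m} = P"
    using xs(2) len by (auto simp: set_conv_nth less_Suc_eq_le)
  have "mono_on {..m} ((!) xs)"
    using mono by (rule strict_mono_on_imp_mono_on)
  then have 1: "xs ! 0 \<le> x" "x \<le> xs ! m" if "x \<in> P" for x
    using that img by (auto simp: mono_on_def)
  have "xs ! 0 \<in> P" "xs ! m \<in> P"
    using img by auto
  then have "xs ! 0 = a" "xs ! m = b"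
    using 1 assms by (auto intro!: antisym)
  with that mono img show thesis by blast
qed

lemma indicator_telescope:
  fixes g :: "real \<Rightarrow> 'a::real_normed_vector"
  assumes p: "strict_mono_on {..m} p" "p 0 = 0" "p m = t"
    and ab: "0 \<le> a" "a \<le> b" "min a t \<in> p ` {..m}" "min b t \<in> p ` {..m}"
  shows "(\<Sum>i<m. indicat_real {a<..b} (p (Suc i)) *\<^sub>R (g (p (Suc i)) - g (p i)))
    = g (min b t) - g (min a t)"
proof -
  \<comment> \<open>Each knot interval lies inside or outside \<open>(a,b]\<close>. Clamping the knots to \<open>[a,b] \<inter> [0,t]\<close> leaves
    the inner ones fixed and makes the outer ones degenerate.\<close>
  define cl where "cl x = max (min a t) (min (min b t) x)" for x
  have mono: "p i \<le> p j" if "i \<le> j" "j \<le> m" for i j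
    using p(1) that by (auto simp: strict_mono_on_leD)
  obtain k l where k: "k \<le> m" "p k = min a t" and l: "l \<le> m" "p l = min b t"
    using ab by (metis atMost_iff imageE)
  have less: "i < j \<longleftrightarrow> p i < p j" if "i \<le> m" "j \<le> m" for i j
    using p(1) that by (simp add: strict_mono_on_less)
  have "indicat_real {a<..b} (p (Suc i)) *\<^sub>R (g (p (Suc i)) - g (p i)) = g (cl (p (Suc i))) - g (cl (p i))"
    if i: "i < m" for i
  proof -
    have t: "p (Suc i) \<le> t"
      using mono[of "Suc i" m] p i by auto
    have lt: "p i < p (Suc i)" using less[of i "Suc i"] i by auto
    consider "p (Suc i) \<le> a" | "b < p (Suc i)" | "a < p (Suc i)" "p (Suc i) \<le> b" by linarith
    then show ?thesis
    proof cases
      case 1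
      then have "cl (p (Suc i)) = min a t" "cl (p i) = min a t"
        unfolding cl_def using t lt by linarith+
      then show ?thesis using 1 by simp
    next
      case 2
      then have "p l < p (Suc i)" using l t by auto
      then have "l \<le> i" using less[of l "Suc i"] l i by auto
      then have "p l \<le> p i" using mono[of l i] i by auto
      then show ?thesis using 2 t lt l ab by (auto simp: cl_def indicator_def min_def max_def split: if_splits)
    next
      case 3
      then have "p k < p (Suc i)" using k t by auto
      then have "k \<le> i" using less[of k "Suc i"] k i by auto
      then have "p k \<le> p i" using mono[of k i] i by auto
      then show ?thesis using 3 t lt k ab by (auto simp: cl_def indicator_def min_def max_def split: if_splits)
    qed
  qed
  then have "(\<Sum>i<m. indicat_real {a<..b} (p (Suc i)) *\<^sub>R (g (p (Suc i)) - g (p i)))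
      = (\<Sum>i<m. g (cl (p (Suc i))) - g (cl (p i)))"
    by simp
  also have "\<dots> = g (cl t) - g (cl 0)"
    using sum_lessThan_telescope[of "\<lambda>i. g (cl (p i))" m] p by simp
  also have "cl t = min b t"
    using ab by (auto simp: cl_def min_def max_def)
  also have "cl 0 = min a t"
    using ab mono[of 0 m] p by (auto simp: cl_def min_def max_def)
  finally show ?thesis .
qed

text \<open>The intervals in a representation of a step function may overlap. On a grid that contains all their
  endpoints, however, the integral depends only on the values of the function, which makes two
  step functions comparable.\<close>

lemma step_integral_eq_sum:
  assumes p: "strict_mono_on {..m} p" "p 0 = 0" "p m = t"
    and step: "is_step \<sigma>"
    and ends: "\<And>a b c. (a, b, c) \<in> set (snd \<sigma>) \<Longrightarrow> min a t \<in> p ` {..m} \<and> min b t \<in> p ` {..m}"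
  shows "step_integral t g \<sigma> = (\<Sum>i<m. blinfun_apply (step_fun \<sigma> (p (Suc i))) (g (p (Suc i)) - g (p i)))"
proof -
  have pos: "p (Suc i) \<noteq> 0" if "i < m" for i
    using strict_mono_onD[OF p(1), of 0 "Suc i"] that p(2) by auto
  have "(\<Sum>(a, b, c)\<leftarrow>xs. blinfun_apply c (g (min b t) - g (min a t)))
      = (\<Sum>i<m. blinfun_apply (\<Sum>(a, b, c)\<leftarrow>xs. indicat_real {a<..b} (p (Suc i)) *\<^sub>R c) (g (p (Suc i)) - g (p i)))"
    if "set xs \<subseteq> set (snd \<sigma>)" for xs
    using that
  proof (induction xs)
    case (Cons x xs)
    obtain a b c where x: "x = (a, b, c)" by (cases x)
    have ab: "0 \<le> a" "a \<le> b" "min a t \<in> p ` {..m}" "min b t \<in> p ` {..m}"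
      using Cons.prems ends step by (auto simp: x is_step_def)
    have "blinfun_apply c (g (min b t) - g (min a t))
        = (\<Sum>i<m. blinfun_apply (indicat_real {a<..b} (p (Suc i)) *\<^sub>R c) (g (p (Suc i)) - g (p i)))"
      unfolding indicator_telescope[OF p ab, symmetric]
      by (simp add: blinfun.sum_right blinfun.scaleR_left blinfun.scaleR_right)
    then show ?case
      using Cons by (simp add: x blinfun.add_left sum.distrib)
  qed simp
  from this[of "snd \<sigma>"] show ?thesis
    unfolding step_integral_def step_fun_def using pos by (auto intro!: sum.cong)
qed

text \<open>A function of finite variation is handled through a real function that dominates its
  increments; its own variation function is one choice.\<close>

definition increments_dominated :: "real \<Rightarrow> (real \<Rightarrow> real) \<Rightarrow> (real \<Rightarrow> 'a::real_normed_vector) \<Rightarrow> bool" where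
  "increments_dominated t v g \<longleftrightarrow>
     (\<forall>a b. 0 \<le> a \<and> a \<le> b \<and> b \<le> t \<longrightarrow> norm (g b - g a) \<le> v b - v a)"

lemma increments_dominatedD:
  "increments_dominated t v g \<Longrightarrow> 0 \<le> a \<Longrightarrow> a \<le> b \<Longrightarrow> b \<le> t \<Longrightarrow> norm (g b - g a) \<le> v b - v a"
  by (auto simp: increments_dominated_def)

lemma dominating_mono:
  "increments_dominated t v g \<Longrightarrow> 0 \<le> a \<Longrightarrow> a \<le> b \<Longrightarrow> b \<le> t \<Longrightarrow> v a \<le> v b"
  using increments_dominatedD[of t v g a b] norm_ge_zero[of "g b - g a"] by linarith

lemma finite_variation_dominated:
  fixes g :: "real \<Rightarrow> 'a::real_normed_vector"
  assumes "finite_variation g" "0 \<le> t"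
  obtains v where "increments_dominated t v g"
proof -
  define S where "S b = {\<Sum>i<n. norm (g (\<tau> (Suc i)) - g (\<tau> i)) | (n::nat) \<tau>.
      mono_on {..n} \<tau> \<and> \<tau> ` {..n} \<subseteq> {0..b}}" for b
  obtain C where C: "\<And>(n::nat) \<tau>. mono_on {..n} \<tau> \<Longrightarrow> \<tau> ` {..n} \<subseteq> {0..t} \<Longrightarrow>
      (\<Sum>i<n. norm (g (\<tau> (Suc i)) - g (\<tau> i))) \<le> C"
    using assms(1)[unfolded finite_variation_def, rule_format, of 0 t] assms(2) by auto
  have bdd: "bdd_above (S b)" if "b \<le> t" for b
  proof (rule bdd_aboveI[of _ C])
    fix x assume "x \<in> S b"
    then obtain n \<tau> where x: "x = (\<Sum>i<n. norm (g (\<tau> (Suc i)) - g (\<tau> i)))"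
      and \<tau>: "mono_on {..n} \<tau>" "\<tau> ` {..n} \<subseteq> {0..b}"
      unfolding S_def by blast
    from \<tau>(2) that have "\<tau> ` {..n} \<subseteq> {0..t}" by force
    with \<tau>(1) show "x \<le> C" unfolding x by (rule C)
  qed
  have "norm (g b - g a) \<le> Sup (S b) - Sup (S a)" if ab: "0 \<le> a" "a \<le> b" "b \<le> t" for a b
  proof -
    have "(\<Sum>i<0. norm (g ((\<lambda>_. a) (Suc i)) - g ((\<lambda>_. a) i))) \<in> S a"
      unfolding S_def using ab by (intro CollectI exI[of _ 0] exI[of _ "\<lambda>_. a"]) (auto simp: mono_on_def)
    moreover have "x \<le> Sup (S b) - norm (g b - g a)" if x_in: "x \<in> S a" for x
    proof -
      obtain n \<tau> where x: "x = (\<Sum>i<n. norm (g (\<tau> (Suc i)) - g (\<tau> i)))"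
        and \<tau>: "mono_on {..n} \<tau>" "\<tau> ` {..n} \<subseteq> {0..a}"
        using x_in unfolding S_def by blast
      \<comment> \<open>Appending \<open>a\<close> and \<open>b\<close> to a subdivision of \<open>[0,a]\<close> adds at least \<open>norm (g b - g a)\<close>.\<close>
      define \<tau>' where "\<tau>' i = (if i \<le> n then \<tau> i else if i = Suc n then a else b)" for i
      have "mono_on {..Suc (Suc n)} \<tau>'" "\<tau>' ` {..Suc (Suc n)} \<subseteq> {0..b}"
        using \<tau> ab unfolding \<tau>'_def mono_on_def image_subset_iff
        by (auto split: if_splits) (meson atMost_iff order_trans)+
      then have "(\<Sum>i<Suc (Suc n). norm (g (\<tau>' (Suc i)) - g (\<tau>' i))) \<in> S b"
        unfolding S_def by blast
      then have "(\<Sum>i<Suc (Suc n). norm (g (\<tau>' (Suc i)) - g (\<tau>' i))) \<le> Sup (S b)"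
        using bdd ab by (intro cSup_upper) auto
      moreover have "(\<Sum>i<n. norm (g (\<tau>' (Suc i)) - g (\<tau>' i))) = x"
        unfolding x by (intro sum.cong) (auto simp: \<tau>'_def)
      ultimately have "x + norm (g a - g (\<tau> n)) + norm (g b - g a) \<le> Sup (S b)"
        by (simp add: \<tau>'_def)
      then show ?thesis using norm_ge_zero[of "g a - g (\<tau> n)"] by linarith
    qed
    ultimately have "Sup (S a) \<le> Sup (S b) - norm (g b - g a)"
      by (intro cSup_least) auto
    then show ?thesis by simp
  qed
  then have "increments_dominated t (\<lambda>b. Sup (S b)) g"
    by (auto simp: increments_dominated_def)
  then show thesis by (rule that)
qed

lemma step_integral_diff_le:
  assumes t: "0 \<le> t" and steps: "is_step \<sigma>" "is_step \<sigma>'"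
    and M: "\<And>s a b. s \<in> {0..t} \<Longrightarrow> a \<in> {0..t} \<Longrightarrow> b \<in> {0..t} \<Longrightarrow>
        norm (blinfun_apply (step_fun \<sigma> s - step_fun \<sigma>' s) (g b - g a)) \<le> M * norm (g b - g a)"
    and "0 \<le> M" and dom: "increments_dominated t v g"
  shows "norm (step_integral t g \<sigma> - step_integral t g \<sigma>') \<le> M * (v t - v 0)"
proof -
  define P where "P = {0, t} \<union> (\<Union>(a, b, c)\<in>set (snd \<sigma>) \<union> set (snd \<sigma>'). {min a t, min b t})"
  have "finite P" "P \<subseteq> {0..t}" "0 \<in> P" "t \<in> P"
    using t steps by (auto simp: P_def is_step_def)
  then obtain p :: "nat \<Rightarrow> real" and m where p: "strict_mono_on {..m} p" "p ` {..m} = P" "p 0 = 0" "p m = t"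
    by (rule finite_set_enumeration)
  have in_range: "p i \<in> {0..t}" if "i \<le> m" for i
    using p(2) \<open>P \<subseteq> {0..t}\<close> that by auto
  have mono: "p i \<le> p (Suc i)" if "i < m" for i
    using p(1) that by (auto simp: strict_mono_on_leD)
  have ends: "min a t \<in> P \<and> min b t \<in> P" if "(a, b, c) \<in> set (snd \<sigma>) \<union> set (snd \<sigma>')" for a b c
    using that unfolding P_def by blast
  have eq: "step_integral t g \<sigma> = (\<Sum>i<m. blinfun_apply (step_fun \<sigma> (p (Suc i))) (g (p (Suc i)) - g (p i)))"
    using p(1,3,4) steps ends by (intro step_integral_eq_sum) (auto simp: p(2))
  have eq': "step_integral t g \<sigma>' = (\<Sum>i<m. blinfun_apply (step_fun \<sigma>' (p (Suc i))) (g (p (Suc i)) - g (p i)))"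
    using p(1,3,4) steps ends by (intro step_integral_eq_sum) (auto simp: p(2))
  have "norm (step_integral t g \<sigma> - step_integral t g \<sigma>')
      = norm (\<Sum>i<m. blinfun_apply (step_fun \<sigma> (p (Suc i)) - step_fun \<sigma>' (p (Suc i))) (g (p (Suc i)) - g (p i)))"
    unfolding eq eq' by (simp add: sum_subtractf blinfun.diff_left)
  also have "\<dots> \<le> (\<Sum>i<m. M * (v (p (Suc i)) - v (p i)))"
  proof (rule sum_norm_le)
    fix i assume "i \<in> {..<m}"
    then have i: "i < m" by simp
    have "norm (blinfun_apply (step_fun \<sigma> (p (Suc i)) - step_fun \<sigma>' (p (Suc i))) (g (p (Suc i)) - g (p i)))
        \<le> M * norm (g (p (Suc i)) - g (p i))"
      using in_range i by (intro M) auto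
    also have "\<dots> \<le> M * (v (p (Suc i)) - v (p i))"
      using in_range[of i] in_range[of "Suc i"] mono i \<open>0 \<le> M\<close>
      by (intro mult_left_mono increments_dominatedD[OF dom]) auto
    finally show "norm (blinfun_apply (step_fun \<sigma> (p (Suc i)) - step_fun \<sigma>' (p (Suc i))) (g (p (Suc i)) - g (p i)))
        \<le> M * (v (p (Suc i)) - v (p i))" .
  qed
  also have "\<dots> = M * (v t - v 0)"
    using sum_lessThan_telescope[of "\<lambda>i. v (p i)" m] p by (simp add: sum_distrib_left[symmetric])
  finally show ?thesis .
qed

lemma compact_closure_of_totally_bounded:
  fixes S :: "'a::complete_space set"
  assumes "\<And>e. 0 < e \<Longrightarrow> \<exists>k. finite k \<and> S \<subseteq> (\<Union>x\<in>k. ball x e)"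
  shows "compact (closure S)"
  unfolding compact_eq_totally_bounded
proof (intro conjI allI impI)
  show "complete (closure S)"
    by (simp add: complete_eq_closed)
  fix e :: real assume e: "0 < e"
  then obtain k where k: "finite k" "S \<subseteq> (\<Union>x\<in>k. ball x (e/2))"
    using assms[of "e/2"] by auto
  then have "S \<subseteq> (\<Union>x\<in>k. cball x (e/2))"
    by force
  then have "closure S \<subseteq> (\<Union>x\<in>k. cball x (e/2))"
    using k(1) by (intro closure_minimal closed_UN) auto
  also have "\<dots> \<subseteq> (\<Union>x\<in>k. ball x e)"
    using e by force
  finally show "\<exists>k. finite k \<and> closure S \<subseteq> (\<Union>x\<in>k. ball x e)"
    using k(1) by blast
qed

text \<open>\<open>g\<close> factors through \<open>v\<close> as a Lipschitz map, and the range of \<open>v\<close> is a bounded set of reals. The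
  differences of points of this compact set form the set whose seminorm controls integrals against
  \<open>g\<close>.\<close>

lemma compact_range_of_dominated:
  fixes g :: "real \<Rightarrow> 'a::banach"
  assumes dom: "increments_dominated t v g"
  shows "compact (closure (g ` {0..t}))"
proof (rule compact_closure_of_totally_bounded)
  fix e :: real assume e: "0 < e"
  define fl where "fl s = \<lfloor>v s / e\<rfloor>" for s
  have "fl ` {0..t} \<subseteq> {fl 0..fl t}"
    using e dominating_mono[OF dom] by (auto simp: fl_def intro!: floor_mono divide_right_mono)
  then have fin: "finite (fl ` {0..t})"
    by (rule finite_subset) simp
  have "\<forall>j\<in>fl ` {0..t}. \<exists>s. s \<in> {0..t} \<and> fl s = j"
    by blast
  then obtain c where c: "\<And>j. j \<in> fl ` {0..t} \<Longrightarrow> c j \<in> {0..t} \<and> fl (c j) = j"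
    by metis
  have "g s \<in> ball (g (c (fl s))) e" if s: "s \<in> {0..t}" for s
  proof -
    have c': "c (fl s) \<in> {0..t}" "fl (c (fl s)) = fl s"
      using c s by auto
    have near: "\<bar>v s / e - v (c (fl s)) / e\<bar> < 1"
      using floor_correct[of "v s / e"] floor_correct[of "v (c (fl s)) / e"] c'(2)
      unfolding fl_def by linarith
    have "norm (g s - g (c (fl s))) \<le> \<bar>v s - v (c (fl s))\<bar>"
      using increments_dominatedD[OF dom, of s "c (fl s)"] increments_dominatedD[OF dom, of "c (fl s)" s]
        c'(1) s norm_minus_commute[of "g s" "g (c (fl s))"]
      by (cases "s \<le> c (fl s)") (simp_all del: minus_diff_eq)
    also have "\<dots> = e * \<bar>v s / e - v (c (fl s)) / e\<bar>"
      using e by (simp add: diff_divide_distrib[symmetric])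
    also have "\<dots> < e * 1"
      using e near by (intro mult_strict_left_mono) auto
    finally show ?thesis by (simp add: dist_norm norm_minus_commute)
  qed
  then have "g ` {0..t} \<subseteq> (\<Union>x\<in>g ` c ` fl ` {0..t}. ball x e)"
    by auto
  then show "\<exists>k. finite k \<and> g ` {0..t} \<subseteq> (\<Union>x\<in>k. ball x e)"
    using finite_imageI[OF finite_imageI[OF fin]] by (intro exI[of _ "g ` c ` fl ` {0..t}"] conjI)
qed

definition step_approximable :: "(real \<Rightarrow> 'a::real_normed_vector) \<Rightarrow> bool" where
  "step_approximable \<phi> \<longleftrightarrow>
     (\<forall>T\<ge>0. \<forall>\<delta>>0. \<exists>\<sigma>. is_step \<sigma> \<and> (\<forall>s\<in>{0..T}. norm (step_fun \<sigma> s - \<phi> s) < \<delta>))"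

text \<open>The filter in the definition of the integral need not be countably generated. The limit is first found
  along one sequence of step functions \<open>\<rho> k\<close> that approximate \<open>\<phi>\<close> in norm on \<open>[0,k]\<close>; this sequence also
  shows that the filter is nontrivial. Convergence along the whole filter follows because a
  step integral involves only the action on differences of values of \<open>g\<close>, and these lie in a
  compact set \<open>K\<close>, so that closeness in the single seminorm \<open>rho K\<close> is enough.\<close>

lemma norm_step_integral_minus_stieltjes_integral_le:
  fixes \<phi> :: "real \<Rightarrow> 'h::banach \<Rightarrow>\<^sub>L 'g::banach"
  assumes \<phi>: "step_approximable \<phi>" and t: "0 \<le> t" and dom: "increments_dominated t v g"
    and \<sigma>: "is_step \<sigma>" and near: "\<And>s. s \<in> {0..t} \<Longrightarrow> norm (step_fun \<sigma> s - \<phi> s) \<le> \<eta>"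
  shows "norm (step_integral t g \<sigma> - stieltjes_integral t \<phi> g) \<le> \<eta> * (v t - v 0)"
proof -
  have "\<exists>\<sigma>. is_step \<sigma> \<and> (\<forall>s\<in>{0..real k}. norm (step_fun \<sigma> s - \<phi> s) < inverse (real (Suc k)))" for k
    using \<phi> by (auto simp: step_approximable_def simp del: of_nat_Suc)
  then obtain \<rho> where \<rho>: "\<And>k. is_step (\<rho> k)"
    "\<And>k s. s \<in> {0..real k} \<Longrightarrow> norm (step_fun (\<rho> k) s - \<phi> s) < inverse (real (Suc k))"
    by metis
  define V where "V = v t - v 0"
  have V: "0 \<le> V"
    using dominating_mono[OF dom, of 0 t] t by (simp add: V_def)
  define close where "close \<sigma> M \<longleftrightarrow> 0 \<le> M \<and> (\<forall>s\<in>{0..t}. \<forall>a\<in>{0..t}. \<forall>b\<in>{0..t}.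
      norm (blinfun_apply (step_fun \<sigma> s - \<phi> s) (g b - g a)) \<le> M * norm (g b - g a))" for \<sigma> M
  have closeI: "close \<sigma> M" if "\<And>s. s \<in> {0..t} \<Longrightarrow> norm (step_fun \<sigma> s - \<phi> s) \<le> M" for \<sigma> M
  proof -
    have "norm (blinfun_apply (step_fun \<sigma> s - \<phi> s) h) \<le> M * norm h" if "s \<in> {0..t}" for s h
      using norm_blinfun[of "step_fun \<sigma> s - \<phi> s" h] \<open>\<And>s. s \<in> {0..t} \<Longrightarrow> norm (step_fun \<sigma> s - \<phi> s) \<le> M\<close>[OF that]
      by (meson mult_right_mono norm_ge_zero order_trans)
    moreover have "0 \<le> M"
      using that[of 0] t norm_ge_zero[of "step_fun \<sigma> 0 - \<phi> 0"] by (simp del: norm_ge_zero)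
    ultimately show ?thesis by (auto simp: close_def)
  qed
  have close_\<rho>: "close (\<rho> k) (inverse (real (Suc k)))" if "t \<le> real k" for k
    using \<rho>(2)[of _ k] that by (intro closeI less_imp_le) auto
  have diff: "norm (step_integral t g \<sigma> - step_integral t g \<sigma>') \<le> (M + M') * V"
    if "is_step \<sigma>" "is_step \<sigma>'" and c: "close \<sigma> M" "close \<sigma>' M'" for \<sigma> \<sigma>' M M'
    unfolding V_def
  proof (rule step_integral_diff_le[OF t that(1,2) _ _ dom])
    fix s a b assume "s \<in> {0..t}" "a \<in> {0..t}" "b \<in> {0..t}"
    then have "norm (blinfun_apply (step_fun \<sigma> s - \<phi> s) (g b - g a)) \<le> M * norm (g b - g a)"
       "norm (blinfun_apply (step_fun \<sigma>' s - \<phi> s) (g b - g a)) \<le> M' * norm (g b - g a)"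
      using c unfolding close_def by blast+
    moreover have "blinfun_apply (step_fun \<sigma> s - step_fun \<sigma>' s) (g b - g a) =
        blinfun_apply (step_fun \<sigma> s - \<phi> s) (g b - g a) - blinfun_apply (step_fun \<sigma>' s - \<phi> s) (g b - g a)"
      by (simp add: blinfun.diff_left)
    ultimately show "norm (blinfun_apply (step_fun \<sigma> s - step_fun \<sigma>' s) (g b - g a)) \<le> (M + M') * norm (g b - g a)"
      by (simp add: distrib_right) (use norm_triangle_ineq4 in \<open>smt (verit)\<close>)
  qed (use c in \<open>auto simp: close_def\<close>)
  define I where "I k = step_integral t g (\<rho> k)" for k
  obtain k0 :: nat where k0: "t \<le> real k0"
    using real_arch_simple by blast
  have tends: "(\<lambda>k. (M + inverse (real (Suc k))) * V) \<longlonglongrightarrow> M * V" for M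
    using tendsto_mult_right[OF tendsto_add[OF tendsto_const LIMSEQ_inverse_real_of_nat], of M V] by simp
  have "Cauchy I"
  proof (rule metric_CauchyI)
    fix e :: real assume e: "0 < e"
    then obtain k1 where k1: "\<And>k. k1 \<le> k \<Longrightarrow> norm ((0 + inverse (real (Suc k))) * V) < e / 2"
      using LIMSEQ_D[OF tends[of 0], of "e/2"] by (auto simp del: of_nat_Suc)
    have "dist (I j) (I k) < e" if "max k0 k1 \<le> j" "max k0 k1 \<le> k" for j k
    proof -
      have "norm (I j - I k) \<le> (inverse (real (Suc j)) + inverse (real (Suc k))) * V"
        unfolding I_def using k0 that by (intro diff close_\<rho> \<rho>(1)) auto
      also have "\<dots> < e"
        using k1[of j] k1[of k] that V by (simp add: distrib_right del: of_nat_Suc)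
      finally show ?thesis by (simp add: dist_norm)
    qed
    then show "\<exists>M. \<forall>m\<ge>M. \<forall>n\<ge>M. dist (I m) (I n) < e"
      by blast
  qed
  then obtain J where J: "I \<longlonglongrightarrow> J"
    using Cauchy_convergent convergent_def by blast
  have lim: "norm (step_integral t g \<sigma> - J) \<le> M * V" if "is_step \<sigma>" "close \<sigma> M" for \<sigma> M
  proof (rule tendsto_le[OF _ tends])
    show "(\<lambda>k. norm (step_integral t g \<sigma> - I k)) \<longlonglongrightarrow> norm (step_integral t g \<sigma> - J)"
      by (intro tendsto_intros J)
    show "\<forall>\<^sub>F k in sequentially. norm (step_integral t g \<sigma> - I k) \<le> (M + inverse (real (Suc k))) * V"
      using eventually_ge_at_top[of k0]
      by eventually_elim (unfold I_def, intro diff that \<rho>(1) close_\<rho>, use k0 in auto)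
  qed simp
  define Fl where "Fl = inf (filtercomap step_fun (nhds_ucp \<phi>)) (principal {\<sigma>. is_step \<sigma>})"
  have "filtermap \<rho> sequentially \<le> Fl"
    unfolding Fl_def le_inf_iff
  proof
    show "filtermap \<rho> sequentially \<le> principal {\<sigma>. is_step \<sigma>}"
      by (simp add: le_principal eventually_filtermap \<rho>)
    have "\<forall>\<^sub>F k in sequentially. \<forall>s\<in>{0..T}. rho K (step_fun (\<rho> k) s - \<phi> s) < \<delta>"
      if "0 < \<delta>" for K T \<delta>
    proof -
      obtain j :: nat where j: "T \<le> real j"
        using real_arch_simple by blast
      have "\<forall>\<^sub>F k in sequentially. inverse (real (Suc k)) < \<delta>"
        using order_tendstoD(2)[OF LIMSEQ_inverse_real_of_nat \<open>0 < \<delta>\<close>] .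
      then show ?thesis
        using eventually_ge_at_top[of j]
      proof eventually_elim
        case (elim k)
        show ?case
        proof
          fix s assume "s \<in> {0..T}"
          then have "norm (step_fun (\<rho> k) s - \<phi> s) < \<delta>"
            using \<rho>(2)[of s k] elim j by (auto simp del: of_nat_Suc)
          then show "rho K (step_fun (\<rho> k) s - \<phi> s) < \<delta>"
            using rho_le_norm by (rule le_less_trans[rotated])
        qed
      qed
    qed
    then have "filterlim (\<lambda>k. step_fun (\<rho> k)) (nhds_ucp \<phi>) sequentially"
      unfolding nhds_ucp_def by (auto simp: filterlim_INF filterlim_principal)
    then have "filterlim \<rho> (filtercomap step_fun (nhds_ucp \<phi>)) sequentially"
      by (simp add: filterlim_filtercomap_iff comp_def)
    then show "filtermap \<rho> sequentially \<le> filtercomap step_fun (nhds_ucp \<phi>)"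
      by (simp add: filterlim_def)
  qed
  then have nontrivial: "Fl \<noteq> bot"
    by (metis bot.extremum_uniqueI filtermap_bot_iff sequentially_bot)
  have "(step_integral t g \<longlongrightarrow> J) Fl"
  proof (rule tendstoI)
    fix e :: real assume e: "0 < e"
    define K where "K = (\<lambda>(x, y). x - y) ` (closure (g ` {0..t}) \<times> closure (g ` {0..t}))"
    have K: "compact K"
      unfolding K_def using compact_range_of_dominated[OF dom]
      by (intro compact_continuous_image compact_Times) (auto simp: case_prod_unfold intro!: continuous_intros)
    have in_K: "g b - g a \<in> K" if "a \<in> {0..t}" "b \<in> {0..t}" for a b
      unfolding K_def using that closure_subset[of "g ` {0..t}"] by (force intro!: image_eqI[of _ _ "(g b, g a)"])
    define \<delta> where "\<delta> = e / (V + 1)"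
    have \<delta>: "0 < \<delta>" "\<delta> * V < e"
      using e V by (auto simp: \<delta>_def field_simps)
    have "nhds_ucp \<phi> \<le> principal {\<psi>. \<forall>s\<in>{0..t}. rho K (\<psi> s - \<phi> s) < \<delta>}"
      unfolding nhds_ucp_def using K t \<delta> by (intro INF_lower2[of "(K, t, \<delta>)"]) auto
    then have "\<forall>\<^sub>F \<psi> in nhds_ucp \<phi>. \<forall>s\<in>{0..t}. rho K (\<psi> s - \<phi> s) < \<delta>"
      by (simp add: le_principal)
    then have "\<forall>\<^sub>F \<sigma> in filtercomap step_fun (nhds_ucp \<phi>). \<forall>s\<in>{0..t}. rho K (step_fun \<sigma> s - \<phi> s) < \<delta>"
      by (rule eventually_filtercomapI)
    then have "\<forall>\<^sub>F \<sigma> in Fl. \<forall>s\<in>{0..t}. rho K (step_fun \<sigma> s - \<phi> s) < \<delta>"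
      unfolding Fl_def by (rule filter_leD[OF inf_le1])
    moreover have "\<forall>\<^sub>F \<sigma> in Fl. is_step \<sigma>"
      unfolding Fl_def eventually_inf_principal by simp
    ultimately show "\<forall>\<^sub>F \<sigma> in Fl. dist (step_integral t g \<sigma>) J < e"
    proof eventually_elim
      case (elim \<sigma>)
      have "close \<sigma> \<delta>"
        unfolding close_def
      proof (intro conjI ballI)
        fix s a b assume s: "s \<in> {0..t}" "a \<in> {0..t}" "b \<in> {0..t}"
        then obtain C where "C < \<delta>" "\<And>x. x \<in> K \<Longrightarrow> norm (blinfun_apply (step_fun \<sigma> s - \<phi> s) x) \<le> C * norm x"
          using elim(1) rho_lessD by blast
        then show "norm (blinfun_apply (step_fun \<sigma> s - \<phi> s) (g b - g a)) \<le> \<delta> * norm (g b - g a)"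
          using in_K[OF s(2,3)] by (meson less_imp_le mult_right_mono norm_ge_zero order_trans)
      qed (use \<delta> in simp)
      then have "norm (step_integral t g \<sigma> - J) \<le> \<delta> * V"
        using elim(2) by (intro lim)
      then show ?case using \<delta>(2) by (simp add: dist_norm)
    qed
  qed
  then have "stieltjes_integral t \<phi> g = J"
    using nontrivial unfolding stieltjes_integral_def Fl_def[symmetric] by (intro tendsto_Lim)
  then show ?thesis
    using lim[OF \<sigma> closeI[OF near]] by (simp add: V_def)
qed

section \<open>Right continuous paths with left limits\<close>

lemma cadlag_right: "cadlag X \<Longrightarrow> 0 \<le> t \<Longrightarrow> (X \<longlongrightarrow> X t) (at_right t)"
  by (simp add: cadlag_def)

lemma cadlag_left_lim:
  fixes X :: "real \<Rightarrow> 'a::t2_space"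
  assumes "cadlag X" "0 < t"
  shows "(X \<longlongrightarrow> left_lim X t) (at_left t)"
proof -
  obtain l where "(X \<longlongrightarrow> l) (at_left t)"
    using assms by (auto simp: cadlag_def)
  moreover from this have "left_lim X t = l"
    using assms(2) by (simp add: left_lim_def tendsto_Lim)
  ultimately show ?thesis by simp
qed

lemma left_lim_eqI: "(X \<longlongrightarrow> l) (at_left t) \<Longrightarrow> 0 < t \<Longrightarrow> left_lim X t = l"
  by (simp add: left_lim_def tendsto_Lim)

lemma cadlag_compose:
  fixes X :: "real \<Rightarrow> 'a::t2_space" and \<Phi> :: "'a \<Rightarrow> 'b::t2_space"
  assumes "cadlag X" "continuous_on UNIV \<Phi>"
  shows "cadlag (\<lambda>t. \<Phi> (X t))" "0 \<le> t \<Longrightarrow> left_lim (\<lambda>t. \<Phi> (X t)) t = \<Phi> (left_lim X t)"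
proof -
  have iso: "isCont \<Phi> x" for x
    using assms(2) by (simp add: continuous_on_eq_continuous_at)
  have left: "((\<lambda>t. \<Phi> (X t)) \<longlongrightarrow> \<Phi> (left_lim X t)) (at_left t)" if "0 < t" for t
    using isCont_tendsto_compose[OF iso cadlag_left_lim[OF assms(1) that]] .
  then show "cadlag (\<lambda>t. \<Phi> (X t))"
    unfolding cadlag_def using isCont_tendsto_compose[OF iso cadlag_right[OF assms(1)]] by blast
  show "left_lim (\<lambda>t. \<Phi> (X t)) t = \<Phi> (left_lim X t)" if "0 \<le> t"
    using left_lim_eqI[OF left] that by (cases "t = 0") (auto simp: left_lim_def)
qed

lemma ex_left_open_interval:
  fixes p :: "nat \<Rightarrow> real"
  assumes "p 0 < s" "s \<le> p m"
  shows "\<exists>i<m. p i < s \<and> s \<le> p (Suc i)"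
proof -
  define k where "k = (LEAST k. s \<le> p k)"
  have k: "s \<le> p k" "k \<le> m"
    unfolding k_def using assms(2) by (auto intro: LeastI Least_le)
  with assms(1) have "k \<noteq> 0" by (metis not_le)
  then obtain i where i: "k = Suc i" by (cases k) auto
  have "p i < s"
    using not_less_Least[of i "\<lambda>k. s \<le> p k"] i by (auto simp: k_def)
  with i k show ?thesis by (intro exI[of _ i]) simp
qed

lemma ex_right_open_interval:
  fixes p :: "nat \<Rightarrow> real"
  assumes "p 0 \<le> s" "s < p m"
  shows "\<exists>i<m. p i \<le> s \<and> s < p (Suc i)"
proof -
  define k where "k = (LEAST k. s < p k)"
  have k: "s < p k" "k \<le> m"
    unfolding k_def using assms(2) by (auto intro: LeastI Least_le)
  with assms(1) have "k \<noteq> 0" by (metis not_le)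
  then obtain i where i: "k = Suc i" by (cases k) auto
  have "p i \<le> s"
    using not_less_Least[of i "\<lambda>k. s < p k"] i by (auto simp: k_def)
  with i k show ?thesis by (intro exI[of _ i]) simp
qed

text \<open>The intervals between knots are half-open because \<open>Y\<close> may jump at the knots.\<close>

definition knots :: "real \<Rightarrow> real \<Rightarrow> (real \<Rightarrow> 'a::real_normed_vector) \<Rightarrow> (nat \<Rightarrow> real) \<Rightarrow> nat \<Rightarrow> bool" where
  "knots \<eta> t Y p m \<longleftrightarrow> strict_mono_on {..m} p \<and> p 0 = 0 \<and> p m = t \<and>
     (\<forall>i<m. \<forall>s. p i \<le> s \<and> s < p (Suc i) \<longrightarrow> norm (Y s - Y (p i)) < \<eta>)"

text \<open>Around every point, three knots (the point and the ends of a short interval) suffice, by the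
  existence of one-sided limits, and admissible finite sets for adjacent intervals can be united. Bisection does
  the rest. Finite sets are used in place of sequences because they are easy to unite.\<close>

lemma cadlag_knots:
  fixes Y :: "real \<Rightarrow> 'a::real_normed_vector"
  assumes Y: "cadlag Y" and t: "0 \<le> t" and \<eta>: "0 < \<eta>"
  obtains p m where "knots \<eta> t Y p m"
proof -
  define steady where "steady P a b \<longleftrightarrow> (\<forall>s s'. a \<le> s \<longrightarrow> s \<le> s' \<longrightarrow> s' \<le> b \<longrightarrow> {s<..s'} \<inter> P = {} \<longrightarrow>
      norm (Y s' - Y s) < \<eta>)" for P a b
  define Q where "Q a b \<longleftrightarrow> (0 \<le> a \<longrightarrow>
      (\<exists>P. finite P \<and> P \<subseteq> {a..b} \<and> a \<in> P \<and> b \<in> P \<and> steady P a b))" for a b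
  have "Q 0 t"
    using t
  proof (induction rule: Bolzano)
    case (trans a b c)
    show ?case
      unfolding Q_def
    proof
      assume a: "0 \<le> a"
      obtain P where P: "finite P" "P \<subseteq> {a..b}" "a \<in> P" "b \<in> P" "steady P a b"
        using trans(1) a unfolding Q_def by blast
      obtain P' where P': "finite P'" "P' \<subseteq> {b..c}" "b \<in> P'" "c \<in> P'" "steady P' b c"
        using trans(2,3) a unfolding Q_def by (meson order_trans)
      have "norm (Y s' - Y s) < \<eta>"
        if s: "a \<le> s" "s \<le> s'" "s' \<le> c" "{s<..s'} \<inter> (P \<union> P') = {}" for s s'
      proof (cases "b \<le> s")
        case True
        then show ?thesis using P'(5)[unfolded steady_def, rule_format, of s s'] s by blast
      next
        case False
        have "b \<notin> {s<..s'}"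
          using s(4) P(4) by blast
        then have "s' \<le> b"
          using False by simp
        then show ?thesis using P(5)[unfolded steady_def, rule_format, of s s'] s by blast
      qed
      then have "steady (P \<union> P') a c"
        unfolding steady_def by blast
      moreover have "finite (P \<union> P')" "P \<union> P' \<subseteq> {a..c}" "a \<in> P \<union> P'" "c \<in> P \<union> P'"
        using P(1-4) P'(1-4) trans(3,4) by auto
      ultimately show "\<exists>P. finite P \<and> P \<subseteq> {a..c} \<and> a \<in> P \<and> c \<in> P \<and> steady P a c"
        by blast
    qed
  next
    case (local x)
    have right: "\<forall>\<^sub>F s in at_right x. dist (Y s) (Y x) < \<eta> / 2"
      using tendstoD[OF cadlag_right[OF Y local(1)], of "\<eta>/2"] \<eta> by simp
    then obtain d1 where d1: "x < d1" "\<And>s. x < s \<Longrightarrow> s < d1 \<Longrightarrow> dist (Y s) (Y x) < \<eta> / 2"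
      unfolding eventually_at_right_field by blast
    have "\<exists>d2<x. \<forall>s. 0 < x \<longrightarrow> d2 < s \<and> s < x \<longrightarrow> dist (Y s) (left_lim Y x) < \<eta> / 2"
    proof (cases "0 < x")
      case True
      then have "\<forall>\<^sub>F s in at_left x. dist (Y s) (left_lim Y x) < \<eta> / 2"
        using tendstoD[OF cadlag_left_lim[OF Y True], of "\<eta>/2"] \<eta> by simp
      then show ?thesis
        unfolding eventually_at_left_field by auto
    qed (auto intro: exI[of _ "x - 1"])
    then obtain d2 where d2: "d2 < x"
      "\<And>s. 0 < x \<Longrightarrow> d2 < s \<Longrightarrow> s < x \<Longrightarrow> dist (Y s) (left_lim Y x) < \<eta> / 2"
      by blast
    have "Q a b" if ab: "a \<le> x" "x \<le> b" "b - a < min (d1 - x) (x - d2)" for a b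
      unfolding Q_def
    proof
      assume a: "0 \<le> a"
      have "norm (Y s' - Y s) < \<eta>"
        if s: "a \<le> s" "s \<le> s'" "s' \<le> b" "{s<..s'} \<inter> {a, x, b} = {}" for s s'
      proof (cases "s = s'")
        case False
        then have "x \<le> s \<or> s' < x" using s by auto
        then show ?thesis
        proof
          assume "x \<le> s"
          then have "dist (Y s) (Y x) < \<eta> / 2" "dist (Y s') (Y x) < \<eta> / 2"
            using d1(2)[of s] d1(2)[of s'] \<eta> s ab by (cases "s = x"; cases "s' = x"; auto)+
          then have "dist (Y s') (Y s) < \<eta>"
            by (metis dist_commute dist_triangle_half_l)
          then show ?thesis by (simp add: dist_norm)
        next
          assume x: "s' < x"
          then have "dist (Y s) (left_lim Y x) < \<eta> / 2" "dist (Y s') (left_lim Y x) < \<eta> / 2"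
            using d2(2)[of s] d2(2)[of s'] s ab a by auto
          then have "dist (Y s') (Y s) < \<eta>"
            by (metis dist_commute dist_triangle_half_l)
          then show ?thesis by (simp add: dist_norm)
        qed
      qed (use \<eta> in simp)
      then have "steady {a, x, b} a b"
        unfolding steady_def by blast
      moreover have "finite {a, x, b}" "{a, x, b} \<subseteq> {a..b}" "a \<in> {a, x, b}" "b \<in> {a, x, b}"
        using ab by auto
      ultimately show "\<exists>P. finite P \<and> P \<subseteq> {a..b} \<and> a \<in> P \<and> b \<in> P \<and> steady P a b"
        by blast
    qed
    then show ?case
      using d1(1) d2(1) by (intro exI[of _ "min (d1 - x) (x - d2)"]) auto
  qed
  then obtain P where P: "finite P" "P \<subseteq> {0..t}" "0 \<in> P" "t \<in> P" "steady P 0 t"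
    unfolding Q_def by blast
  obtain p :: "nat \<Rightarrow> real" and m where p: "strict_mono_on {..m} p" "p ` {..m} = P" "p 0 = 0" "p m = t"
    using finite_set_enumeration[OF P(1-4)] .
  have "norm (Y s - Y (p i)) < \<eta>" if i: "i < m" and s: "p i \<le> s" "s < p (Suc i)" for i s
  proof (rule P(5)[unfolded steady_def, rule_format])
    show "{p i<..s} \<inter> P = {}"
    proof (rule ccontr)
      assume "{p i<..s} \<inter> P \<noteq> {}"
      then obtain j where "j \<le> m" "p j \<in> {p i<..s}"
        unfolding p(2)[symmetric] by blast
      with s(2) have j: "j \<le> m" "p i < p j" "p j < p (Suc i)"
        by auto
      then have "i < j" "j < Suc i"
        using strict_mono_on_less[OF p(1)] i by auto
      then show False by simp
    qed
    have "p i \<in> P" "p (Suc i) \<in> P"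
      using p(2) i by auto
    then show "0 \<le> p i" "s \<le> t"
      using P(2) s by auto
  qed (use s in simp)
  then have "knots \<eta> t Y p m"
    using p by (simp add: knots_def)
  then show thesis by (rule that)
qed

lemma knotsD:
  assumes "knots \<eta> t Y p m"
  shows "strict_mono_on {..m} p" "p 0 = 0" "p m = t" "i < m \<Longrightarrow> p i < p (Suc i)"
    "i \<le> m \<Longrightarrow> p i \<in> {0..t}"
    "i < m \<Longrightarrow> p i \<le> s \<Longrightarrow> s < p (Suc i) \<Longrightarrow> norm (Y s - Y (p i)) < \<eta>"
proof -
  show m: "strict_mono_on {..m} p" and "p 0 = 0" "p m = t"
    "i < m \<Longrightarrow> p i \<le> s \<Longrightarrow> s < p (Suc i) \<Longrightarrow> norm (Y s - Y (p i)) < \<eta>"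
    using assms by (auto simp: knots_def)
  show "i < m \<Longrightarrow> p i < p (Suc i)"
    using strict_mono_onD[OF m, of i "Suc i"] by auto
  show "i \<le> m \<Longrightarrow> p i \<in> {0..t}"
    using strict_mono_on_leD[OF m, of 0 i] strict_mono_on_leD[OF m, of i m] assms
    by (auto simp: knots_def)
qed

lemma knots_left_lim:
  assumes Y: "cadlag Y" and k: "knots \<eta> t Y p m" and i: "i < m" and u: "p i < u" "u \<le> p (Suc i)"
  shows "norm (left_lim Y u - Y (p i)) \<le> \<eta>"
proof -
  have u0: "0 < u" using knotsD(5)[OF k, of i] i u by simp
  have "((\<lambda>s. norm (Y s - Y (p i))) \<longlongrightarrow> norm (left_lim Y u - Y (p i))) (at_left u)"
    by (intro tendsto_intros cadlag_left_lim Y u0)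
  moreover have "\<forall>\<^sub>F s in at_left u. norm (Y s - Y (p i)) \<le> \<eta>"
    unfolding eventually_at_left_field
    using knotsD(6)[OF k i] u by (intro exI[of _ "p i"]) (auto intro: less_imp_le)
  ultimately show ?thesis
    by (rule tendsto_upperbound) simp
qed

text \<open>Away from the knots the jumps are at most twice as large as the oscillation between knots.\<close>

lemma finite_big_jumps:
  fixes Y :: "real \<Rightarrow> 'a::real_normed_vector"
  assumes Y: "cadlag Y" and t: "0 \<le> t" and \<epsilon>: "0 < \<epsilon>"
  shows "finite {u\<in>{0<..t}. \<epsilon> \<le> norm (jump Y u)}"
proof -
  obtain p m where k: "knots (\<epsilon>/3) t Y p m"
    using cadlag_knots[OF Y t, of "\<epsilon>/3"] \<epsilon> by auto
  have "u \<in> p ` {..m}" if u: "u \<in> {0<..t}" "\<epsilon> \<le> norm (jump Y u)" for u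
  proof -
    obtain i where i: "i < m" "p i < u" "u \<le> p (Suc i)"
      using ex_left_open_interval[of p u m] u(1) knotsD[OF k] by auto
    show ?thesis
    proof (cases "u = p (Suc i)")
      case False
      then have "norm (Y u - Y (p i)) < \<epsilon>/3"
        using knotsD(6)[OF k i(1)] i by auto
      moreover have "norm (left_lim Y u - Y (p i)) \<le> \<epsilon>/3"
        using knots_left_lim[OF Y k i] .
      ultimately have "norm (jump Y u) < \<epsilon>"
        using norm_triangle_ineq4[of "Y u - Y (p i)" "left_lim Y u - Y (p i)"] \<epsilon> by (simp add: jump_def)
      then show ?thesis using u by simp
    qed (use i in auto)
  qed
  then have "{u\<in>{0<..t}. \<epsilon> \<le> norm (jump Y u)} \<subseteq> p ` {..m}"
    by blast
  then show ?thesis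
    by (rule finite_subset) simp
qed

lemma compact_range_of_cadlag:
  fixes Y :: "real \<Rightarrow> 'a::banach"
  assumes Y: "cadlag Y" and t: "0 \<le> t"
  shows "compact (closure (Y ` {0..t}))"
proof (rule compact_closure_of_totally_bounded)
  fix e :: real assume e: "0 < e"
  obtain p m where k: "knots e t Y p m"
    using cadlag_knots[OF Y t e] .
  have "Y s \<in> (\<Union>x\<in>(\<lambda>i. Y (p i)) ` {..m}. ball x e)" if s: "s \<in> {0..t}" for s
  proof (cases "s = t")
    case True
    then show ?thesis using knotsD(3)[OF k] e by (auto intro!: bexI[of _ m])
  next
    case False
    then obtain i where i: "i < m" "p i \<le> s" "s < p (Suc i)"
      using ex_right_open_interval[of p s m] s knotsD[OF k] by auto
    then have "Y s \<in> ball (Y (p i)) e"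
      using knotsD(6)[OF k i] by (simp add: dist_norm norm_minus_commute)
    then show ?thesis using i by auto
  qed
  then have "Y ` {0..t} \<subseteq> (\<Union>x\<in>(\<lambda>i. Y (p i)) ` {..m}. ball x e)"
    by (rule image_subsetI)
  then show "\<exists>k. finite k \<and> Y ` {0..t} \<subseteq> (\<Union>x\<in>k. ball x e)"
    by (intro exI[of _ "(\<lambda>i. Y (p i)) ` {..m}"] conjI finite_imageI finite_atMost)
qed

lemma left_lim_in_closure:
  assumes Y: "cadlag Y" and u: "u \<in> {0..t}"
  shows "left_lim Y u \<in> closure (Y ` {0..t})"
proof (cases "u = 0")
  case True
  then show ?thesis using u closure_subset[of "Y ` {0..t}"] by (auto simp: left_lim_def)
next
  case False
  then have u0: "0 < u" using u by simp
  have "\<forall>\<^sub>F s in at_left u. Y s \<in> closure (Y ` {0..t})"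
    unfolding eventually_at_left_field
    using u u0 closure_subset[of "Y ` {0..t}"] by (intro exI[of _ 0]) force
  then show ?thesis
    by (rule Lim_in_closed_set[OF closed_closure]) (use cadlag_left_lim[OF Y u0] in auto)
qed

definition knot_step :: "(real \<Rightarrow> 'a) \<Rightarrow> (nat \<Rightarrow> real) \<Rightarrow> nat \<Rightarrow> 'a step" where
  "knot_step Y p m = (Y 0, map (\<lambda>i. (p i, p (Suc i), Y (p i))) [0..<m])"

lemma is_step_knot_step: "knots \<eta> t Y p m \<Longrightarrow> is_step (knot_step Y p m)"
  using knotsD(4)[of \<eta> t Y p m] knotsD(5)[of \<eta> t Y p m]
  by (auto simp: is_step_def knot_step_def intro: less_imp_le)

lemma norm_knot_step_minus_left_lim:
  assumes Y: "cadlag Y" and k: "knots \<eta> t Y p m" and \<eta>: "0 < \<eta>" and s: "s \<in> {0..t}"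
  shows "norm (step_fun (knot_step Y p m) s - left_lim Y s) \<le> \<eta>"
proof -
  have eq: "step_fun (knot_step Y p m) s =
      indicat_real {0} s *\<^sub>R Y 0 + (\<Sum>i<m. indicat_real {p i<..p (Suc i)} s *\<^sub>R Y (p i))"
    unfolding step_fun_def knot_step_def
    by (simp add: comp_def interv_sum_list_conv_sum_set_nat atLeast0LessThan)
  show ?thesis
  proof (cases "s = 0")
    case True
    then have "(\<Sum>i<m. indicat_real {p i<..p (Suc i)} s *\<^sub>R Y (p i)) = 0"
      using knotsD(5)[OF k] by (intro sum.neutral) (simp add: indicator_def not_less)
    then show ?thesis using True \<eta> unfolding eq by (simp add: left_lim_def)
  next
    case False
    then obtain i where i: "i < m" "p i < s" "s \<le> p (Suc i)"
      using ex_left_open_interval[of p s m] s knotsD[OF k] by auto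
    have "indicat_real {p j<..p (Suc j)} s *\<^sub>R Y (p j) = (if j = i then Y (p i) else 0)" if "j < m" for j
    proof -
      have "j = i" if "p j < s" "s \<le> p (Suc j)"
      proof -
        have "p j < p (Suc i)" "p i < p (Suc j)" using i that by auto
        then have "j < Suc i" "i < Suc j"
          using strict_mono_on_less[OF knotsD(1)[OF k], of j "Suc i"]
            strict_mono_on_less[OF knotsD(1)[OF k], of i "Suc j"] i(1) \<open>j < m\<close> by simp_all
        then show ?thesis by simp
      qed
      then show ?thesis using i by (cases "j = i") (auto simp: indicator_def)
    qed
    then have "(\<Sum>i<m. indicat_real {p i<..p (Suc i)} s *\<^sub>R Y (p i)) = Y (p i)"
      using i(1) by (simp add: sum.delta)
    then show ?thesis
      using knots_left_lim[OF Y k i] False norm_minus_commute[of "Y (p i)" "left_lim Y s"]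
      unfolding eq by simp
  qed
qed

lemma step_integral_knot_step:
  assumes k: "knots \<eta> t Y p m"
  shows "step_integral t g (knot_step Y p m) = (\<Sum>i<m. blinfun_apply (Y (p i)) (g (p (Suc i)) - g (p i)))"
proof -
  have "step_integral t g (knot_step Y p m)
      = (\<Sum>i<m. blinfun_apply (Y (p i)) (g (min (p (Suc i)) t) - g (min (p i) t)))"
    unfolding step_integral_def knot_step_def
    by (simp add: comp_def interv_sum_list_conv_sum_set_nat atLeast0LessThan)
  also have "\<dots> = (\<Sum>i<m. blinfun_apply (Y (p i)) (g (p (Suc i)) - g (p i)))"
    using knotsD(5)[OF k] by (intro sum.cong) (auto simp: min_absorb1)
  finally show ?thesis .
qed

lemma step_approximable_left_lim:
  fixes Y :: "real \<Rightarrow> 'a::real_normed_vector"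
  assumes Y: "cadlag Y"
  shows "step_approximable (left_lim Y)"
  unfolding step_approximable_def
proof (intro allI impI)
  fix T \<delta> :: real assume "0 \<le> T" "0 < \<delta>"
  then obtain p m where k: "knots (\<delta>/2) T Y p m"
    using cadlag_knots[OF Y, of T "\<delta>/2"] by auto
  have "norm (step_fun (knot_step Y p m) s - left_lim Y s) < \<delta>" if "s \<in> {0..T}" for s
    using norm_knot_step_minus_left_lim[OF Y k _ that] \<open>0 < \<delta>\<close> by simp
  then show "\<exists>\<sigma>. is_step \<sigma> \<and> (\<forall>s\<in>{0..T}. norm (step_fun \<sigma> s - left_lim Y s) < \<delta>)"
    using is_step_knot_step[OF k] by blast
qed

section \<open>Jumps of Stieltjes integrators\<close>

lemma has_sum_diff:
  fixes f g :: "'a \<Rightarrow> 'b::topological_ab_group_add"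
  assumes "(f has_sum a) A" "(g has_sum b) A"
  shows "((\<lambda>x. f x - g x) has_sum (a - b)) A"
  using has_sum_add[OF assms(1), of "\<lambda>x. - g x" "- b"] assms(2) by (simp add: has_sum_uminus)

text \<open>Induction on the largest jump time \<open>c\<close>: the increase of \<open>v\<close> up to a time shortly before \<open>c\<close> pays for the
  earlier jumps and the increase from there to \<open>c\<close> for the jump at \<open>c\<close>.\<close>

lemma sum_norm_jump_le:
  fixes g :: "real \<Rightarrow> 'a::real_normed_vector"
  assumes g: "cadlag g" and dom: "increments_dominated t v g"
    and U: "finite U" "U \<subseteq> {0<..t}" and t: "0 \<le> t"
  shows "(\<Sum>u\<in>U. norm (jump g u)) \<le> v t - v 0"
proof -
  have "\<forall>b. 0 \<le> b \<longrightarrow> b \<le> t \<longrightarrow> U \<subseteq> {0<..b} \<longrightarrow> (\<Sum>u\<in>U. norm (jump g u)) \<le> v b - v 0"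
    using U(1)
  proof (induction rule: finite_linorder_max_induct)
    case empty
    then show ?case using dominating_mono[OF dom] by auto
  next
    case (insert c A)
    show ?case
    proof (intro allI impI)
      fix b assume b: "0 \<le> b" "b \<le> t" "insert c A \<subseteq> {0<..b}"
      define a where "a = Max (insert 0 A)"
      have a: "0 \<le> a" "a < c" "\<And>x. x \<in> A \<Longrightarrow> x \<le> a"
        using insert.hyps b(3) unfolding a_def by auto
      have c: "0 < c" "c \<le> b" "c \<le> t" using b by auto
      have "(\<Sum>u\<in>A. norm (jump g u)) + norm (g c - g s) \<le> v c - v 0" if s: "a < s" "s < c" for s
      proof -
        have "A \<subseteq> {0<..s}"
          using a(3) s(1) b(3) by fastforce
        then have "(\<Sum>u\<in>A. norm (jump g u)) \<le> v s - v 0"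
          using insert.IH[rule_format, of s] s a c by simp
        moreover have "norm (g c - g s) \<le> v c - v s"
          using s a c by (intro increments_dominatedD[OF dom]) auto
        ultimately show ?thesis by simp
      qed
      then have ev: "\<forall>\<^sub>F s in at_left c. (\<Sum>u\<in>A. norm (jump g u)) + norm (g c - g s) \<le> v c - v 0"
        unfolding eventually_at_left_field using a(2) by blast
      have "((\<lambda>s. (\<Sum>u\<in>A. norm (jump g u)) + norm (g c - g s)) \<longlongrightarrow>
          (\<Sum>u\<in>A. norm (jump g u)) + norm (g c - left_lim g c)) (at_left c)"
        by (intro tendsto_intros cadlag_left_lim g c)
      from tendsto_upperbound[OF this ev] have "(\<Sum>u\<in>A. norm (jump g u)) + norm (jump g c) \<le> v c - v 0"
        by (simp add: jump_def)
      moreover have "c \<notin> A" using insert.hyps by blast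
      moreover have "v c \<le> v b" using c b by (intro dominating_mono[OF dom]) auto
      ultimately show "(\<Sum>u\<in>insert c A. norm (jump g u)) \<le> v b - v 0"
        using insert.hyps(1) by simp
    qed
  qed
  then show ?thesis using U(2) t by blast
qed

lemma tendsto_step_integral:
  fixes \<phi> :: "real \<Rightarrow> 'h::banach \<Rightarrow>\<^sub>L 'g::banach"
  assumes \<phi>: "step_approximable \<phi>" and t: "0 \<le> t" and dom: "increments_dominated t v g"
    and \<sigma>: "\<And>k. is_step (\<sigma> k)"
    and near: "\<And>k s. s \<in> {0..t} \<Longrightarrow> norm (step_fun (\<sigma> k) s - \<phi> s) \<le> inverse (real (Suc k))"
  shows "(\<lambda>k. step_integral t g (\<sigma> k)) \<longlonglongrightarrow> stieltjes_integral t \<phi> g"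
proof (rule LIM_zero_cancel, rule Lim_null_comparison)
  show "\<forall>\<^sub>F k in sequentially. norm (step_integral t g (\<sigma> k) - stieltjes_integral t \<phi> g)
      \<le> inverse (real (Suc k)) * (v t - v 0)"
    by (intro always_eventually allI norm_step_integral_minus_stieltjes_integral_le[OF \<phi> t dom] \<sigma> near)
  show "(\<lambda>k. inverse (real (Suc k)) * (v t - v 0)) \<longlonglongrightarrow> 0"
    using tendsto_mult_right[OF LIMSEQ_inverse_real_of_nat, of "v t - v 0"] by simp
qed

lemma bounded_step_fun:
  fixes \<sigma> :: "'a::real_normed_vector step"
  shows "norm (step_fun \<sigma> s) \<le> norm (fst \<sigma>) + (\<Sum>(a, b, c)\<leftarrow>snd \<sigma>. norm c)"
proof -
  have "norm (\<Sum>(a, b, c)\<leftarrow>xs. indicat_real {a<..b} s *\<^sub>R c) \<le> (\<Sum>(a, b, c)\<leftarrow>xs. norm c)"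
    for xs :: "(real \<times> real \<times> 'a) list"
  proof (induction xs)
    case (Cons x xs)
    obtain a b c where x: "x = (a, b, c)" by (cases x)
    have "norm (indicat_real {a<..b} s *\<^sub>R c) \<le> norm c"
      by (simp add: indicator_def)
    then show ?case
      using Cons by (auto simp: x intro!: norm_triangle_le add_mono)
  qed simp
  moreover have "norm (indicat_real {0} s *\<^sub>R fst \<sigma>) \<le> norm (fst \<sigma>)"
    by (simp add: indicator_def)
  ultimately show ?thesis
    unfolding step_fun_def by (intro norm_triangle_le add_mono)
qed

lemma step_approximable_bounded:
  assumes "step_approximable \<phi>" "0 \<le> t"
  obtains C where "\<And>s. s \<in> {0..t} \<Longrightarrow> norm (\<phi> s) \<le> C"
proof -
  obtain \<sigma> where \<sigma>: "\<And>s. s \<in> {0..t} \<Longrightarrow> norm (step_fun \<sigma> s - \<phi> s) < 1"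
    using assms zero_less_one unfolding step_approximable_def by metis
  define C where "C = norm (fst \<sigma>) + (\<Sum>(a, b, c)\<leftarrow>snd \<sigma>. norm c) + 1"
  have "norm (\<phi> s) \<le> C" if "s \<in> {0..t}" for s
    using \<sigma>[OF that] bounded_step_fun[of \<sigma> s] norm_triangle_sub[of "\<phi> s" "step_fun \<sigma> s"]
    by (simp add: C_def norm_minus_commute)
  then show thesis by (rule that)
qed

lemma has_sum_step_integral_pure_jump:
  fixes D :: "real \<Rightarrow> 'h::banach" and \<sigma> :: "('h \<Rightarrow>\<^sub>L 'g::banach) step"
  assumes D: "D summable_on {0<..t}" and t: "0 \<le> t" and \<sigma>: "is_step \<sigma>"
  shows "((\<lambda>u. blinfun_apply (step_fun \<sigma> u) (D u)) has_sum
      step_integral t (\<lambda>s. \<Sum>\<^sub>\<infinity>u\<in>{0<..s}. D u) \<sigma>) {0<..t}"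
proof -
  define J where "J s = (\<Sum>\<^sub>\<infinity>u\<in>{0<..s}. D u)" for s
  have one: "((\<lambda>u. blinfun_apply (indicat_real {a<..b} u *\<^sub>R c) (D u)) has_sum
      blinfun_apply c (J (min b t) - J (min a t))) {0<..t}" if ab: "0 \<le> a" "a \<le> b" for a b and c :: "'h \<Rightarrow>\<^sub>L 'g"
  proof -
    have D': "D summable_on A" if "A \<subseteq> {0<..t}" for A
      using summable_on_subset_banach[OF D that] .
    have sub: "{min a t<..min b t} \<subseteq> {0<..t}" using ab t by auto
    have un: "{0<..min b t} = {0<..min a t} \<union> {min a t<..min b t}" using ab t by auto
    have "J (min b t) = J (min a t) + (\<Sum>\<^sub>\<infinity>u\<in>{min a t<..min b t}. D u)"
      unfolding J_def un using ab t by (intro infsum_Un_disjoint D') auto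
    then have "(D has_sum (J (min b t) - J (min a t))) {min a t<..min b t}"
      using has_sum_infsum[OF D'[OF sub]] by simp
    then have "((\<lambda>u. blinfun_apply c (D u)) has_sum blinfun_apply c (J (min b t) - J (min a t))) {min a t<..min b t}"
      by (rule has_sum_bounded_linear[OF blinfun.bounded_linear_right])
    then show ?thesis
      by (rule has_sum_cong_neutral[THEN iffD1, rotated -1])
        (use ab in \<open>auto simp: indicator_def blinfun.scaleR_left min_def split: if_splits\<close>)
  qed
  have "((\<lambda>u. blinfun_apply (\<Sum>(a, b, c)\<leftarrow>xs. indicat_real {a<..b} u *\<^sub>R c) (D u)) has_sum
      (\<Sum>(a, b, c)\<leftarrow>xs. blinfun_apply c (J (min b t) - J (min a t)))) {0<..t}"
    if "set xs \<subseteq> set (snd \<sigma>)" for xs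
    using that
  proof (induction xs)
    case (Cons x xs)
    obtain a b c where x: "x = (a, b, c)" by (cases x)
    have "0 \<le> a" "a \<le> b" using Cons.prems \<sigma> by (auto simp: x is_step_def)
    from has_sum_add[OF one[OF this, of c] Cons.IH] Cons.prems show ?case
      by (simp add: x blinfun.add_left)
  qed simp
  from this[of "snd \<sigma>"] show ?thesis
    unfolding step_integral_def J_def[symmetric]
    by (rule has_sum_cong[THEN iffD1, rotated]) (auto simp: step_fun_def)
qed

lemma abs_summable_blinfun_apply:
  fixes \<phi> :: "'a \<Rightarrow> 'h::real_normed_vector \<Rightarrow>\<^sub>L 'g::real_normed_vector"
  assumes "(\<lambda>u. norm (D u)) summable_on S" "\<And>u. u \<in> S \<Longrightarrow> norm (\<phi> u) \<le> C"
  shows "(\<lambda>u. norm (blinfun_apply (\<phi> u) (D u))) summable_on S"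
proof (rule Infinite_Sum.abs_summable_on_comparison_test)
  show "(\<lambda>u. norm (C * norm (D u))) summable_on S"
    using summable_on_cmult_right[OF assms(1), of "\<bar>C\<bar>"] by (simp add: abs_mult)
  fix u assume u: "u \<in> S"
  have "norm (blinfun_apply (\<phi> u) (D u)) \<le> norm (\<phi> u) * norm (D u)"
    by (rule norm_blinfun)
  also have "\<dots> \<le> \<bar>C\<bar> * norm (D u)"
    using assms(2)[OF u] by (intro mult_right_mono) auto
  finally show "norm (blinfun_apply (\<phi> u) (D u)) \<le> norm (C * norm (D u))"
    by (simp add: abs_mult)
qed

text \<open>The continuous part and the sum of the jumps both have dominated increments, hence the three
  integrals are limits along the same sequence of step functions, for which additivity is
  obvious. Against the sum of the jumps, the integral of a step function is a sum over the
  jump times.\<close>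

lemma stieltjes_integral_split_jumps:
  fixes \<phi> :: "real \<Rightarrow> 'h::banach \<Rightarrow>\<^sub>L 'g::banach"
  assumes g: "cadlag g" "finite_variation g" and \<phi>: "step_approximable \<phi>" and t: "0 \<le> t"
  shows "(\<lambda>u. blinfun_apply (\<phi> u) (jump g u)) summable_on {0<..t}"
    and "stieltjes_integral t \<phi> g = stieltjes_integral t \<phi> (continuous_part g)
      + (\<Sum>\<^sub>\<infinity>u\<in>{0<..t}. blinfun_apply (\<phi> u) (jump g u))"
proof -
  obtain v where v: "increments_dominated t v g"
    using finite_variation_dominated[OF g(2) t] .
  have abs: "(\<lambda>u. norm (jump g u)) summable_on {0<..t}"
    unfolding abs_summable_iff_bdd_above
    by (rule bdd_aboveI[of _ "v t - v 0"]) (use sum_norm_jump_le[OF g(1) v _ _ t] in auto)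
  note summ = abs_summable_summable[OF abs]
  define J where "J s = (\<Sum>\<^sub>\<infinity>u\<in>{0<..s}. jump g u)" for s
  define w where "w s = (\<Sum>\<^sub>\<infinity>u\<in>{0<..s}. norm (jump g u))" for s
  have J: "norm (J b - J a) \<le> w b - w a" if ab: "0 \<le> a" "a \<le> b" "b \<le> t" for a b
  proof -
    have un: "{0<..b} = {0<..a} \<union> {a<..b}" using ab by auto
    have abs': "(\<lambda>u. norm (jump g u)) summable_on A" if "A \<subseteq> {0<..t}" for A
      using summable_on_subset_banach[OF abs that] .
    have "J b = J a + (\<Sum>\<^sub>\<infinity>u\<in>{a<..b}. jump g u)"
      unfolding J_def un using ab by (intro infsum_Un_disjoint summable_on_subset_banach[OF summ]) auto
    moreover have "w b = w a + (\<Sum>\<^sub>\<infinity>u\<in>{a<..b}. norm (jump g u))"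
      unfolding w_def un using ab by (intro infsum_Un_disjoint abs') auto
    moreover have "norm (\<Sum>\<^sub>\<infinity>u\<in>{a<..b}. jump g u) \<le> (\<Sum>\<^sub>\<infinity>u\<in>{a<..b}. norm (jump g u))"
      using ab by (intro norm_infsum_bound abs') auto
    ultimately show ?thesis by simp
  qed
  have dom_J: "increments_dominated t w J"
    using J by (simp add: increments_dominated_def)
  have cont: "continuous_part g = (\<lambda>s. g s - J s)"
    by (simp add: continuous_part_def J_def fun_eq_iff)
  have dom_c: "increments_dominated t (\<lambda>s. v s + w s) (continuous_part g)"
    unfolding increments_dominated_def
  proof (intro allI impI, elim conjE)
    fix a b assume ab: "0 \<le> a" "a \<le> b" "b \<le> t"
    have "norm (continuous_part g b - continuous_part g a) = norm ((g b - g a) - (J b - J a))"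
      by (simp add: cont algebra_simps)
    also have "\<dots> \<le> norm (g b - g a) + norm (J b - J a)"
      by (rule norm_triangle_ineq4)
    also have "\<dots> \<le> v b + w b - (v a + w a)"
      using increments_dominatedD[OF v ab] J[OF ab] by simp
    finally show "norm (continuous_part g b - continuous_part g a) \<le> v b + w b - (v a + w a)" .
  qed
  have "\<exists>\<sigma>. is_step \<sigma> \<and> (\<forall>s\<in>{0..t}. norm (step_fun \<sigma> s - \<phi> s) \<le> inverse (real (Suc k)))" for k
  proof -
    have "0 < inverse (real (Suc k))" by simp
    then obtain \<sigma> where "is_step \<sigma>" "\<forall>s\<in>{0..t}. norm (step_fun \<sigma> s - \<phi> s) < inverse (real (Suc k))"
      using \<phi> t unfolding step_approximable_def by blast
    then show ?thesis by (intro exI[of _ \<sigma>]) (auto intro: less_imp_le)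
  qed
  then obtain \<sigma> where \<sigma>: "\<And>k. is_step (\<sigma> k)"
    "\<And>k s. s \<in> {0..t} \<Longrightarrow> norm (step_fun (\<sigma> k) s - \<phi> s) \<le> inverse (real (Suc k))"
    by metis
  obtain C where C: "\<And>s. s \<in> {0..t} \<Longrightarrow> norm (\<phi> s) \<le> C"
    using step_approximable_bounded[OF \<phi> t] by blast
  show sum_\<phi>: "(\<lambda>u. blinfun_apply (\<phi> u) (jump g u)) summable_on {0<..t}"
    by (rule abs_summable_summable) (intro abs_summable_blinfun_apply[OF abs, where C = C] C, auto)
  have lim_J: "(\<lambda>k. step_integral t J (\<sigma> k)) \<longlonglongrightarrow> (\<Sum>\<^sub>\<infinity>u\<in>{0<..t}. blinfun_apply (\<phi> u) (jump g u))"
  proof (rule LIM_zero_cancel, rule Lim_null_comparison)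
    show "(\<lambda>k. inverse (real (Suc k)) * w t) \<longlonglongrightarrow> 0"
      using tendsto_mult_right[OF LIMSEQ_inverse_real_of_nat, of "w t"] by simp
    have "norm (step_integral t J (\<sigma> k) - (\<Sum>\<^sub>\<infinity>u\<in>{0<..t}. blinfun_apply (\<phi> u) (jump g u)))
        \<le> inverse (real (Suc k)) * w t" for k
    proof -
      let ?d = "\<lambda>u. blinfun_apply (step_fun (\<sigma> k) u - \<phi> u) (jump g u)"
      have "((\<lambda>u. blinfun_apply (step_fun (\<sigma> k) u) (jump g u)) has_sum step_integral t J (\<sigma> k)) {0<..t}"
        using has_sum_step_integral_pure_jump[OF summ t \<sigma>(1)] by (simp add: J_def[abs_def])
      from has_sum_diff[OF this has_sum_infsum[OF sum_\<phi>]]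
      have "(?d has_sum (step_integral t J (\<sigma> k) - (\<Sum>\<^sub>\<infinity>u\<in>{0<..t}. blinfun_apply (\<phi> u) (jump g u)))) {0<..t}"
        by (simp add: blinfun.diff_left)
      then have "step_integral t J (\<sigma> k) - (\<Sum>\<^sub>\<infinity>u\<in>{0<..t}. blinfun_apply (\<phi> u) (jump g u)) = infsum ?d {0<..t}"
        by (simp add: infsumI)
      also have "norm \<dots> \<le> (\<Sum>\<^sub>\<infinity>u\<in>{0<..t}. norm (?d u))"
        by (intro norm_infsum_bound abs_summable_blinfun_apply[OF abs, where C = "inverse (real (Suc k))"] \<sigma>(2)) auto
      also have "\<dots> \<le> (\<Sum>\<^sub>\<infinity>u\<in>{0<..t}. inverse (real (Suc k)) * norm (jump g u))"
      proof (rule infsum_mono)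
        show "(\<lambda>u. norm (?d u)) summable_on {0<..t}"
          by (intro abs_summable_blinfun_apply[OF abs, where C = "inverse (real (Suc k))"] \<sigma>(2)) auto
        show "(\<lambda>u. inverse (real (Suc k)) * norm (jump g u)) summable_on {0<..t}"
          by (rule summable_on_cmult_right[OF abs])
        fix u assume "u \<in> {0<..t}"
        then show "norm (?d u) \<le> inverse (real (Suc k)) * norm (jump g u)"
          using \<sigma>(2)[of u k] norm_blinfun[of "step_fun (\<sigma> k) u - \<phi> u" "jump g u"]
          by (meson atLeastAtMost_iff greaterThanAtMost_iff less_imp_le mult_right_mono norm_ge_zero order_trans)
      qed
      also have "\<dots> = inverse (real (Suc k)) * w t"
        unfolding w_def by (rule infsum_cmult_right')
      finally show ?thesis .
    qed
    then show "\<forall>\<^sub>F k in sequentially. norm (step_integral t J (\<sigma> k)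
        - (\<Sum>\<^sub>\<infinity>u\<in>{0<..t}. blinfun_apply (\<phi> u) (jump g u))) \<le> inverse (real (Suc k)) * w t"
      by (intro always_eventually allI)
  qed
  have lim_c: "(\<lambda>k. step_integral t (continuous_part g) (\<sigma> k)) \<longlonglongrightarrow> stieltjes_integral t \<phi> (continuous_part g)"
    by (rule tendsto_step_integral[OF \<phi> t dom_c \<sigma>])
  have split: "step_integral t (continuous_part g) (\<sigma> k) + step_integral t J (\<sigma> k) = step_integral t g (\<sigma> k)" for k
    unfolding step_integral_def cont sum_list_addf[symmetric]
    by (intro arg_cong[where f = sum_list] map_cong)
      (auto simp: blinfun.add_right[symmetric] algebra_simps)
  from tendsto_add[OF lim_c lim_J, unfolded split]
  have "(\<lambda>k. step_integral t g (\<sigma> k)) \<longlonglongrightarrow> stieltjes_integral t \<phi> (continuous_part g)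
      + (\<Sum>\<^sub>\<infinity>u\<in>{0<..t}. blinfun_apply (\<phi> u) (jump g u))" .
  moreover have "(\<lambda>k. step_integral t g (\<sigma> k)) \<longlonglongrightarrow> stieltjes_integral t \<phi> g"
    by (rule tendsto_step_integral[OF \<phi> t v \<sigma>])
  ultimately show "stieltjes_integral t \<phi> g = stieltjes_integral t \<phi> (continuous_part g)
      + (\<Sum>\<^sub>\<infinity>u\<in>{0<..t}. blinfun_apply (\<phi> u) (jump g u))"
    by (rule LIMSEQ_unique[rotated])
qed

section \<open>Partitions of a compact interval\<close>

text \<open>The part of the partitions in \<open>[0,t]\<close>: the points \<open>q n i\<close> with \<open>i \<le> N n\<close>, and the index \<open>\<kappa> n u\<close> of the interval
  that contains \<open>u\<close>. The last four assumptions are Condition (C) and approximation from the left; the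
  oscillation condition is replaced by its consequence for the increments over intervals without
  big jumps.\<close>

locale truncated_partitions =
  fixes t :: real and q :: "nat \<Rightarrow> nat \<Rightarrow> real" and N :: "nat \<Rightarrow> nat"
    and \<kappa> :: "nat \<Rightarrow> real \<Rightarrow> nat" and Z :: "real \<Rightarrow> 'z::banach"
  assumes t_nonneg: "0 \<le> t"
    and Z_cadlag: "cadlag Z"
    and q_mono: "\<And>n. strict_mono_on {..N n} (q n)"
    and q_start: "\<And>n. q n 0 = 0"
    and q_end: "\<And>n. q n (N n) = t"
    and \<kappa>_less: "\<And>n u. u \<in> {0<..t} \<Longrightarrow> \<kappa> n u < N n"
    and \<kappa>_lower: "\<And>n u. u \<in> {0<..t} \<Longrightarrow> q n (\<kappa> n u) < u"
    and \<kappa>_upper: "\<And>n u. u \<in> {0<..t} \<Longrightarrow> u \<le> q n (Suc (\<kappa> n u))"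
    and separates_jumps: "\<And>\<epsilon>. 0 < \<epsilon> \<Longrightarrow> \<forall>\<^sub>F n in sequentially. \<forall>u\<in>{0<..t}. \<forall>v\<in>{0<..t}.
        \<epsilon> \<le> norm (jump Z u) \<and> \<epsilon> \<le> norm (jump Z v) \<and> \<kappa> n u = \<kappa> n v \<longrightarrow> u = v"
    and increment_tendsto_jump: "\<And>u s. u \<in> {0<..t} \<Longrightarrow> jump Z u \<noteq> 0 \<Longrightarrow> u \<le> s \<Longrightarrow> s \<le> t \<Longrightarrow>
        (\<lambda>n. Z (min (q n (Suc (\<kappa> n u))) s) - Z (q n (\<kappa> n u))) \<longlonglongrightarrow> jump Z u"
    and lower_tendsto_left_lim: "\<And>u. u \<in> {0<..t} \<Longrightarrow> (\<lambda>n. Z (q n (\<kappa> n u))) \<longlonglongrightarrow> left_lim Z u"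
    and small_increments: "\<And>\<eta>. 0 < \<eta> \<Longrightarrow> \<exists>\<epsilon>>0. \<forall>\<^sub>F n in sequentially. \<forall>i<N n.
        (\<forall>u\<in>{q n i<..q n (Suc i)}. norm (jump Z u) < \<epsilon>) \<longrightarrow> norm (Z (q n (Suc i)) - Z (q n i)) \<le> \<eta>"
begin

lemma q_less: "i < N n \<Longrightarrow> q n i < q n (Suc i)"
  using strict_mono_onD[OF q_mono, of i n "Suc i"] by auto

lemma q_in: "i \<le> N n \<Longrightarrow> q n i \<in> {0..t}"
  using strict_mono_on_leD[OF q_mono, of 0 n i] strict_mono_on_leD[OF q_mono, of i n "N n"]
  by (auto simp: q_start q_end)

lemma \<kappa>_unique:
  assumes "i < N n" "q n i < u" "u \<le> q n (Suc i)"
  shows "\<kappa> n u = i"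
proof -
  have u: "u \<in> {0<..t}"
    using assms q_in[of i n] q_in[of "Suc i" n] by auto
  have "q n (\<kappa> n u) < q n (Suc i)" "q n i < q n (Suc (\<kappa> n u))"
    using \<kappa>_lower[OF u, of n] \<kappa>_upper[OF u, of n] assms by auto
  then have "\<kappa> n u < Suc i" "i < Suc (\<kappa> n u)"
    using strict_mono_on_less[OF q_mono[of n], of "\<kappa> n u" "Suc i"]
      strict_mono_on_less[OF q_mono[of n], of i "Suc (\<kappa> n u)"] \<kappa>_less[OF u, of n] assms(1) by simp_all
  then show ?thesis by simp
qed

abbreviation R :: "'z set" where "R \<equiv> closure (Z ` {0..t})"

lemma Z_in_R: "s \<in> {0..t} \<Longrightarrow> Z s \<in> R"
  using closure_subset[of "Z ` {0..t}"] by blast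

lemma compact_R: "compact R"
  using compact_range_of_cadlag[OF Z_cadlag t_nonneg] .

lemma upper_tendsto:
  assumes u: "u \<in> {0<..t}" "jump Z u \<noteq> 0" and s: "u \<le> s" "s \<le> t"
  shows "(\<lambda>n. Z (min (q n (Suc (\<kappa> n u))) s)) \<longlonglongrightarrow> Z u"
  using tendsto_add[OF increment_tendsto_jump[OF u s] lower_tendsto_left_lim[OF u(1)]]
  by (simp add: jump_def)

lemma upper_end_tendsto:
  assumes u: "u \<in> {0<..t}" "jump Z u \<noteq> 0"
  shows "(\<lambda>n. Z (q n (Suc (\<kappa> n u)))) \<longlonglongrightarrow> Z u"
proof -
  have "min (q n (Suc (\<kappa> n u))) t = q n (Suc (\<kappa> n u))" for n
    using q_in[of "Suc (\<kappa> n u)" n] \<kappa>_less[OF u(1), of n] by auto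
  then show ?thesis
    using upper_tendsto[OF u, of t] u by simp
qed

lemma eventually_inj_on_\<kappa>:
  assumes U: "finite U" "U \<subseteq> {0<..t}" "\<And>u. u \<in> U \<Longrightarrow> jump Z u \<noteq> 0"
  shows "\<forall>\<^sub>F n in sequentially. inj_on (\<kappa> n) U"
proof (cases "U = {}")
  case False
  define \<epsilon> where "\<epsilon> = Min ((\<lambda>u. norm (jump Z u)) ` U)"
  have "0 < \<epsilon>"
    unfolding \<epsilon>_def using False U by simp
  moreover have "\<epsilon> \<le> norm (jump Z u)" if "u \<in> U" for u
    unfolding \<epsilon>_def using U that by simp
  ultimately show ?thesis
    using separates_jumps[of \<epsilon>] U(2)
    by (auto elim!: eventually_mono simp: inj_on_def subset_iff)
qed simp

text \<open>Finitely many jump times eventually lie in distinct intervals of the partition, and the pairs of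
  values at the ends of these intervals converge to the pairs of left limits and values.\<close>

lemma sum_over_jumps_le:
  fixes \<beta> :: "'z \<Rightarrow> 'z \<Rightarrow> 'h::real_normed_vector"
  assumes \<beta>: "continuous_on UNIV (\<lambda>(x, y). \<beta> x y)" and diag: "\<And>z. \<beta> z z = 0"
    and bound: "\<And>n. (\<Sum>i<N n. norm (\<beta> (Z (q n i)) (Z (q n (Suc i))))) \<le> C"
    and U: "finite U" "U \<subseteq> {0<..t}"
  shows "(\<Sum>u\<in>U. norm (\<beta> (left_lim Z u) (Z u))) \<le> C"
proof -
  define U' where "U' = {u\<in>U. jump Z u \<noteq> 0}"
  have U': "finite U'" "U' \<subseteq> {0<..t}" "\<And>u. u \<in> U' \<Longrightarrow> jump Z u \<noteq> 0"
    using U by (auto simp: U'_def)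
  have inj: "\<forall>\<^sub>F n in sequentially. inj_on (\<kappa> n) U'"
    by (rule eventually_inj_on_\<kappa>) (use U' in auto)
  have lim: "(\<lambda>n. norm (\<beta> (Z (q n (\<kappa> n u))) (Z (q n (Suc (\<kappa> n u)))))) \<longlonglongrightarrow> norm (\<beta> (left_lim Z u) (Z u))"
    if "u \<in> U'" for u
    using continuous_on_tendsto_compose[OF \<beta> tendsto_Pair[OF lower_tendsto_left_lim upper_end_tendsto], of u u] U' that
    by (intro tendsto_norm) auto
  have "(\<Sum>u\<in>U. norm (\<beta> (left_lim Z u) (Z u))) = (\<Sum>u\<in>U'. norm (\<beta> (left_lim Z u) (Z u)))"
    using U(1) by (intro sum.mono_neutral_right) (auto simp: U'_def jump_def diag)
  also have "\<dots> \<le> C"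
  proof (rule tendsto_upperbound)
    show "(\<lambda>n. \<Sum>u\<in>U'. norm (\<beta> (Z (q n (\<kappa> n u))) (Z (q n (Suc (\<kappa> n u)))))) \<longlonglongrightarrow> (\<Sum>u\<in>U'. norm (\<beta> (left_lim Z u) (Z u)))"
      by (intro tendsto_sum lim)
    show "\<forall>\<^sub>F n in sequentially. (\<Sum>u\<in>U'. norm (\<beta> (Z (q n (\<kappa> n u))) (Z (q n (Suc (\<kappa> n u)))))) \<le> C"
      using inj
    proof eventually_elim
      case (elim n)
      have "(\<Sum>u\<in>U'. norm (\<beta> (Z (q n (\<kappa> n u))) (Z (q n (Suc (\<kappa> n u))))))
          = (\<Sum>i\<in>\<kappa> n ` U'. norm (\<beta> (Z (q n i)) (Z (q n (Suc i)))))"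
        by (simp add: sum.reindex[OF elim])
      also have "\<dots> \<le> (\<Sum>i<N n. norm (\<beta> (Z (q n i)) (Z (q n (Suc i)))))"
        using U'(2) \<kappa>_less by (intro sum_mono2) auto
      also have "\<dots> \<le> C" by (rule bound)
      finally show ?case .
    qed
  qed simp
  finally show ?thesis .
qed

lemma summable_over_jumps:
  fixes \<gamma> :: "'z \<Rightarrow> 'z \<Rightarrow> real"
  assumes \<gamma>: "continuous_on UNIV (\<lambda>(x, y). \<gamma> x y)" "\<And>z. \<gamma> z z = 0" "\<And>z z'. 0 \<le> \<gamma> z z'"
    and bound: "\<And>n. (\<Sum>i<N n. \<gamma> (Z (q n i)) (Z (q n (Suc i)))) \<le> C"
  shows "(\<lambda>u. \<gamma> (left_lim Z u) (Z u)) summable_on {0<..t}"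
    and "(\<Sum>\<^sub>\<infinity>u\<in>{0<..t}. \<gamma> (left_lim Z u) (Z u)) \<le> C"
proof -
  have le: "(\<Sum>u\<in>U. \<gamma> (left_lim Z u) (Z u)) \<le> C" if "finite U" "U \<subseteq> {0<..t}" for U
    using sum_over_jumps_le[OF \<gamma>(1,2) _ that, of C] bound \<gamma>(3) by simp
  show summ: "(\<lambda>u. \<gamma> (left_lim Z u) (Z u)) summable_on {0<..t}"
    by (rule nonneg_bdd_above_summable_on) (use \<gamma>(3) le in \<open>auto intro!: bdd_aboveI[of _ C]\<close>)
  show "(\<Sum>\<^sub>\<infinity>u\<in>{0<..t}. \<gamma> (left_lim Z u) (Z u)) \<le> C"
    using summ le by (rule infsum_le_finite_sums)
qed

text \<open>The jumps of size at least \<open>\<epsilon>\<close> form a finite set \<open>U\<close>. The intervals that meet \<open>U\<close> yield the sum over \<open>U\<close> in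
  the limit; on the other intervals, and for the other jumps, \<open>\<theta>\<close> is at most \<open>\<eta>\<close> times \<open>\<gamma>\<close>, whose sums are
  bounded.\<close>

lemma sum_little_o:
  fixes \<theta> :: "'z \<Rightarrow> 'z \<Rightarrow> 'g::banach" and \<gamma> :: "'z \<Rightarrow> 'z \<Rightarrow> real"
  assumes \<gamma>: "continuous_on UNIV (\<lambda>(x, y). \<gamma> x y)" "\<And>z. \<gamma> z z = 0" "\<And>z z'. 0 \<le> \<gamma> z z'"
    and bound: "\<And>n. (\<Sum>i<N n. \<gamma> (Z (q n i)) (Z (q n (Suc i)))) \<le> C"
    and \<theta>: "continuous_on UNIV (\<lambda>(x, y). \<theta> x y)"
    and small: "\<And>\<eta>. 0 < \<eta> \<Longrightarrow> \<exists>\<delta>>0. \<forall>z\<in>R. \<forall>z'. norm (z' - z) \<le> \<delta> \<longrightarrow> norm (\<theta> z z') \<le> \<eta> * \<gamma> z z'"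
  shows "(\<lambda>u. norm (\<theta> (left_lim Z u) (Z u))) summable_on {0<..t}"
    and "(\<lambda>n. \<Sum>i<N n. \<theta> (Z (q n i)) (Z (q n (Suc i)))) \<longlonglongrightarrow> (\<Sum>\<^sub>\<infinity>u\<in>{0<..t}. \<theta> (left_lim Z u) (Z u))"
proof -
  note \<gamma>_summable = summable_over_jumps[OF \<gamma> bound]
  have C: "0 \<le> C"
    using sum_nonneg[of "{..<N 0}" "\<lambda>i. \<gamma> (Z (q 0 i)) (Z (q 0 (Suc i)))"] \<gamma>(3) bound[of 0] by simp
  have \<theta>_le: "norm (\<theta> (left_lim Z u) (Z u)) \<le> \<eta> * \<gamma> (left_lim Z u) (Z u)"
    if "\<forall>z\<in>R. \<forall>z'. norm (z' - z) \<le> \<delta> \<longrightarrow> norm (\<theta> z z') \<le> \<eta> * \<gamma> z z'" "u \<in> {0<..t}" "norm (jump Z u) < \<delta>" for \<eta> \<delta> u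
    using that left_lim_in_closure[OF Z_cadlag, of u t] by (auto simp: jump_def)
  have summ_\<eta>: "(\<lambda>u. norm (\<eta> * \<gamma> (left_lim Z u) (Z u))) summable_on A" if "A \<subseteq> {0<..t}" "0 \<le> \<eta>" for \<eta> A
    using summable_on_cmult_right[OF summable_on_subset_banach[OF \<gamma>_summable(1) that(1)], of \<eta>] \<gamma>(3) that(2)
    by (simp add: abs_mult)
  show summ: "(\<lambda>u. norm (\<theta> (left_lim Z u) (Z u))) summable_on {0<..t}"
  proof -
    obtain \<delta> where \<delta>: "0 < \<delta>" "\<forall>z\<in>R. \<forall>z'. norm (z' - z) \<le> \<delta> \<longrightarrow> norm (\<theta> z z') \<le> 1 * \<gamma> z z'"
      using small[of 1] by auto
    define F where "F = {u\<in>{0<..t}. \<delta> \<le> norm (jump Z u)}"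
    have F: "finite F"
      unfolding F_def using finite_big_jumps[OF Z_cadlag t_nonneg \<delta>(1)] .
    have "(\<lambda>u. norm (\<theta> (left_lim Z u) (Z u))) summable_on {0<..t} - F"
    proof (rule Infinite_Sum.abs_summable_on_comparison_test)
      show "(\<lambda>u. norm (1 * \<gamma> (left_lim Z u) (Z u))) summable_on {0<..t} - F"
        by (rule summ_\<eta>) auto
      fix u assume "u \<in> {0<..t} - F"
      then show "norm (\<theta> (left_lim Z u) (Z u)) \<le> norm (1 * \<gamma> (left_lim Z u) (Z u))"
        using \<theta>_le[OF \<delta>(2), of u] \<gamma>(3) by (auto simp: F_def)
    qed
    then have "(\<lambda>u. norm (\<theta> (left_lim Z u) (Z u))) summable_on ({0<..t} - F) \<union> F"
      by (rule summable_on_Un_disjoint[OF _ summable_on_finite[OF F]]) auto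
    moreover have "({0<..t} - F) \<union> F = {0<..t}" by (auto simp: F_def)
    ultimately show ?thesis by simp
  qed
  show "(\<lambda>n. \<Sum>i<N n. \<theta> (Z (q n i)) (Z (q n (Suc i)))) \<longlonglongrightarrow> (\<Sum>\<^sub>\<infinity>u\<in>{0<..t}. \<theta> (left_lim Z u) (Z u))"
  proof (rule LIMSEQ_I)
    fix r :: real assume r: "0 < r"
    define \<eta> where "\<eta> = r / (4 * (C + 1))"
    have \<eta>: "0 < \<eta>" "\<eta> * C \<le> r / 4"
      using r C by (auto simp: \<eta>_def field_simps)
    obtain \<delta> where \<delta>: "0 < \<delta>" "\<forall>z\<in>R. \<forall>z'. norm (z' - z) \<le> \<delta> \<longrightarrow> norm (\<theta> z z') \<le> \<eta> * \<gamma> z z'"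
      using small[OF \<eta>(1)] by auto
    obtain \<epsilon>0 where \<epsilon>0: "0 < \<epsilon>0" and ev_small: "\<forall>\<^sub>F n in sequentially. \<forall>i<N n.
        (\<forall>u\<in>{q n i<..q n (Suc i)}. norm (jump Z u) < \<epsilon>0) \<longrightarrow> norm (Z (q n (Suc i)) - Z (q n i)) \<le> \<delta>"
      using small_increments[OF \<delta>(1)] by auto
    define \<epsilon> where "\<epsilon> = min \<epsilon>0 \<delta>"
    define U where "U = {u\<in>{0<..t}. \<epsilon> \<le> norm (jump Z u)}"
    have "0 < \<epsilon>" using \<epsilon>0 \<delta> by (simp add: \<epsilon>_def)
    then have U: "finite U" "U \<subseteq> {0<..t}" "\<And>u. u \<in> U \<Longrightarrow> jump Z u \<noteq> 0"
      using finite_big_jumps[OF Z_cadlag t_nonneg, of \<epsilon>] unfolding U_def by auto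
    have inj: "\<forall>\<^sub>F n in sequentially. inj_on (\<kappa> n) U"
      by (rule eventually_inj_on_\<kappa>) (use U in auto)
    define S where "S = (\<Sum>u\<in>U. \<theta> (left_lim Z u) (Z u))"
    have "(\<lambda>n. \<theta> (Z (q n (\<kappa> n u))) (Z (q n (Suc (\<kappa> n u))))) \<longlonglongrightarrow> \<theta> (left_lim Z u) (Z u)"
      if "u \<in> U" for u
      using continuous_on_tendsto_compose[OF \<theta> tendsto_Pair[OF lower_tendsto_left_lim upper_end_tendsto], of u u] U that
      by auto
    then have "(\<lambda>n. \<Sum>u\<in>U. \<theta> (Z (q n (\<kappa> n u))) (Z (q n (Suc (\<kappa> n u))))) \<longlonglongrightarrow> S"
      unfolding S_def by (rule tendsto_sum)
    then have ev_S: "\<forall>\<^sub>F n in sequentially. norm ((\<Sum>u\<in>U. \<theta> (Z (q n (\<kappa> n u))) (Z (q n (Suc (\<kappa> n u))))) - S) < r / 4"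
      using tendstoD[of _ S sequentially "r / 4"] r by (simp add: dist_norm)
    have tail: "norm ((\<Sum>\<^sub>\<infinity>u\<in>{0<..t}. \<theta> (left_lim Z u) (Z u)) - S) \<le> r / 4"
    proof -
      let ?A = "{0<..t} - U"
      have un: "{0<..t} = ?A \<union> U" using U(2) by auto
      have "(\<Sum>\<^sub>\<infinity>u\<in>?A \<union> U. \<theta> (left_lim Z u) (Z u)) = (\<Sum>\<^sub>\<infinity>u\<in>?A. \<theta> (left_lim Z u) (Z u)) + S"
        using U(1) summable_on_subset_banach[OF abs_summable_summable[OF summ], of ?A]
        by (subst infsum_Un_disjoint) (auto simp: S_def)
      then have "norm ((\<Sum>\<^sub>\<infinity>u\<in>{0<..t}. \<theta> (left_lim Z u) (Z u)) - S) = norm (\<Sum>\<^sub>\<infinity>u\<in>?A. \<theta> (left_lim Z u) (Z u))"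
        using un by simp
      also have "\<dots> \<le> (\<Sum>\<^sub>\<infinity>u\<in>?A. norm (\<theta> (left_lim Z u) (Z u)))"
        using summable_on_subset_banach[OF summ] by (intro norm_infsum_bound) auto
      also have "\<dots> \<le> (\<Sum>\<^sub>\<infinity>u\<in>{0<..t}. \<eta> * \<gamma> (left_lim Z u) (Z u))"
      proof (rule infsum_mono_neutral)
        show "(\<lambda>u. norm (\<theta> (left_lim Z u) (Z u))) summable_on ?A"
          using summable_on_subset_banach[OF summ] by auto
        show "(\<lambda>u. \<eta> * \<gamma> (left_lim Z u) (Z u)) summable_on {0<..t}"
          by (rule summable_on_cmult_right[OF \<gamma>_summable(1)])
        fix u assume "u \<in> ?A \<inter> {0<..t}"
        then show "norm (\<theta> (left_lim Z u) (Z u)) \<le> \<eta> * \<gamma> (left_lim Z u) (Z u)"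
          by (intro \<theta>_le[OF \<delta>(2)]) (auto simp: U_def \<epsilon>_def)
      qed (use \<eta>(1) \<gamma>(3) in auto)
      also have "\<dots> = \<eta> * (\<Sum>\<^sub>\<infinity>u\<in>{0<..t}. \<gamma> (left_lim Z u) (Z u))"
        by (rule infsum_cmult_right')
      also have "\<dots> \<le> \<eta> * C"
        using \<eta>(1) \<gamma>_summable(2) by (intro mult_left_mono) auto
      finally show ?thesis using \<eta>(2) by simp
    qed
    have "\<forall>\<^sub>F n in sequentially. norm ((\<Sum>i<N n. \<theta> (Z (q n i)) (Z (q n (Suc i))))
        - (\<Sum>\<^sub>\<infinity>u\<in>{0<..t}. \<theta> (left_lim Z u) (Z u))) < r"
      using ev_S ev_small inj
    proof eventually_elim
      case (elim n)
      let ?\<theta> = "\<lambda>i. \<theta> (Z (q n i)) (Z (q n (Suc i)))"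
      have sub: "\<kappa> n ` U \<subseteq> {..<N n}"
        using U(2) \<kappa>_less by auto
      have "norm (?\<theta> i) \<le> \<eta> * \<gamma> (Z (q n i)) (Z (q n (Suc i)))" if i: "i \<in> {..<N n} - \<kappa> n ` U" for i
      proof -
        have "norm (jump Z u) < \<epsilon>0" if u: "u \<in> {q n i<..q n (Suc i)}" for u
        proof (rule ccontr)
          assume "\<not> norm (jump Z u) < \<epsilon>0"
          then have "u \<in> U"
            using u i q_in[of i n] q_in[of "Suc i" n] by (auto simp: U_def \<epsilon>_def)
          moreover have "\<kappa> n u = i" using u i by (intro \<kappa>_unique) auto
          ultimately show False using i by auto
        qed
        then have "norm (Z (q n (Suc i)) - Z (q n i)) \<le> \<delta>"
          using elim(2) i by auto
        then show ?thesis
          using \<delta>(2) Z_in_R[OF q_in[of i n]] i by auto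
      qed
      then have "norm (\<Sum>i\<in>{..<N n} - \<kappa> n ` U. ?\<theta> i) \<le> (\<Sum>i\<in>{..<N n} - \<kappa> n ` U. \<eta> * \<gamma> (Z (q n i)) (Z (q n (Suc i))))"
        by (rule sum_norm_le)
      also have "\<dots> \<le> (\<Sum>i<N n. \<eta> * \<gamma> (Z (q n i)) (Z (q n (Suc i))))"
        using \<eta>(1) \<gamma>(3) by (intro sum_mono2) auto
      also have "\<dots> \<le> \<eta> * C"
        using \<eta>(1) bound[of n] by (simp add: sum_distrib_left[symmetric])
      finally have rest: "norm (\<Sum>i\<in>{..<N n} - \<kappa> n ` U. ?\<theta> i) \<le> r / 4"
        using \<eta>(2) by simp
      have "(\<Sum>i<N n. ?\<theta> i) = (\<Sum>i\<in>{..<N n} - \<kappa> n ` U. ?\<theta> i) + (\<Sum>i\<in>\<kappa> n ` U. ?\<theta> i)"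
        using sum.subset_diff[OF sub, of ?\<theta>] by simp
      also have "(\<Sum>i\<in>\<kappa> n ` U. ?\<theta> i) = (\<Sum>u\<in>U. ?\<theta> (\<kappa> n u))"
        by (simp add: sum.reindex[OF elim(3)])
      finally have eq: "(\<Sum>i<N n. ?\<theta> i) = (\<Sum>i\<in>{..<N n} - \<kappa> n ` U. ?\<theta> i) + (\<Sum>u\<in>U. ?\<theta> (\<kappa> n u))" .
      have "norm (x + y - z) \<le> norm x + norm (y - S) + norm (z - S)" for x y z :: 'g
        using norm_triangle_ineq[of x "y - S"] norm_triangle_ineq4[of "x + (y - S)" "z - S"] by simp
      from this[of "\<Sum>i\<in>{..<N n} - \<kappa> n ` U. ?\<theta> i" "\<Sum>u\<in>U. ?\<theta> (\<kappa> n u)" "\<Sum>\<^sub>\<infinity>u\<in>{0<..t}. \<theta> (left_lim Z u) (Z u)"]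
      show ?case
        unfolding eq using rest elim(1) tail r by linarith
    qed
    then show "\<exists>no. \<forall>n\<ge>no. norm ((\<Sum>i<N n. \<theta> (Z (q n i)) (Z (q n (Suc i))))
        - (\<Sum>\<^sub>\<infinity>u\<in>{0<..t}. \<theta> (left_lim Z u) (Z u))) < r"
      by (simp add: eventually_sequentially)
  qed
qed

section \<open>Convergence of Riemann sums\<close>

definition truncated_sum :: "('z \<Rightarrow> 'z \<Rightarrow> 'h::real_normed_vector) \<Rightarrow> nat \<Rightarrow> real \<Rightarrow> 'h" where
  "truncated_sum \<beta> n x = (\<Sum>i<N n. \<beta> (Z (min (q n i) x)) (Z (min (q n (Suc i)) x)))"

text \<open>Since the truncated increments \<open>b n i x\<close> telescope in \<open>x\<close> along the knots, the difference is a double sum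
  of terms \<open>d n i j\<close> in which the integrand at the left end of the \<open>i\<close>-th interval is compared with the
  integrand at the knot \<open>p j\<close>. A term vanishes unless one of the two points lies in the interval that
  starts at the other.

  If the partition point lies in the knot interval, then the integrands differ by at most \<open>\<eta>\<close>, and the sum of
  the increments is at most \<open>C\<close>, up to those increments that are cut off at the next
  knot; the latter converge to increments over jumps and are bounded by \<open>C\<close> as well.

  If the knot \<open>p j\<close> lies inside the partition interval, then the single term concerned tends to
  zero. At a jump time the partition interval has, by Condition (C), the jump as its only
  increment in the limit, so nothing is added between the knot and the next one. At any other knot,
  approximation from the left makes the integrands agree in the limit.\<close>

lemma sum_minus_riemann_sum_eventually_le:
  fixes \<Phi> :: "'z \<Rightarrow> 'h::real_normed_vector \<Rightarrow>\<^sub>L 'g::real_normed_vector" and \<beta> :: "'z \<Rightarrow> 'z \<Rightarrow> 'h"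
  assumes \<Phi>: "continuous_on UNIV \<Phi>"
    and \<beta>: "continuous_on UNIV (\<lambda>(x, y). \<beta> x y)" and diag: "\<And>z. \<beta> z z = 0"
    and bound: "\<And>n. (\<Sum>i<N n. norm (\<beta> (Z (q n i)) (Z (q n (Suc i))))) \<le> C"
    and \<eta>: "0 < \<eta>" and k: "knots \<eta> t (\<lambda>s. \<Phi> (Z s)) p m"
  shows "\<forall>\<^sub>F n in sequentially. norm (
      (\<Sum>i<N n. blinfun_apply (\<Phi> (Z (q n i))) (\<beta> (Z (q n i)) (Z (q n (Suc i))))) -
      (\<Sum>j<m. blinfun_apply (\<Phi> (Z (p j))) (truncated_sum \<beta> n (p (Suc j)) - truncated_sum \<beta> n (p j))))
      \<le> \<eta> * (2 * C + 2)"
proof -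
  note p = knotsD[OF k]
  define b where "b n i x = \<beta> (Z (min (q n i) x)) (Z (min (q n (Suc i)) x))" for n i x
  define d where "d n i j = blinfun_apply (\<Phi> (Z (q n i)) - \<Phi> (Z (p j))) (b n i (p (Suc j)) - b n i (p j))" for n i j
  \<comment> \<open>The first knot is \<open>0\<close>, which lies in no interval of a partition, and \<open>\<kappa> n 0\<close> is unspecified.\<close>
  define e where "e n j = (if 0 < j then norm (d n (\<kappa> n (p j)) j) else 0)" for n j
  define crossing where "crossing n j = norm (\<beta> (Z (q n (\<kappa> n (p (Suc j))))) (Z (p (Suc j))))" for n j
  have p_pos: "p j \<in> {0<..t}" if "0 < j" "j \<le> m" for j
    using strict_mono_onD[OF p(1), of 0 j] p(2) p(5)[of j] that by auto
  have \<beta>_lim: "(\<lambda>n. \<beta> (x n) (y n)) \<longlonglongrightarrow> \<beta> x' y'" if "x \<longlonglongrightarrow> x'" "y \<longlonglongrightarrow> y'" for x y :: "nat \<Rightarrow> 'z" and x' y'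
    using continuous_on_tendsto_compose[OF \<beta> tendsto_Pair[OF that]] by simp
  have \<Phi>_lim: "(\<lambda>n. \<Phi> (x n)) \<longlonglongrightarrow> \<Phi> x'" if "x \<longlonglongrightarrow> x'" for x :: "nat \<Rightarrow> 'z" and x'
    using continuous_on_tendsto_compose[OF \<Phi> that] by simp

  have telescope: "(\<Sum>j<m. b n i (p (Suc j)) - b n i (p j)) = \<beta> (Z (q n i)) (Z (q n (Suc i)))" if "i < N n" for n i
  proof -
    have "min (q n i) t = q n i" "min (q n (Suc i)) t = q n (Suc i)" "min (q n i) 0 = 0" "min (q n (Suc i)) 0 = 0"
      using q_in[of i n] q_in[of "Suc i" n] that by auto
    then show ?thesis
      using sum_lessThan_telescope[of "\<lambda>j. b n i (p j)" m] p(2,3) by (simp add: b_def diag)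
  qed
  have difference: "(\<Sum>i<N n. blinfun_apply (\<Phi> (Z (q n i))) (\<beta> (Z (q n i)) (Z (q n (Suc i))))) -
      (\<Sum>j<m. blinfun_apply (\<Phi> (Z (p j))) (truncated_sum \<beta> n (p (Suc j)) - truncated_sum \<beta> n (p j)))
      = (\<Sum>i<N n. \<Sum>j<m. d n i j)" for n
  proof -
    have "(\<Sum>i<N n. blinfun_apply (\<Phi> (Z (q n i))) (\<beta> (Z (q n i)) (Z (q n (Suc i)))))
        = (\<Sum>i<N n. \<Sum>j<m. blinfun_apply (\<Phi> (Z (q n i))) (b n i (p (Suc j)) - b n i (p j)))"
      by (intro sum.cong refl) (simp add: telescope[symmetric] blinfun.sum_right)
    moreover have "(\<Sum>j<m. blinfun_apply (\<Phi> (Z (p j))) (truncated_sum \<beta> n (p (Suc j)) - truncated_sum \<beta> n (p j)))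
        = (\<Sum>i<N n. \<Sum>j<m. blinfun_apply (\<Phi> (Z (p j))) (b n i (p (Suc j)) - b n i (p j)))"
      by (subst sum.swap) (simp add: truncated_sum_def b_def sum_subtractf[symmetric] blinfun.sum_right)
    ultimately show ?thesis
      by (simp add: d_def blinfun.diff_left sum_subtractf)
  qed

  have d_le: "norm (d n i j) \<le>
      (if p j \<le> q n i \<and> q n i < p (Suc j) then \<eta> * norm (\<beta> (Z (q n i)) (Z (q n (Suc i)))) else 0)
      + (if i = \<kappa> n (p (Suc j)) then \<eta> * crossing n j else 0)
      + (if i = \<kappa> n (p j) then e n j else 0)" (is "_ \<le> ?A + ?B + ?E")
    if i: "i < N n" and j: "j < m" for n i j
  proof -
    have nonneg: "0 \<le> ?A" "0 \<le> ?B" "0 \<le> ?E"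
      using \<eta> by (auto simp: crossing_def e_def)
    note qi = q_less[OF i] and pj = p(4)[OF j]
    consider (before) "p (Suc j) \<le> q n i" | (after) "q n (Suc i) \<le> p j"
      | (start) "p j \<le> q n i" "q n i < p (Suc j)" | (inside) "q n i < p j" "p j < q n (Suc i)"
      by linarith
    then show ?thesis
    proof cases
      case before
      then have "b n i (p (Suc j)) = 0" "b n i (p j) = 0"
        using qi pj by (auto simp: b_def min_absorb2 diag)
      then show ?thesis using nonneg by (simp add: d_def)
    next
      case after
      then have "b n i (p (Suc j)) = b n i (p j)"
        using qi pj by (simp add: b_def min_absorb1)
      then show ?thesis using nonneg by (simp add: d_def)
    next
      case start
      have "norm (\<Phi> (Z (q n i)) - \<Phi> (Z (p j))) \<le> \<eta>"
        using p(6)[OF j start] by simp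
      then have *: "norm (blinfun_apply (\<Phi> (Z (q n i)) - \<Phi> (Z (p j))) h) \<le> \<eta> * norm h" for h
        using norm_blinfun[of "\<Phi> (Z (q n i)) - \<Phi> (Z (p j))" h] by (meson mult_right_mono norm_ge_zero order_trans)
      have "b n i (p j) = 0"
        using start qi by (simp add: b_def min_absorb2 diag)
      then have d: "norm (d n i j) \<le> \<eta> * norm (b n i (p (Suc j)))"
        unfolding d_def using *[of "b n i (p (Suc j))"] by simp
      show ?thesis
      proof (cases "q n (Suc i) \<le> p (Suc j)")
        case True
        then have "b n i (p (Suc j)) = \<beta> (Z (q n i)) (Z (q n (Suc i)))"
          using start by (simp add: b_def min_absorb1)
        then have "norm (d n i j) \<le> ?A" using d start by simp
        then show ?thesis using nonneg by simp
      next
        case False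
        then have "i = \<kappa> n (p (Suc j))"
          using start i by (intro \<kappa>_unique[symmetric]) auto
        moreover have "b n i (p (Suc j)) = \<beta> (Z (q n i)) (Z (p (Suc j)))"
          using start False by (simp add: b_def min_absorb1 min_absorb2)
        ultimately have "norm (d n i j) \<le> ?B" using d by (simp add: crossing_def)
        then show ?thesis using nonneg by simp
      qed
    next
      case inside
      have "0 < j"
        using inside p(2) q_in[of i n] i by (cases j) auto
      moreover have "i = \<kappa> n (p j)"
        using inside i by (intro \<kappa>_unique[symmetric]) auto
      ultimately have "norm (d n i j) = ?E" by (simp add: e_def)
      then show ?thesis using nonneg by simp
    qed
  qed

  have e_lim: "(\<lambda>n. e n j) \<longlonglongrightarrow> 0" if j: "j < m" for j
  proof (cases "0 < j")
    case True
    define u s where "u = p j" and "s = p (Suc j)"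
    have u: "u \<in> {0<..t}" using p_pos[OF True] j by (simp add: u_def)
    have s: "u \<le> s" "s \<le> t" "s \<in> {0<..t}"
      using p(4)[OF j] p(5)[of "Suc j"] u j by (auto simp: u_def s_def)
    have low: "q n (\<kappa> n u) < u" "u \<le> q n (Suc (\<kappa> n u))" "\<kappa> n u < N n" for n
      using \<kappa>_lower[OF u] \<kappa>_upper[OF u] \<kappa>_less[OF u] by auto
    have bu: "b n (\<kappa> n u) u = \<beta> (Z (q n (\<kappa> n u))) (Z u)" for n
      using low[of n] by (simp add: b_def min_absorb1 min_absorb2)
    have bs: "b n (\<kappa> n u) s = \<beta> (Z (q n (\<kappa> n u))) (Z (min (q n (Suc (\<kappa> n u))) s))" for n
      using low[of n] s(1) by (simp add: b_def min_absorb1)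
    have eq: "e n j = norm (blinfun_apply (\<Phi> (Z (q n (\<kappa> n u))) - \<Phi> (Z u)) (b n (\<kappa> n u) s - b n (\<kappa> n u) u))" for n
      using True by (simp add: e_def d_def u_def s_def)
    note left = lower_tendsto_left_lim[OF u]
    show ?thesis
    proof (cases "jump Z u = 0")
      case False
      have "(\<lambda>n. b n (\<kappa> n u) s - b n (\<kappa> n u) u) \<longlonglongrightarrow> \<beta> (left_lim Z u) (Z u) - \<beta> (left_lim Z u) (Z u)"
        unfolding bs bu by (intro tendsto_diff \<beta>_lim left tendsto_const upper_tendsto[OF u False s(1,2)])
      moreover have "(\<lambda>n. \<Phi> (Z (q n (\<kappa> n u))) - \<Phi> (Z u)) \<longlonglongrightarrow> \<Phi> (left_lim Z u) - \<Phi> (Z u)"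
        by (intro tendsto_diff \<Phi>_lim left tendsto_const)
      ultimately have "(\<lambda>n. e n j) \<longlonglongrightarrow> norm (blinfun_apply (\<Phi> (left_lim Z u) - \<Phi> (Z u)) 0)"
        unfolding eq by (intro tendsto_norm bounded_bilinear.tendsto[OF bounded_bilinear_blinfun_apply]) auto
      then show ?thesis by simp
    next
      case True
      have "(\<lambda>n. \<Phi> (Z (q n (\<kappa> n u))) - \<Phi> (Z u)) \<longlonglongrightarrow> \<Phi> (left_lim Z u) - \<Phi> (Z u)"
        by (intro tendsto_diff \<Phi>_lim left tendsto_const)
      then have lim0: "(\<lambda>n. \<Phi> (Z (q n (\<kappa> n u))) - \<Phi> (Z u)) \<longlonglongrightarrow> 0"
        using True by (simp add: jump_def)
      have "compact ((\<lambda>(x, y). \<beta> x y) ` (R \<times> R))"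
        by (intro compact_continuous_image compact_Times compact_R continuous_on_subset[OF \<beta>]) auto
      then obtain M where "\<forall>x\<in>R. \<forall>y\<in>R. norm (\<beta> x y) \<le> M"
        by (auto dest!: compact_imp_bounded simp: bounded_iff)
      then have M: "norm (\<beta> x y) \<le> M" if "x \<in> R" "y \<in> R" for x y
        using that by blast
      have "norm (b n (\<kappa> n u) s - b n (\<kappa> n u) u) \<le> M + M" for n
      proof -
        have "min (q n (Suc (\<kappa> n u))) s \<in> {0..t}"
          using q_in[of "Suc (\<kappa> n u)" n] low[of n] s by auto
        then show ?thesis
          unfolding bs bu using q_in[of "\<kappa> n u" n] low[of n] u
          by (intro order_trans[OF norm_triangle_ineq4] add_mono M Z_in_R) auto
      qed
      then have "e n j \<le> norm (\<Phi> (Z (q n (\<kappa> n u))) - \<Phi> (Z u)) * (M + M)" for n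
        unfolding eq by (intro order_trans[OF norm_blinfun] mult_left_mono) auto
      moreover have "(\<lambda>n. norm (\<Phi> (Z (q n (\<kappa> n u))) - \<Phi> (Z u)) * (M + M)) \<longlonglongrightarrow> 0"
        using tendsto_mult_right[OF tendsto_norm_zero[OF lim0], of "M + M"] by simp
      moreover have "0 \<le> e n j" for n by (simp add: e_def)
      ultimately show ?thesis
        by (intro tendsto_sandwich[of "\<lambda>_. 0" "\<lambda>n. e n j" sequentially
            "\<lambda>n. norm (\<Phi> (Z (q n (\<kappa> n u))) - \<Phi> (Z u)) * (M + M)"]) auto
    qed
  qed (simp add: e_def)

  have ev_e: "\<forall>\<^sub>F n in sequentially. (\<Sum>j<m. e n j) < \<eta>"
  proof (rule order_tendstoD(2))
    show "(\<lambda>n. \<Sum>j<m. e n j) \<longlonglongrightarrow> (\<Sum>j<m. 0)"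
      by (intro tendsto_sum e_lim) simp
  qed (use \<eta> in simp)
  have "(\<lambda>n. \<Sum>j<m. crossing n j) \<longlonglongrightarrow> (\<Sum>j<m. norm (\<beta> (left_lim Z (p (Suc j))) (Z (p (Suc j)))))"
    unfolding crossing_def using p_pos
    by (intro tendsto_sum tendsto_norm \<beta>_lim lower_tendsto_left_lim tendsto_const) auto
  moreover have "(\<Sum>j<m. norm (\<beta> (left_lim Z (p (Suc j))) (Z (p (Suc j))))) \<le> C"
  proof -
    have "inj_on (\<lambda>j. p (Suc j)) {..<m}"
      using inj_onD[OF strict_mono_on_imp_inj_on[OF p(1)], of "Suc _" "Suc _"]
      by (intro inj_onI) auto
    then have "(\<Sum>j<m. norm (\<beta> (left_lim Z (p (Suc j))) (Z (p (Suc j)))))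
        = (\<Sum>u\<in>(\<lambda>j. p (Suc j)) ` {..<m}. norm (\<beta> (left_lim Z u) (Z u)))"
      by (simp add: sum.reindex)
    also have "\<dots> \<le> C"
      by (intro sum_over_jumps_le[OF \<beta> diag bound]) (use p_pos in auto)
    finally show ?thesis .
  qed
  ultimately have ev_crossing: "\<forall>\<^sub>F n in sequentially. (\<Sum>j<m. crossing n j) < C + 1"
    by (auto intro: order_tendstoD(2))

  show ?thesis
    using ev_e ev_crossing
  proof eventually_elim
    case (elim n)
    have A: "(\<Sum>j<m. if p j \<le> q n i \<and> q n i < p (Suc j) then c else 0) \<le> c"
      if i: "i < N n" and "0 \<le> c" for i and c :: real
    proof -
      have "q n i < t"
        using q_less[OF i] q_in[of "Suc i" n] i by auto
      then obtain j0 where j0: "j0 < m" "p j0 \<le> q n i" "q n i < p (Suc j0)"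
        using ex_right_open_interval[of p "q n i" m] p(2,3) q_in[of i n] i by auto
      have "j = j0" if "j < m" "p j \<le> q n i" "q n i < p (Suc j)" for j
      proof -
        have "p j < p (Suc j0)" "p j0 < p (Suc j)" using j0 that by auto
        then have "j < Suc j0" "j0 < Suc j"
          using strict_mono_on_less[OF p(1), of j "Suc j0"] strict_mono_on_less[OF p(1), of j0 "Suc j"]
            j0(1) that(1) by simp_all
        then show ?thesis by simp
      qed
      then have "(\<Sum>j<m. if p j \<le> q n i \<and> q n i < p (Suc j) then c else 0) \<le> (\<Sum>j<m. if j = j0 then c else 0)"
        using \<open>0 \<le> c\<close> by (intro sum_mono) auto
      then show ?thesis using j0(1) by simp
    qed
    have swap: "(\<Sum>j<m. \<Sum>i<N n. h i j) = (\<Sum>i<N n. \<Sum>j<m. h i j)" for h :: "nat \<Rightarrow> nat \<Rightarrow> real"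
      by (rule sum.swap)
    have "norm (\<Sum>i<N n. \<Sum>j<m. d n i j) \<le> (\<Sum>i<N n. \<Sum>j<m.
        (if p j \<le> q n i \<and> q n i < p (Suc j) then \<eta> * norm (\<beta> (Z (q n i)) (Z (q n (Suc i)))) else 0)
        + (if i = \<kappa> n (p (Suc j)) then \<eta> * crossing n j else 0)
        + (if i = \<kappa> n (p j) then e n j else 0))"
      by (intro sum_norm_le d_le) auto
    also have "\<dots> = (\<Sum>i<N n. \<Sum>j<m. if p j \<le> q n i \<and> q n i < p (Suc j) then \<eta> * norm (\<beta> (Z (q n i)) (Z (q n (Suc i)))) else 0)
        + (\<Sum>j<m. \<Sum>i<N n. if i = \<kappa> n (p (Suc j)) then \<eta> * crossing n j else 0)
        + (\<Sum>j<m. \<Sum>i<N n. if i = \<kappa> n (p j) then e n j else 0)"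
      by (simp only: sum.distrib swap)
    also have "\<dots> \<le> (\<Sum>i<N n. \<eta> * norm (\<beta> (Z (q n i)) (Z (q n (Suc i))))) + (\<Sum>j<m. \<eta> * crossing n j) + (\<Sum>j<m. e n j)"
      using \<eta> by (intro add_mono sum_mono A) (auto simp: crossing_def e_def)
    also have "\<dots> \<le> \<eta> * C + \<eta> * (C + 1) + \<eta>"
      unfolding sum_distrib_left[symmetric] using bound[of n] elim \<eta>
      by (intro add_mono mult_left_mono) auto
    finally show ?case
      unfolding difference by (simp add: algebra_simps)
  qed
qed

text \<open>The operator \<open>\<Psi>\<close> treats both topologies at once: it ranges over the functionals for weak
  convergence and is the identity for convergence in norm.\<close>

lemma riemann_sums_tendsto:
  fixes \<Phi> :: "'z \<Rightarrow> 'h::banach \<Rightarrow>\<^sub>L 'g::banach" and \<beta> :: "'z \<Rightarrow> 'z \<Rightarrow> 'h" and \<Psi> :: "'g \<Rightarrow>\<^sub>L 'k::real_normed_vector"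
  assumes \<Phi>: "continuous_on UNIV \<Phi>"
    and \<beta>: "continuous_on UNIV (\<lambda>(x, y). \<beta> x y)" and diag: "\<And>z. \<beta> z z = 0"
    and bound: "\<And>n. (\<Sum>i<N n. norm (\<beta> (Z (q n i)) (Z (q n (Suc i))))) \<le> C"
    and dom: "increments_dominated t v g"
    and lim: "\<And>M x y. x \<in> {0..t} \<Longrightarrow> y \<in> {0..t} \<Longrightarrow>
      (\<lambda>n. blinfun_apply \<Psi> (blinfun_apply M (truncated_sum \<beta> n y - truncated_sum \<beta> n x)))
        \<longlonglongrightarrow> blinfun_apply \<Psi> (blinfun_apply M (g y - g x))"
  shows "(\<lambda>n. blinfun_apply \<Psi> (\<Sum>i<N n. blinfun_apply (\<Phi> (Z (q n i))) (\<beta> (Z (q n i)) (Z (q n (Suc i))))))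
      \<longlonglongrightarrow> blinfun_apply \<Psi> (stieltjes_integral t (\<lambda>s. \<Phi> (left_lim Z s)) g)"
proof (rule LIMSEQ_I)
  fix r :: real assume r: "0 < r"
  have C: "0 \<le> C"
    by (rule order_trans[OF sum_nonneg bound[of 0]]) simp
  define V where "V = v t - v 0"
  have V: "0 \<le> V"
    using dominating_mono[OF dom, of 0 t] t_nonneg by (simp add: V_def)
  define W where "W = (norm \<Psi> + 1) * (2 * C + 2 + V)"
  define \<eta> where "\<eta> = r / (4 * W)"
  have pos: "0 < W"
    unfolding W_def using C V by (intro mult_pos_pos add_nonneg_pos add_pos_nonneg) auto
  have \<eta>: "0 < \<eta>" "norm \<Psi> * (\<eta> * (2 * C + 2)) \<le> r / 4" "norm \<Psi> * (\<eta> * V) \<le> r / 4"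
  proof -
    show pos\<eta>: "0 < \<eta>" using r pos by (simp add: \<eta>_def)
    have total: "\<eta> * W = r / 4"
      using pos by (simp add: \<eta>_def)
    have "norm \<Psi> * x \<le> W" if "0 \<le> x" "x \<le> 2 * C + 2 + V" for x
      unfolding W_def using that by (intro mult_mono) auto
    then have *: "\<eta> * (norm \<Psi> * x) \<le> r / 4" if "0 \<le> x" "x \<le> 2 * C + 2 + V" for x
      unfolding total[symmetric] using that pos\<eta> by (intro mult_left_mono) auto
    show "norm \<Psi> * (\<eta> * (2 * C + 2)) \<le> r / 4" "norm \<Psi> * (\<eta> * V) \<le> r / 4"
      using *[of "2 * C + 2"] *[of V] C V by (simp_all add: mult.left_commute)
  qed
  let ?Y = "\<lambda>s. \<Phi> (Z s)"
  have Y: "cadlag ?Y" and left: "left_lim ?Y s = \<Phi> (left_lim Z s)" if "0 \<le> s" for s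
    using cadlag_compose[OF Z_cadlag \<Phi>] that by auto
  have left': "left_lim ?Y = (\<lambda>s. \<Phi> (left_lim Z s))"
  proof
    fix s show "left_lim ?Y s = \<Phi> (left_lim Z s)"
      using left[of s] by (cases "0 \<le> s") (auto simp: left_lim_def)
  qed
  obtain p m where k: "knots \<eta> t ?Y p m"
    using cadlag_knots[OF Y[OF order_refl] t_nonneg \<eta>(1)] .
  define T where "T n = (\<Sum>i<N n. blinfun_apply (\<Phi> (Z (q n i))) (\<beta> (Z (q n i)) (Z (q n (Suc i)))))" for n
  define T' where "T' n = (\<Sum>j<m. blinfun_apply (\<Phi> (Z (p j))) (truncated_sum \<beta> n (p (Suc j)) - truncated_sum \<beta> n (p j)))" for n
  define J' where "J' = (\<Sum>j<m. blinfun_apply (\<Phi> (Z (p j))) (g (p (Suc j)) - g (p j)))"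
  define J where "J = stieltjes_integral t (\<lambda>s. \<Phi> (left_lim Z s)) g"
  have "norm (step_integral t g (knot_step ?Y p m) - stieltjes_integral t (left_lim ?Y) g) \<le> \<eta> * V"
    unfolding V_def
    by (intro norm_step_integral_minus_stieltjes_integral_le[OF step_approximable_left_lim t_nonneg dom]
        is_step_knot_step[OF k] norm_knot_step_minus_left_lim[OF _ k \<eta>(1)] Y[OF order_refl])
  then have "norm (J' - J) \<le> \<eta> * V"
    unfolding step_integral_knot_step[OF k] left' J'_def J_def .
  then have "norm (blinfun_apply \<Psi> (J' - J)) \<le> norm \<Psi> * (\<eta> * V)"
    by (intro order_trans[OF norm_blinfun] mult_left_mono) auto
  then have J: "norm (blinfun_apply \<Psi> (J' - J)) \<le> r / 4"
    using \<eta>(3) by simp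
  have "(\<lambda>n. blinfun_apply \<Psi> (T' n)) \<longlonglongrightarrow> blinfun_apply \<Psi> J'"
    unfolding T'_def J'_def blinfun.sum_right
    using knotsD(5)[OF k] by (intro tendsto_sum lim) auto
  then have "\<forall>\<^sub>F n in sequentially. norm (blinfun_apply \<Psi> (T' n) - blinfun_apply \<Psi> J') < r / 4"
    using tendstoD[of "\<lambda>n. blinfun_apply \<Psi> (T' n)" _ sequentially "r / 4"] r by (simp add: dist_norm)
  moreover have "\<forall>\<^sub>F n in sequentially. norm (T n - T' n) \<le> \<eta> * (2 * C + 2)"
    using sum_minus_riemann_sum_eventually_le[OF \<Phi> \<beta> diag bound \<eta>(1) k] by (simp add: T_def T'_def)
  ultimately have "\<forall>\<^sub>F n in sequentially. norm (blinfun_apply \<Psi> (T n) - blinfun_apply \<Psi> J) < r"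
  proof eventually_elim
    case (elim n)
    have "norm (blinfun_apply \<Psi> (T n - T' n)) \<le> norm \<Psi> * (\<eta> * (2 * C + 2))"
      using elim(2) by (intro order_trans[OF norm_blinfun] mult_left_mono) auto
    then have "norm (blinfun_apply \<Psi> (T n - T' n)) \<le> r / 4"
      using \<eta>(2) by simp
    have split: "blinfun_apply \<Psi> (T n) - blinfun_apply \<Psi> J = blinfun_apply \<Psi> (T n - T' n)
        + (blinfun_apply \<Psi> (T' n) - blinfun_apply \<Psi> J') + blinfun_apply \<Psi> (J' - J)"
      by (simp add: blinfun.diff_right)
    have "norm (x + y + z) \<le> norm x + norm y + norm z" for x y z :: 'k
      by (rule norm_triangle_le) (use norm_triangle_ineq[of x y] in simp)
    from this[of "blinfun_apply \<Psi> (T n - T' n)" "blinfun_apply \<Psi> (T' n) - blinfun_apply \<Psi> J'" "blinfun_apply \<Psi> (J' - J)"]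
    show ?case
      unfolding split using \<open>norm (blinfun_apply \<Psi> (T n - T' n)) \<le> r / 4\<close> elim(1) J r by linarith
  qed
  then show "\<exists>no. \<forall>n\<ge>no. norm (blinfun_apply \<Psi> (\<Sum>i<N n. blinfun_apply (\<Phi> (Z (q n i))) (\<beta> (Z (q n i)) (Z (q n (Suc i)))))
      - blinfun_apply \<Psi> (stieltjes_integral t (\<lambda>s. \<Phi> (left_lim Z s)) g)) < r"
    by (simp add: eventually_sequentially T_def J_def)
qed

end

section \<open>Second order expansion\<close>

lemma gateaux_line_derivative:
  assumes "has_gateaux_derivative g L (x + s *\<^sub>R h)"
  shows "((\<lambda>s. g (x + s *\<^sub>R h)) has_vector_derivative blinfun_apply L h) (at s)"
  unfolding has_vector_derivative_def has_derivative_at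
proof
  show "bounded_linear (\<lambda>r. r *\<^sub>R blinfun_apply L h)"
    by (rule bounded_linear_scaleR_left)
  have "((\<lambda>r. inverse r *\<^sub>R (g (x + s *\<^sub>R h + r *\<^sub>R h) - g (x + s *\<^sub>R h))) \<longlongrightarrow> blinfun_apply L h) (at 0)"
    using assms by (simp add: has_gateaux_derivative_def)
  then have "((\<lambda>r. norm (inverse r *\<^sub>R (g (x + s *\<^sub>R h + r *\<^sub>R h) - g (x + s *\<^sub>R h)) - blinfun_apply L h)) \<longlongrightarrow> 0) (at 0)"
    by (intro tendsto_norm_zero LIM_zero)
  then show "(\<lambda>r. norm (g (x + (s + r) *\<^sub>R h) - g (x + s *\<^sub>R h) - r *\<^sub>R blinfun_apply L h) / norm r) \<midarrow>0\<rightarrow> 0"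
  proof (rule Lim_transform_eventually)
    have "norm (inverse r *\<^sub>R (g (x + s *\<^sub>R h + r *\<^sub>R h) - g (x + s *\<^sub>R h)) - blinfun_apply L h)
        = norm (g (x + (s + r) *\<^sub>R h) - g (x + s *\<^sub>R h) - r *\<^sub>R blinfun_apply L h) / norm r" if "r \<noteq> 0" for r
    proof -
      have "inverse r *\<^sub>R (g (x + s *\<^sub>R h + r *\<^sub>R h) - g (x + s *\<^sub>R h)) - blinfun_apply L h
          = inverse r *\<^sub>R (g (x + (s + r) *\<^sub>R h) - g (x + s *\<^sub>R h) - r *\<^sub>R blinfun_apply L h)"
        using that by (simp add: algebra_simps)
      then show ?thesis
        using that by (simp add: divide_inverse abs_inverse)
    qed
    then show "\<forall>\<^sub>F r in at 0. norm (inverse r *\<^sub>R (g (x + s *\<^sub>R h + r *\<^sub>R h) - g (x + s *\<^sub>R h)) - blinfun_apply L h)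
        = norm (g (x + (s + r) *\<^sub>R h) - g (x + s *\<^sub>R h) - r *\<^sub>R blinfun_apply L h) / norm r"
      by (simp add: eventually_at_filter)
  qed
qed

lemma unit_interval_mean_value:
  fixes \<phi> :: "real \<Rightarrow> 'a::real_normed_vector"
  assumes "\<And>s. s \<in> {0..1} \<Longrightarrow> (\<phi> has_vector_derivative \<phi>' s) (at s)"
    and "\<And>s. s \<in> {0..1} \<Longrightarrow> norm (\<phi>' s) \<le> M" and s: "s \<in> {0..1}"
  shows "norm (\<phi> s - \<phi> 0) \<le> M"
proof -
  have M: "0 \<le> M"
    using assms(2)[of 0] norm_ge_zero[of "\<phi>' 0"] by (simp del: norm_ge_zero)
  have "norm (\<phi> s - \<phi> 0) \<le> M * norm (s - 0)"
  proof (rule differentiable_bound)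
    show "convex {0..1::real}" by simp
    fix r :: real assume r: "r \<in> {0..1}"
    show "(\<phi> has_derivative (\<lambda>x. x *\<^sub>R \<phi>' r)) (at r within {0..1})"
      using assms(1)[OF r] by (auto simp: has_vector_derivative_def intro: has_derivative_at_withinI)
    show "onorm (\<lambda>x. x *\<^sub>R \<phi>' r) \<le> M"
      using assms(2)[OF r] M by (intro onorm_bound) (auto simp: mult.commute[of M] intro: mult_left_mono)
  qed (use s in auto)
  also have "\<dots> \<le> M"
    using s M by (auto intro: mult_left_le)
  finally show ?thesis .
qed

text \<open>The expansion below uses segments between points of the range of a path. These may leave its
  closure \<open>K\<close>, so \<open>w\<close> has to be any point near \<open>K\<close>.\<close>

lemma uniformly_close_near_compact:
  fixes \<Phi> :: "'a::real_normed_vector \<Rightarrow> 'b::real_normed_vector"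
  assumes \<Phi>: "continuous_on UNIV \<Phi>" and K: "compact K" and \<eta>: "0 < \<eta>"
  obtains \<delta> where "0 < \<delta>" "\<And>z w. z \<in> K \<Longrightarrow> norm (w - z) \<le> \<delta> \<Longrightarrow> norm (\<Phi> w - \<Phi> z) \<le> \<eta>"
proof -
  have "\<exists>d>0. \<forall>w. norm (w - z) < d \<longrightarrow> norm (\<Phi> w - \<Phi> z) < \<eta> / 2" for z
    using \<Phi>[unfolded continuous_on_iff, rule_format, of z "\<eta>/2"] \<eta> by (simp add: dist_norm)
  then obtain d where d: "\<And>z. 0 < d z" "\<And>z w. norm (w - z) < d z \<Longrightarrow> norm (\<Phi> w - \<Phi> z) < \<eta> / 2"
    by metis
  have "K \<subseteq> (\<Union>z\<in>K. ball z (d z / 2))"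
    using d(1) by force
  then obtain D where D: "D \<subseteq> K" "finite D" "K \<subseteq> (\<Union>z\<in>D. ball z (d z / 2))"
    using compactE_image[OF K, of K "\<lambda>z. ball z (d z / 2)"] by blast
  define \<delta> where "\<delta> = Min (insert 1 ((\<lambda>z. d z / 3) ` D))"
  have "0 < \<delta>"
    unfolding \<delta>_def using D(2) d(1) by auto
  moreover have "\<delta> \<le> d z / 3" if "z \<in> D" for z
    unfolding \<delta>_def using D(2) that by (intro Min_le) auto
  ultimately have \<delta>: "0 < \<delta>" "\<And>z. z \<in> D \<Longrightarrow> \<delta> \<le> d z / 3" by auto
  have "norm (\<Phi> w - \<Phi> z) \<le> \<eta>" if z: "z \<in> K" and w: "norm (w - z) \<le> \<delta>" for z w
  proof -
    obtain c where c: "c \<in> D" "dist c z < d c / 2"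
      using D(3) z by auto
    have "norm (z - c) < d c / 2"
      using c(2) by (simp add: dist_norm norm_minus_commute)
    moreover have "norm (w - c) \<le> norm (w - z) + norm (z - c)"
      using norm_triangle_ineq[of "w - z" "z - c"] by simp
    ultimately have "norm (w - c) < d c" "norm (z - c) < d c"
      using w \<delta>(2)[OF c(1)] d(1)[of c] by linarith+
    then have "norm (\<Phi> w - \<Phi> c) < \<eta> / 2" "norm (\<Phi> z - \<Phi> c) < \<eta> / 2"
      using d(2) by auto
    then show ?thesis
      using norm_triangle_ineq4[of "\<Phi> w - \<Phi> c" "\<Phi> z - \<Phi> c"] by simp
  qed
  with \<delta>(1) show thesis by (rule that)
qed

lemma norm_Pair_mono: "norm a \<le> norm c \<Longrightarrow> norm b \<le> norm d \<Longrightarrow> norm (a, b) \<le> norm (c, d)"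
  by (auto simp: norm_Pair intro!: real_sqrt_le_mono add_mono power_mono)

locale ito_function =
  fixes B :: "'e::banach \<Rightarrow> 'e \<Rightarrow> 'e1::banach"
    and f :: "'f::banach \<times> 'e \<Rightarrow> 'g::banach"
    and Daf :: "'f \<times> 'e \<Rightarrow> 'f \<Rightarrow>\<^sub>L 'g"
    and Dxf :: "'f \<times> 'e \<Rightarrow> 'e \<Rightarrow>\<^sub>L 'g"
    and Dxxf :: "'f \<times> 'e \<Rightarrow> 'e \<Rightarrow>\<^sub>L 'e \<Rightarrow>\<^sub>L 'g"
    and DBf :: "'f \<times> 'e \<Rightarrow> 'e1 \<Rightarrow>\<^sub>L 'g"
  assumes B: "bounded_bilinear B"
    and f_a: "\<And>a x. has_gateaux_derivative (\<lambda>a'. f (a', x)) (Daf (a, x)) a"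
    and f_x: "\<And>a x. has_gateaux_derivative (\<lambda>x'. f (a, x')) (Dxf (a, x)) x"
    and f_xx: "\<And>a x. has_gateaux_derivative (\<lambda>x'. Dxf (a, x')) (Dxxf (a, x)) x"
    and Daf: "continuous_on UNIV Daf"
    and Dxf: "continuous_on UNIV Dxf"
    and DBf: "continuous_on UNIV DBf"
    and Dxxf_eq: "\<And>a x u v. blinfun_apply (blinfun_apply (Dxxf (a, x)) u) v = blinfun_apply (DBf (a, x)) (B u v)"
begin

definition remainder :: "'f \<times> 'e \<Rightarrow> 'f \<times> 'e \<Rightarrow> 'g" where
  "remainder z z' = f z' - f z - blinfun_apply (Daf z) (fst z' - fst z) - blinfun_apply (Dxf z) (snd z' - snd z)
     - (1/2) *\<^sub>R blinfun_apply (DBf z) (B (snd z' - snd z) (snd z' - snd z))"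

definition gauge :: "'f \<times> 'e \<Rightarrow> 'f \<times> 'e \<Rightarrow> real" where
  "gauge z z' = norm (fst z' - fst z) + (norm (snd z' - snd z))\<^sup>2"

text \<open>The increment is made in two steps, first from \<open>(a, x)\<close> to \<open>(a, x')\<close> and then to \<open>(a', x')\<close>. Along each
  segment the mean value inequality is applied, twice in the direction of \<open>x\<close>, to \<open>f\<close> minus its
  Taylor polynomial at \<open>(a, x)\<close>; the second derivative in the direction \<open>h\<close> is \<open>DBf\<close> applied to
  \<open>B h h\<close>, whose coefficient is nearly constant because \<open>DBf\<close> is continuous.\<close>

lemma remainder_little_o:
  assumes K: "compact K" and \<eta>: "0 < \<eta>"
  shows "\<exists>\<delta>>0. \<forall>z\<in>K. \<forall>z'. norm (z' - z) \<le> \<delta> \<longrightarrow> norm (remainder z z') \<le> \<eta> * gauge z z'"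
proof -
  obtain b where b: "0 < b" "\<And>u v. norm (B u v) \<le> norm u * norm v * b"
    using bounded_bilinear.pos_bounded[OF B] by blast
  obtain \<delta>1 where \<delta>1: "0 < \<delta>1" "\<And>z w. z \<in> K \<Longrightarrow> norm (w - z) \<le> \<delta>1 \<Longrightarrow> norm (Daf w - Daf z) \<le> \<eta>"
    using uniformly_close_near_compact[OF Daf K \<eta>] by blast
  have "0 < \<eta> / b" using \<eta> b by simp
  then obtain \<delta>2 where \<delta>2: "0 < \<delta>2" "\<And>z w. z \<in> K \<Longrightarrow> norm (w - z) \<le> \<delta>2 \<Longrightarrow> norm (DBf w - DBf z) \<le> \<eta> / b"
    using uniformly_close_near_compact[OF DBf K] by blast
  have "norm (remainder z z') \<le> \<eta> * gauge z z'" if z: "z \<in> K" and z': "norm (z' - z) \<le> min \<delta>1 \<delta>2" for z z'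
  proof -
    obtain a x where zp: "z = (a, x)" by (cases z)
    obtain a' x' where zp': "z' = (a', x')" by (cases z')
    define k h where "k = a' - a" and "h = x' - x"
    have close: "norm ((a + s *\<^sub>R k, x + r *\<^sub>R h) - z) \<le> min \<delta>1 \<delta>2" if "s \<in> {0..1}" "r \<in> {0..1}" for s r
    proof -
      have "norm (s *\<^sub>R k, r *\<^sub>R h) \<le> norm (k, h)"
        using that by (intro norm_Pair_mono) (auto intro: mult_left_le_one_le)
      then show ?thesis using z' by (simp add: zp zp' k_def h_def)
    qed
    have x': "x' = x + 1 *\<^sub>R h" and a': "a' = a + 1 *\<^sub>R k" by (simp_all add: h_def k_def)

    define \<phi> where "\<phi> s = f (a + s *\<^sub>R k, x') - s *\<^sub>R blinfun_apply (Daf z) k" for s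
    have "norm (\<phi> 1 - \<phi> 0) \<le> \<eta> * norm k"
    proof (rule unit_interval_mean_value)
      fix s :: real assume s: "s \<in> {0..1}"
      show "(\<phi> has_vector_derivative blinfun_apply (Daf (a + s *\<^sub>R k, x') - Daf z) k) (at s)"
        unfolding \<phi>_def blinfun.diff_left
        by (intro has_vector_derivative_diff gateaux_line_derivative[OF f_a])
          (auto intro!: derivative_eq_intros)
      have "norm (Daf (a + s *\<^sub>R k, x') - Daf z) \<le> \<eta>"
        using \<delta>1(2)[OF z] close[OF s, of 1] x' by simp
      then show "norm (blinfun_apply (Daf (a + s *\<^sub>R k, x') - Daf z) k) \<le> \<eta> * norm k"
        by (meson mult_right_mono norm_blinfun norm_ge_zero order_trans)
    qed simp
    then have first: "norm (f (a', x') - f (a, x') - blinfun_apply (Daf z) k) \<le> \<eta> * norm k"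
      using a' by (simp add: \<phi>_def algebra_simps)

    define \<psi> where "\<psi> s = blinfun_apply (Dxf (a, x + s *\<^sub>R h)) h - blinfun_apply (Dxf z) h
        - s *\<^sub>R blinfun_apply (DBf z) (B h h)" for s
    have \<psi>: "norm (\<psi> s) \<le> \<eta> * (norm h)\<^sup>2" if s: "s \<in> {0..1}" for s
    proof -
      have "norm (\<psi> s - \<psi> 0) \<le> \<eta> * (norm h)\<^sup>2"
      proof (rule unit_interval_mean_value[OF _ _ s])
        fix s :: real assume s: "s \<in> {0..1}"
        have "((\<lambda>s. blinfun_apply (Dxf (a, x + s *\<^sub>R h)) h) has_vector_derivative
            blinfun_apply (blinfun_apply (Dxxf (a, x + s *\<^sub>R h)) h) h) (at s)"
          using bounded_linear.has_vector_derivative[OF blinfun.bounded_linear_left gateaux_line_derivative[OF f_xx]] .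
        then have "((\<lambda>s. blinfun_apply (Dxf (a, x + s *\<^sub>R h)) h) has_vector_derivative
            blinfun_apply (DBf (a, x + s *\<^sub>R h)) (B h h)) (at s)"
          by (simp add: Dxxf_eq)
        then show "(\<psi> has_vector_derivative blinfun_apply (DBf (a, x + s *\<^sub>R h) - DBf z) (B h h)) (at s)"
          unfolding \<psi>_def blinfun.diff_left by (auto intro!: derivative_eq_intros)
        have "norm (DBf (a, x + s *\<^sub>R h) - DBf z) \<le> \<eta> / b"
          using \<delta>2(2)[OF z] close[of 0, OF _ s] by simp
        then have "norm (blinfun_apply (DBf (a, x + s *\<^sub>R h) - DBf z) (B h h)) \<le> \<eta> / b * norm (B h h)"
          by (meson mult_right_mono norm_blinfun norm_ge_zero order_trans)
        also have "\<dots> \<le> \<eta> / b * (norm h * norm h * b)"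
          using b \<eta> by (intro mult_left_mono) auto
        also have "\<dots> = \<eta> * (norm h)\<^sup>2"
          using b(1) by (simp add: power2_eq_square)
        finally show "norm (blinfun_apply (DBf (a, x + s *\<^sub>R h) - DBf z) (B h h)) \<le> \<eta> * (norm h)\<^sup>2" .
      qed
      then show ?thesis by (simp add: \<psi>_def zp)
    qed
    define \<omega> where "\<omega> s = f (a, x + s *\<^sub>R h) - s *\<^sub>R blinfun_apply (Dxf z) h
        - (s\<^sup>2 / 2) *\<^sub>R blinfun_apply (DBf z) (B h h)" for s
    have "norm (\<omega> 1 - \<omega> 0) \<le> \<eta> * (norm h)\<^sup>2"
    proof (rule unit_interval_mean_value[where \<phi>' = \<psi>, OF _ \<psi>])
      fix s :: real
      have "((\<lambda>s. f (a, x + s *\<^sub>R h)) has_vector_derivative blinfun_apply (Dxf (a, x + s *\<^sub>R h)) h) (at s)"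
        by (rule gateaux_line_derivative[OF f_x])
      then show "(\<omega> has_vector_derivative \<psi> s) (at s)"
        unfolding \<omega>_def \<psi>_def by (auto intro!: derivative_eq_intros)
    qed auto
    then have second: "norm (f (a, x') - f (a, x) - blinfun_apply (Dxf z) h - (1/2) *\<^sub>R blinfun_apply (DBf z) (B h h)) \<le> \<eta> * (norm h)\<^sup>2"
      using x' by (simp add: \<omega>_def algebra_simps)
    have "remainder z z' = (f (a', x') - f (a, x') - blinfun_apply (Daf z) k)
        + (f (a, x') - f (a, x) - blinfun_apply (Dxf z) h - (1/2) *\<^sub>R blinfun_apply (DBf z) (B h h))"
      by (simp add: remainder_def zp zp' k_def h_def)
    then have "norm (remainder z z') \<le> \<eta> * norm k + \<eta> * (norm h)\<^sup>2"
      using first second norm_triangle_mono by metis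
    then show ?thesis
      by (simp add: gauge_def zp zp' k_def h_def distrib_left)
  qed
  moreover have "0 < min \<delta>1 \<delta>2" using \<delta>1 \<delta>2 by simp
  ultimately show ?thesis by blast
qed

lemma continuous_gauge: "continuous_on UNIV (\<lambda>(z, z'). gauge z z')"
  unfolding gauge_def case_prod_unfold by (intro continuous_intros)

lemma continuous_on_B: "continuous_on S g \<Longrightarrow> continuous_on S h \<Longrightarrow> continuous_on S (\<lambda>x. B (g x) (h x))"
  by (rule bounded_bilinear.continuous_on[OF B])

lemma continuous_on_blinfun_apply_fst:
  fixes D :: "'f \<times> 'e \<Rightarrow> 'h::real_normed_vector \<Rightarrow>\<^sub>L 'g"
  assumes "continuous_on UNIV D" "continuous_on UNIV h"
  shows "continuous_on UNIV (\<lambda>w. blinfun_apply (D (fst w)) (h w))"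
  by (intro bounded_bilinear.continuous_on[OF bounded_bilinear_blinfun_apply] assms(2)
      continuous_on_compose2[OF assms(1)] continuous_intros) auto

text \<open>The derivatives are partial ones, so joint continuity has to be extracted from the expansion.\<close>

lemma continuous_f: "continuous_on UNIV f"
proof -
  have "f \<midarrow>z\<rightarrow> f z" for z
  proof -
    obtain \<delta> where \<delta>: "0 < \<delta>" "\<And>z'. norm (z' - z) \<le> \<delta> \<Longrightarrow> norm (remainder z z') \<le> 1 * gauge z z'"
      using remainder_little_o[of "{z}" 1] by auto
    have near: "\<forall>\<^sub>F z' in at z. norm (remainder z z') \<le> gauge z z'"
      unfolding eventually_at using \<delta> by (intro exI[of _ \<delta>]) (auto simp: dist_norm)
    have "((\<lambda>z'. gauge z z') \<longlongrightarrow> gauge z z) (at z)"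
      unfolding gauge_def by (intro tendsto_intros)
    then have g: "((\<lambda>z'. gauge z z') \<longlongrightarrow> 0) (at z)"
      by (simp add: gauge_def)
    have r: "((\<lambda>z'. remainder z z') \<longlongrightarrow> 0) (at z)"
      by (rule Lim_null_comparison[OF near g])
    have "((\<lambda>z'. remainder z z' + f z + blinfun_apply (Daf z) (fst z' - fst z) + blinfun_apply (Dxf z) (snd z' - snd z)
        + (1/2) *\<^sub>R blinfun_apply (DBf z) (B (snd z' - snd z) (snd z' - snd z)))
        \<longlongrightarrow> 0 + f z + blinfun_apply (Daf z) (fst z - fst z) + blinfun_apply (Dxf z) (snd z - snd z)
        + (1/2) *\<^sub>R blinfun_apply (DBf z) (B (snd z - snd z) (snd z - snd z))) (at z)"
      by (intro tendsto_intros r bounded_bilinear.tendsto[OF B])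
    then show ?thesis
      by (simp add: remainder_def bounded_bilinear.zero_left[OF B])
  qed
  then show ?thesis
    by (simp add: continuous_on_def)
qed

lemma continuous_remainder: "continuous_on UNIV (\<lambda>(z, z'). remainder z z')"
  unfolding remainder_def case_prod_unfold
  by (intro continuous_intros continuous_on_blinfun_apply_fst continuous_on_B Daf Dxf DBf
      continuous_on_compose2[OF continuous_f]) auto

end

section \<open>Truncating the partitions\<close>

lemma part_bounds:
  assumes \<tau>: "strict_mono \<tau>" and \<pi>: "\<pi> = range (\<lambda>i. {\<tau> i<..\<tau> (Suc i)})" and u: "\<tau> i < u" "u \<le> \<tau> (Suc i)"
  shows "part_lower \<pi> u = \<tau> i" "part_upper \<pi> u = \<tau> (Suc i)"
proof -
  have "part_interval \<pi> u = {\<tau> i<..\<tau> (Suc i)}"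
    unfolding part_interval_def
  proof (rule the_equality)
    show "{\<tau> i<..\<tau> (Suc i)} \<in> \<pi> \<and> u \<in> {\<tau> i<..\<tau> (Suc i)}"
      using u by (auto simp: \<pi>)
    fix I assume "I \<in> \<pi> \<and> u \<in> I"
    then obtain j where j: "I = {\<tau> j<..\<tau> (Suc j)}" "\<tau> j < u" "u \<le> \<tau> (Suc j)"
      by (auto simp: \<pi>)
    then have "\<tau> i < \<tau> (Suc j)" "\<tau> j < \<tau> (Suc i)" using u by auto
    then have "i < Suc j" "j < Suc i"
      using strict_mono_less[OF \<tau>] by auto
    then have "i = j" by simp
    then show "I = {\<tau> i<..\<tau> (Suc i)}" using j by simp
  qed
  moreover have "\<tau> i < \<tau> (Suc i)" using u by simp
  ultimately show "part_lower \<pi> u = \<tau> i" "part_upper \<pi> u = \<tau> (Suc i)"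
    by (simp_all add: part_lower_def part_upper_def)
qed

lemma infsum_partition:
  fixes h :: "real set \<Rightarrow> 'b::{comm_monoid_add, t2_space}"
  assumes \<tau>: "strict_mono \<tau>" and \<pi>: "\<pi> = range (\<lambda>i. {\<tau> i<..\<tau> (Suc i)})"
    and zero: "\<And>i. N \<le> i \<Longrightarrow> h {\<tau> i<..\<tau> (Suc i)} = 0"
  shows "(\<Sum>\<^sub>\<infinity>I\<in>\<pi>. h I) = (\<Sum>i<N. h {\<tau> i<..\<tau> (Suc i)})"
proof -
  have "inj (\<lambda>i. {\<tau> i<..\<tau> (Suc i)})"
  proof (rule injI)
    fix i j assume eq: "{\<tau> i<..\<tau> (Suc i)} = {\<tau> j<..\<tau> (Suc j)}"
    have "\<tau> i < \<tau> (Suc i)" "\<tau> j < \<tau> (Suc j)"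
      using \<tau> by (auto simp: strict_mono_less)
    then have "\<tau> i = \<tau> j"
      using eq cInf_greaterThanAtMost by metis
    then show "i = j" using strict_mono_eq[OF \<tau>] by simp
  qed
  then have "(\<Sum>\<^sub>\<infinity>I\<in>\<pi>. h I) = (\<Sum>\<^sub>\<infinity>i. h {\<tau> i<..\<tau> (Suc i)})"
    unfolding \<pi> by (simp add: infsum_reindex comp_def)
  also have "\<dots> = (\<Sum>\<^sub>\<infinity>i\<in>{..<N}. h {\<tau> i<..\<tau> (Suc i)})"
    using zero by (intro infsum_cong_neutral) auto
  finally show ?thesis by simp
qed

lemma sum_norm_nonneg: "0 \<le> sum_norm z"
  by (simp add: sum_norm_def)

text \<open>The bounds on both sides allow the sizes of jumps to be measured in the norm of the product type.\<close>

lemma norm_le_sum_norm: "norm z \<le> sum_norm z"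
  using norm_Pair_le[of "fst z" "snd z"] by (simp add: sum_norm_def)

lemma sum_norm_le_twice_norm: "sum_norm z \<le> 2 * norm z"
  using norm_fst_le[of "fst z" "snd z"] norm_snd_le[of "snd z" "fst z"] by (simp add: sum_norm_def)

text \<open>On an interval without jumps of size \<open>\<epsilon>\<close> the big jump part is constant, so that its subtraction does
  not change the oscillation. The oscillation only sees the half-open interval; its left end is
  reached by right continuity.\<close>

lemma condition_C_small_increments:
  fixes Z :: "real \<Rightarrow> 'f::real_normed_vector \<times> 'e::real_normed_vector"
  assumes Z: "cadlag Z" and C: "condition_C sum_norm \<pi>s Z" and t: "0 \<le> t" and \<eta>: "0 < \<eta>"
  shows "\<exists>\<epsilon>>0. \<forall>\<^sub>F n in sequentially. \<forall>a b c. {a<..b} \<in> \<pi>s n \<longrightarrow> 0 \<le> a \<longrightarrow> a < c \<longrightarrow> c \<le> b \<longrightarrow> c \<le> t \<longrightarrow>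
      (\<forall>u\<in>{a<..c}. norm (jump Z u) < \<epsilon>) \<longrightarrow> norm (Z c - Z a) \<le> \<eta>"
proof -
  define Y where "Y \<epsilon> u = Z u - big_jump_part sum_norm \<epsilon> Z u" for \<epsilon> u
  have "Limsup (at_right 0) (\<lambda>\<epsilon>. limsup (\<lambda>n. oscillation sum_norm (Y \<epsilon>) (\<pi>s n) t)) < ennreal \<eta>"
    using C t \<eta> by (simp add: condition_C_def Y_def[abs_def])
  then have "\<forall>\<^sub>F \<epsilon> in at_right 0. limsup (\<lambda>n. oscillation sum_norm (Y \<epsilon>) (\<pi>s n) t) < ennreal \<eta>"
    by (rule Limsup_lessD)
  then obtain b where b: "0 < b" "\<And>\<epsilon>. 0 < \<epsilon> \<Longrightarrow> \<epsilon> < b \<Longrightarrow> limsup (\<lambda>n. oscillation sum_norm (Y \<epsilon>) (\<pi>s n) t) < ennreal \<eta>"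
    unfolding eventually_at_right_field by blast
  define \<epsilon> where "\<epsilon> = b / 2"
  have \<epsilon>: "0 < \<epsilon>" using b(1) by (simp add: \<epsilon>_def)
  \<comment> \<open>Half of \<open>\<epsilon>\<close> is used below because \<^const>\<open>sum_norm\<close> is at most twice the norm.\<close>
  have "\<forall>\<^sub>F n in sequentially. oscillation sum_norm (Y \<epsilon>) (\<pi>s n) t < ennreal \<eta>"
    using b by (intro Limsup_lessD) (auto simp: \<epsilon>_def)
  then have "\<forall>\<^sub>F n in sequentially. \<forall>a b c. {a<..b} \<in> \<pi>s n \<longrightarrow> 0 \<le> a \<longrightarrow> a < c \<longrightarrow> c \<le> b \<longrightarrow> c \<le> t \<longrightarrow>
      (\<forall>u\<in>{a<..c}. norm (jump Z u) < \<epsilon> / 2) \<longrightarrow> norm (Z c - Z a) \<le> \<eta>"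
  proof eventually_elim
    case (elim n)
    show ?case
    proof (intro allI impI)
      fix a b c assume I: "{a<..b} \<in> \<pi>s n" and ac: "0 \<le> a" "a < c" "c \<le> b" "c \<le> t"
        and no_jump: "\<forall>u\<in>{a<..c}. norm (jump Z u) < \<epsilon> / 2"
      have "norm (Z c - Z u) \<le> \<eta>" if u: "a < u" "u < c" for u
      proof -
        have small: "s \<notin> big_jump_times sum_norm \<epsilon> Z" if "s \<in> {a<..c}" for s
          using no_jump that sum_norm_le_twice_norm[of "jump Z s"] by (force simp: big_jump_times_def)
        have "s \<in> {0<..c} \<inter> big_jump_times sum_norm \<epsilon> Z \<longleftrightarrow> s \<in> {0<..u} \<inter> big_jump_times sum_norm \<epsilon> Z" for s
          using small[of s] u ac by (cases "s \<le> u") auto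
        then have "{0<..c} \<inter> big_jump_times sum_norm \<epsilon> Z = {0<..u} \<inter> big_jump_times sum_norm \<epsilon> Z"
          by (rule set_eqI)
        then have "Y \<epsilon> c - Y \<epsilon> u = Z c - Z u"
          by (simp add: Y_def big_jump_part_def)
        then have "ennreal (sum_norm (Z c - Z u)) = ennreal (sum_norm (Y \<epsilon> c - Y \<epsilon> u))"
          by simp
        also have "\<dots> \<le> oscillation sum_norm (Y \<epsilon>) (\<pi>s n) t"
          unfolding oscillation_def using I ac u
          by (intro SUP_upper2[of "{a<..b}"] SUP_upper2[of c] SUP_upper2[of u]) auto
        also have "\<dots> < ennreal \<eta>" by (rule elim)
        finally have "sum_norm (Z c - Z u) < \<eta>"
          using ennreal_less_iff[OF sum_norm_nonneg] by blast
        then show ?thesis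
          using norm_le_sum_norm[of "Z c - Z u"] by simp
      qed
      then have ev: "\<forall>\<^sub>F u in at_right a. norm (Z c - Z u) \<le> \<eta>"
        unfolding eventually_at_right_field using ac by blast
      have "((\<lambda>u. norm (Z c - Z u)) \<longlongrightarrow> norm (Z c - Z a)) (at_right a)"
        using ac by (intro tendsto_intros cadlag_right[OF Z])
      then show "norm (Z c - Z a) \<le> \<eta>"
        using ev by (rule tendsto_upperbound) simp
    qed
  qed
  then show ?thesis
    using \<epsilon> by (intro exI[of _ "\<epsilon> / 2"]) simp
qed

lemma condition_C_imp_truncated_partitions:
  fixes Z :: "real \<Rightarrow> 'f::banach \<times> 'e::banach"
  assumes Z: "cadlag Z" and C: "condition_C sum_norm \<pi>s Z" and left: "approximates_from_left \<pi>s Z" and t: "0 \<le> t"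
    and \<tau>: "\<And>n. \<tau> n 0 = 0" "\<And>n. strict_mono (\<tau> n)" "\<And>n. \<pi>s n = range (\<lambda>i. {\<tau> n i<..\<tau> n (Suc i)})"
    and \<kappa>: "\<And>n u. 0 < u \<Longrightarrow> \<tau> n (\<kappa> n u) < u \<and> u \<le> \<tau> n (Suc (\<kappa> n u))"
    and N: "\<And>n i. i < N n \<longleftrightarrow> \<tau> n i < t"
  shows "truncated_partitions t (\<lambda>n i. min (\<tau> n i) t) N \<kappa> Z"
proof -
  have N_end: "t \<le> \<tau> n (N n)" for n
    using N[of "N n" n] by (simp add: not_less)
  have low: "min (\<tau> n i) t = \<tau> n i" if "i < N n" for n i
    using N[of i n] that by simp
  have bounds: "part_lower (\<pi>s n) u = \<tau> n (\<kappa> n u)" "part_upper (\<pi>s n) u = \<tau> n (Suc (\<kappa> n u))" if "0 < u" for n u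
    using part_bounds[OF \<tau>(2,3), of n "\<kappa> n u" u] \<kappa>[OF that] by auto
  have \<kappa>_N: "\<kappa> n u < N n" if "u \<in> {0<..t}" for n u
    using \<kappa>[of u n] that N[of "\<kappa> n u" n] by auto
  show ?thesis
  proof
    show "0 \<le> t" by fact
    show "cadlag Z" by fact
    show "strict_mono_on {..N n} (\<lambda>i. min (\<tau> n i) t)" for n
    proof (rule strict_mono_onI)
      fix i j assume ij: "i \<in> {..N n}" "j \<in> {..N n}" "i < j"
      then have "\<tau> n i < t" using N[of i n] by auto
      moreover have "\<tau> n i < \<tau> n j" using \<tau>(2) ij by (auto simp: strict_mono_less)
      ultimately show "min (\<tau> n i) t < min (\<tau> n j) t" by auto
    qed
    show "min (\<tau> n 0) t = 0" for n using t \<tau>(1) by simp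
    show "min (\<tau> n (N n)) t = t" for n using N_end by simp
    fix u assume u: "u \<in> {0<..t}"
    show "\<kappa> n u < N n" for n by (rule \<kappa>_N[OF u])
    show "min (\<tau> n (\<kappa> n u)) t < u" "u \<le> min (\<tau> n (Suc (\<kappa> n u))) t" for n
      using \<kappa>[of u n] u by auto
    show "(\<lambda>n. Z (min (\<tau> n (\<kappa> n u)) t)) \<longlonglongrightarrow> left_lim Z u"
      using left u unfolding approximates_from_left_def by (simp add: low[OF \<kappa>_N[OF u]] bounds)
    fix s assume s: "jump Z u \<noteq> 0" "u \<le> s" "s \<le> t"
    have "(\<lambda>n. Z (min (part_upper (\<pi>s n) u) s) - Z (min (part_lower (\<pi>s n) u) s)) \<longlonglongrightarrow> jump Z u"
      using C u s unfolding condition_C_def by (simp add: jump_times_def)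
    moreover have "min (part_upper (\<pi>s n) u) s = min (min (\<tau> n (Suc (\<kappa> n u))) t) s"
      "min (part_lower (\<pi>s n) u) s = min (\<tau> n (\<kappa> n u)) t" for n
      using \<kappa>[of u n] u s by (auto simp: bounds)
    ultimately show "(\<lambda>n. Z (min (min (\<tau> n (Suc (\<kappa> n u))) t) s) - Z (min (\<tau> n (\<kappa> n u)) t)) \<longlonglongrightarrow> jump Z u"
      by simp
  next
    fix \<epsilon> :: real assume \<epsilon>: "0 < \<epsilon>"
    obtain n0 where n0: "\<And>n I u v. n0 \<le> n \<Longrightarrow> I \<in> \<pi>s n \<Longrightarrow> u \<in> I \<inter> {0..t} \<inter> big_jump_times sum_norm \<epsilon> Z \<Longrightarrow>
        v \<in> I \<inter> {0..t} \<inter> big_jump_times sum_norm \<epsilon> Z \<Longrightarrow> u = v"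
      using C t \<epsilon> unfolding condition_C_def by metis
    have "u = v" if n: "n0 \<le> n" and u: "u \<in> {0<..t}" "\<epsilon> \<le> norm (jump Z u)"
      and v: "v \<in> {0<..t}" "\<epsilon> \<le> norm (jump Z v)" and eq: "\<kappa> n u = \<kappa> n v" for n u v
    proof (rule n0[OF n])
      show "{\<tau> n (\<kappa> n u)<..\<tau> n (Suc (\<kappa> n u))} \<in> \<pi>s n" by (simp add: \<tau>(3))
      show "u \<in> {\<tau> n (\<kappa> n u)<..\<tau> n (Suc (\<kappa> n u))} \<inter> {0..t} \<inter> big_jump_times sum_norm \<epsilon> Z"
        using \<kappa>[of u n] u norm_le_sum_norm[of "jump Z u"] by (auto simp: big_jump_times_def)
      show "v \<in> {\<tau> n (\<kappa> n u)<..\<tau> n (Suc (\<kappa> n u))} \<inter> {0..t} \<inter> big_jump_times sum_norm \<epsilon> Z"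
        using \<kappa>[of v n] v norm_le_sum_norm[of "jump Z v"] by (auto simp: big_jump_times_def eq)
    qed
    then show "\<forall>\<^sub>F n in sequentially. \<forall>u\<in>{0<..t}. \<forall>v\<in>{0<..t}.
        \<epsilon> \<le> norm (jump Z u) \<and> \<epsilon> \<le> norm (jump Z v) \<and> \<kappa> n u = \<kappa> n v \<longrightarrow> u = v"
      unfolding eventually_sequentially by blast
  next
    fix \<eta> :: real assume \<eta>: "0 < \<eta>"
    obtain \<epsilon> where \<epsilon>: "0 < \<epsilon>" and ev: "\<forall>\<^sub>F n in sequentially. \<forall>a b c. {a<..b} \<in> \<pi>s n \<longrightarrow> 0 \<le> a \<longrightarrow> a < c \<longrightarrow> c \<le> b \<longrightarrow> c \<le> t \<longrightarrow>
      (\<forall>u\<in>{a<..c}. norm (jump Z u) < \<epsilon>) \<longrightarrow> norm (Z c - Z a) \<le> \<eta>"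
      using condition_C_small_increments[OF Z C t \<eta>] by blast
    have "\<forall>\<^sub>F n in sequentially. \<forall>i<N n.
        (\<forall>u\<in>{min (\<tau> n i) t<..min (\<tau> n (Suc i)) t}. norm (jump Z u) < \<epsilon>) \<longrightarrow>
          norm (Z (min (\<tau> n (Suc i)) t) - Z (min (\<tau> n i) t)) \<le> \<eta>"
      using ev
    proof eventually_elim
      case (elim n)
      show ?case
      proof (intro allI impI)
        fix i assume i: "i < N n" and H: "\<forall>u\<in>{min (\<tau> n i) t<..min (\<tau> n (Suc i)) t}. norm (jump Z u) < \<epsilon>"
        have "\<tau> n i < \<tau> n (Suc i)" "0 \<le> \<tau> n i"
          using \<tau>(2)[of n] strict_mono_less_eq[OF \<tau>(2), of n 0 i] \<tau>(1)[of n] by (auto simp: strict_mono_less)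
        moreover have "\<tau> n i < t" using N i by simp
        ultimately show "norm (Z (min (\<tau> n (Suc i)) t) - Z (min (\<tau> n i) t)) \<le> \<eta>"
          using H unfolding low[OF i]
          by (intro elim[rule_format, of "\<tau> n i" "\<tau> n (Suc i)"]) (auto simp: \<tau>(3))
      qed
    qed
    then show "\<exists>\<epsilon>>0. \<forall>\<^sub>F n in sequentially. \<forall>i<N n.
        (\<forall>u\<in>{min (\<tau> n i) t<..min (\<tau> n (Suc i)) t}. norm (jump Z u) < \<epsilon>) \<longrightarrow>
          norm (Z (min (\<tau> n (Suc i)) t) - Z (min (\<tau> n i) t)) \<le> \<eta>"
      using \<epsilon> by blast
  qed
qed

section \<open>The change of variables formula\<close>

theorem theorem3p6:
  fixes B :: "'e::banach \<Rightarrow> 'e \<Rightarrow> 'e1::banach"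
    and A :: "real \<Rightarrow> 'f::banach"
    and X :: "real \<Rightarrow> 'e"
    and \<pi>s :: "nat \<Rightarrow> real set set"
    and Q :: "real \<Rightarrow> 'e1"
    and f :: "'f \<times> 'e \<Rightarrow> 'g::banach"
    and Daf :: "'f \<times> 'e \<Rightarrow> 'f \<Rightarrow>\<^sub>L 'g"
    and Dxf :: "'f \<times> 'e \<Rightarrow> 'e \<Rightarrow>\<^sub>L 'g"
    and Dxxf :: "'f \<times> 'e \<Rightarrow> 'e \<Rightarrow>\<^sub>L 'e \<Rightarrow>\<^sub>L 'g"
    and DBf :: "'f \<times> 'e \<Rightarrow> 'e1 \<Rightarrow>\<^sub>L 'g"
  assumes "bounded_bilinear B"
    and "cadlag (\<lambda>t. (A t, X t))"
    and "\<And>n. is_partition (\<pi>s n)"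
    and "condition_C sum_norm \<pi>s (\<lambda>t. (A t, X t))"
    and "approximates_from_left \<pi>s (\<lambda>t. (A t, X t))"
    and "has_weak_quadratic_variation B \<pi>s X Q"
    and "finite_2_variation \<pi>s X"
    and "finite_variation A"
    and "\<And>a x. has_gateaux_derivative (\<lambda>a'. f (a', x)) (Daf (a, x)) a"
    and "continuous_map euclidean Lc_topology Daf"
    and "\<And>a x. has_gateaux_derivative (\<lambda>x'. f (a, x')) (Dxf (a, x)) x"
    and "\<And>a x. has_gateaux_derivative (\<lambda>x'. Dxf (a, x')) (Dxxf (a, x)) x"
    and "continuous_map euclidean Lc_topology Dxf"
    and "continuous_map euclidean Lc_topology DBf"
    and "\<And>a x u v. blinfun_apply (blinfun_apply (Dxxf (a, x)) u) v
                    = blinfun_apply (DBf (a, x)) (B u v)"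
  shows "\<forall>t\<ge>0. \<exists>I.
      limitin weak_topology
        (\<lambda>n. ito_foellmer_sum (\<pi>s n) (\<lambda>r. Dxf (A r, X r)) X t)
        I sequentially \<and>
      (\<lambda>s. (f (A s, X s) - f (left_lim A s, left_lim X s))
             - blinfun_apply (Dxf (left_lim A s, left_lim X s)) (jump X s)) summable_on {0<..t} \<and>
      f (A t, X t) - f (A 0, X 0) =
        stieltjes_integral t (\<lambda>s. Daf (left_lim A s, left_lim X s)) (continuous_part A)
        + I
        + (1/2) *\<^sub>R
          stieltjes_integral t (\<lambda>s. DBf (left_lim A s, left_lim X s)) (continuous_part Q)
        + (\<Sum>\<^sub>\<infinity>s\<in>{0<..t}. (f (A s, X s) - f (left_lim A s, left_lim X s))
             - blinfun_apply (Dxf (left_lim A s, left_lim X s)) (jump X s)) \<and>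
      (has_strong_quadratic_variation B \<pi>s X Q \<longrightarrow>
        (\<lambda>n. ito_foellmer_sum (\<pi>s n) (\<lambda>r. Dxf (A r, X r)) X t)
          \<longlonglongrightarrow> I)"

proof (intro allI impI)
  fix t :: real assume t: "0 \<le> t"
  define Z where "Z = (\<lambda>t. (A t, X t))"
  interpret ito_function B f Daf Dxf Dxxf DBf
    by (rule ito_function.intro) (rule assms Lc_continuous_imp_continuous)+
  interpret B: bounded_bilinear B by (rule B)

  have Z: "cadlag Z" using assms(2) by (simp add: Z_def)
  have A: "cadlag A" and X: "cadlag X"
    using cadlag_compose(1)[OF Z continuous_on_fst[OF continuous_on_id]]
      cadlag_compose(1)[OF Z continuous_on_snd[OF continuous_on_id]] by (simp_all add: Z_def)
  have Z_at: "Z s = (A s, X s)" for s by (simp add: Z_def)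
  have left_Z: "left_lim Z s = (left_lim A s, left_lim X s)" for s
  proof (cases "0 \<le> s")
    case True
    then show ?thesis
      using cadlag_compose(2)[OF Z continuous_on_fst[OF continuous_on_id] True]
        cadlag_compose(2)[OF Z continuous_on_snd[OF continuous_on_id] True]
      by (simp add: Z_def prod_eq_iff)
  qed (simp add: left_lim_def Z_def)
  have Q: "cadlag Q" "finite_variation Q"
    and Q_lim: "\<And>s \<psi>. 0 \<le> s \<Longrightarrow> (\<lambda>n. blinfun_apply \<psi> (\<Sum>\<^sub>\<infinity>I\<in>\<pi>s n. B (increment X s I) (increment X s I)))
      \<longlonglongrightarrow> blinfun_apply (\<psi> :: 'e1 \<Rightarrow>\<^sub>L real) (Q s)"
    and jump_Q: "\<And>s. 0 \<le> s \<Longrightarrow> jump Q s = B (jump X s) (jump X s)"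
    using assms(6) by (simp_all add: has_quadratic_variation_def limitin_weak_topology)

  have "\<forall>n. \<exists>\<tau>. \<tau> 0 = 0 \<and> strict_mono \<tau> \<and> filterlim \<tau> at_top sequentially \<and>
        \<pi>s n = range (\<lambda>i. {\<tau> i<..\<tau> (Suc i) :: real})"
    using assms(3) by (simp add: is_partition_def)
  then obtain \<tau> where \<tau>: "\<And>n. \<tau> n 0 = 0" "\<And>n. strict_mono (\<tau> n)" "\<And>n. filterlim (\<tau> n) at_top sequentially"
    "\<And>n. \<pi>s n = range (\<lambda>i. {\<tau> n i<..\<tau> n (Suc i) :: real})"
    by metis
  have unbounded: "\<exists>k. s \<le> \<tau> n k" for n s
    using \<tau>(3)[of n] unfolding filterlim_at_top eventually_sequentially by blast
  have ex_interval: "\<exists>i. \<tau> n i < u \<and> u \<le> \<tau> n (Suc i)" if "0 < u" for n u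
  proof -
    obtain k where "u \<le> \<tau> n k" using unbounded by blast
    then show ?thesis
      using ex_left_open_interval[of "\<tau> n" u k] that \<tau>(1) by auto
  qed
  define \<kappa> where "\<kappa> n u = (SOME i. \<tau> n i < u \<and> u \<le> \<tau> n (Suc i))" for n u
  have \<kappa>: "\<tau> n (\<kappa> n u) < u \<and> u \<le> \<tau> n (Suc (\<kappa> n u))" if "0 < u" for n u
    unfolding \<kappa>_def using ex_interval[OF that] by (rule someI_ex)
  \<comment> \<open>The number of partition points before \<open>t\<close>; it is \<open>0\<close> if \<open>t = 0\<close>.\<close>
  define N where "N n = (LEAST k. t \<le> \<tau> n k)" for n
  have N: "i < N n \<longleftrightarrow> \<tau> n i < t" for n i
  proof
    assume "i < N n"
    then show "\<tau> n i < t"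
      unfolding N_def using not_less_Least[of i "\<lambda>k. t \<le> \<tau> n k"] by (simp add: not_le)
  next
    assume "\<tau> n i < t"
    moreover have "t \<le> \<tau> n (N n)"
      unfolding N_def using unbounded[of t n] by (rule LeastI_ex)
    ultimately have "\<tau> n i < \<tau> n (N n)" by simp
    then show "i < N n" using strict_mono_less[OF \<tau>(2)] by simp
  qed
  define q where "q n i = min (\<tau> n i) t" for n i
  have "truncated_partitions t (\<lambda>n i. min (\<tau> n i) t) N \<kappa> Z"
    by (rule condition_C_imp_truncated_partitions[OF Z _ _ t \<tau>(1,2,4) \<kappa> N])
      (use assms(4,5) in \<open>simp_all add: Z_def\<close>)
  then interpret truncated_partitions t q N \<kappa> Z
    by (simp add: q_def[abs_def])
  have q_eq: "q n i = \<tau> n i" if "i < N n" for n i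
    using that N[of i n] by (simp add: q_def)
  have interval: "\<tau> n i < \<tau> n (Suc i)" for n i
    using \<tau>(2) by (simp add: strict_mono_less)
  have increment: "increment X s {\<tau> n i<..\<tau> n (Suc i)} = X (min (q n (Suc i)) s) - X (min (q n i) s)"
    if "s \<le> t" for n i s
    using interval[of n i] that by (simp add: increment_def q_def min.assoc min_absorb2)
  have increment_0: "increment X s {\<tau> n i<..\<tau> n (Suc i)} = 0" if "N n \<le> i" "s \<le> t" for n i s
  proof -
    have "t \<le> \<tau> n i" using N[of i n] that by (simp add: not_less)
    then show ?thesis
      using interval[of n i] that by (simp add: increment_def min_absorb2)
  qed
  have increment_t: "increment X t {\<tau> n i<..\<tau> n (Suc i)} = X (q n (Suc i)) - X (q n i)" for n i
    using increment[of t n i] by (simp add: q_def)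

  \<comment> \<open>The two kinds of increments of which Riemann sums are formed.\<close>
  define \<beta>A :: "'f \<times> 'e \<Rightarrow> 'f \<times> 'e \<Rightarrow> 'f" where "\<beta>A z z' = fst z' - fst z" for z z'
  define \<beta>B :: "'f \<times> 'e \<Rightarrow> 'f \<times> 'e \<Rightarrow> 'e1" where "\<beta>B z z' = B (snd z' - snd z) (snd z' - snd z)" for z z'
  have cont_\<beta>A: "continuous_on UNIV (\<lambda>(z, z'). \<beta>A z z')"
    unfolding \<beta>A_def case_prod_unfold by (intro continuous_intros)
  have cont_\<beta>B: "continuous_on UNIV (\<lambda>(z, z'). \<beta>B z z')"
    unfolding \<beta>B_def case_prod_unfold by (intro continuous_on_B continuous_intros)

  obtain vA where vA: "increments_dominated t vA A"
    using finite_variation_dominated[OF assms(8) t] .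
  obtain vQ where vQ: "increments_dominated t vQ Q"
    using finite_variation_dominated[OF Q(2) t] .
  have bound_A: "(\<Sum>i<N n. norm (A (q n (Suc i)) - A (q n i))) \<le> vA t - vA 0" for n
  proof -
    have "(\<Sum>i<N n. norm (A (q n (Suc i)) - A (q n i))) \<le> (\<Sum>i<N n. vA (q n (Suc i)) - vA (q n i))"
    proof (rule sum_mono)
      fix i assume "i \<in> {..<N n}"
      then show "norm (A (q n (Suc i)) - A (q n i)) \<le> vA (q n (Suc i)) - vA (q n i)"
        using q_in[of i n] q_in[of "Suc i" n] q_less[of i n]
        by (intro increments_dominatedD[OF vA]) auto
    qed
    also have "\<dots> = vA t - vA 0"
      using sum_lessThan_telescope[of "\<lambda>i. vA (q n i)" "N n"] by (simp add: q_start q_end)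
    finally show ?thesis .
  qed
  define V2 where "V2 = (SUP n. \<Sum>\<^sub>\<infinity>I\<in>\<pi>s n. ennreal ((norm (increment X t I))\<^sup>2))"
  have V2: "V2 < \<infinity>"
    using assms(7) t by (simp add: finite_2_variation_def V2_def)
  have bound_X: "(\<Sum>i<N n. (norm (X (q n (Suc i)) - X (q n i)))\<^sup>2) \<le> enn2real V2" for n
  proof -
    have "ennreal (\<Sum>i<N n. (norm (X (q n (Suc i)) - X (q n i)))\<^sup>2)
        = (\<Sum>i<N n. ennreal ((norm (increment X t {\<tau> n i<..\<tau> n (Suc i)}))\<^sup>2))"
      by (simp add: increment_t)
    also have "\<dots> = (\<Sum>\<^sub>\<infinity>I\<in>\<pi>s n. ennreal ((norm (increment X t I))\<^sup>2))"
      by (rule infsum_partition[OF \<tau>(2,4), symmetric]) (simp add: increment_0)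
    also have "\<dots> \<le> V2"
      unfolding V2_def by (rule SUP_upper) simp
    also have "V2 = ennreal (enn2real V2)"
      using V2 by (simp add: ennreal_enn2real)
    finally show ?thesis by simp
  qed
  define C where "C = vA t - vA 0 + enn2real V2"
  have bound_gauge: "(\<Sum>i<N n. gauge (Z (q n i)) (Z (q n (Suc i)))) \<le> C" for n
    using add_mono[OF bound_A[of n] bound_X[of n]] by (simp add: gauge_def Z_def C_def sum.distrib)
  have bound_\<beta>A: "(\<Sum>i<N n. norm (\<beta>A (Z (q n i)) (Z (q n (Suc i))))) \<le> vA t - vA 0" for n
    using bound_A[of n] by (simp add: \<beta>A_def Z_def)
  obtain b where b: "0 < b" "\<And>u v. norm (B u v) \<le> norm u * norm v * b"
    using B.pos_bounded by blast
  have bound_\<beta>B: "(\<Sum>i<N n. norm (\<beta>B (Z (q n i)) (Z (q n (Suc i))))) \<le> enn2real V2 * b" for n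
  proof -
    have "(\<Sum>i<N n. norm (\<beta>B (Z (q n i)) (Z (q n (Suc i))))) \<le> (\<Sum>i<N n. (norm (X (q n (Suc i)) - X (q n i)))\<^sup>2 * b)"
      by (rule sum_mono) (use b(2) in \<open>simp add: \<beta>B_def Z_def power2_eq_square\<close>)
    also have "\<dots> \<le> enn2real V2 * b"
      unfolding sum_distrib_right[symmetric] using bound_X[of n] b(1) by (intro mult_right_mono) auto
    finally show ?thesis .
  qed

  have sum_A: "truncated_sum \<beta>A n s = A s - A 0" if "s \<in> {0..t}" for n s
    using sum_lessThan_telescope[of "\<lambda>i. A (min (q n i) s)" "N n"] that
    unfolding truncated_sum_def by (simp add: \<beta>A_def Z_def q_start q_end)
  have sum_B: "truncated_sum \<beta>B n s = (\<Sum>\<^sub>\<infinity>I\<in>\<pi>s n. B (increment X s I) (increment X s I))" if "s \<in> {0..t}" for n s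
  proof -
    have "truncated_sum \<beta>B n s = (\<Sum>i<N n. B (increment X s {\<tau> n i<..\<tau> n (Suc i)}) (increment X s {\<tau> n i<..\<tau> n (Suc i)}))"
      unfolding truncated_sum_def using that by (simp add: \<beta>B_def Z_def increment)
    also have "\<dots> = (\<Sum>\<^sub>\<infinity>I\<in>\<pi>s n. B (increment X s I) (increment X s I))"
      by (rule infsum_partition[OF \<tau>(2,4), symmetric]) (use that in \<open>simp add: increment_0 B.zero_left\<close>)
    finally show ?thesis .
  qed

  define SA where "SA n = (\<Sum>i<N n. blinfun_apply (Daf (Z (q n i))) (\<beta>A (Z (q n i)) (Z (q n (Suc i)))))" for n
  define SB where "SB n = (\<Sum>i<N n. blinfun_apply (DBf (Z (q n i))) (\<beta>B (Z (q n i)) (Z (q n (Suc i)))))" for n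
  define SR where "SR n = (\<Sum>i<N n. remainder (Z (q n i)) (Z (q n (Suc i))))" for n
  define Ito where "Ito n = ito_foellmer_sum (\<pi>s n) (\<lambda>r. Dxf (A r, X r)) X t" for n
  define JA where "JA = stieltjes_integral t (\<lambda>s. Daf (left_lim Z s)) A"
  define JB where "JB = stieltjes_integral t (\<lambda>s. DBf (left_lim Z s)) Q"
  define JR where "JR = (\<Sum>\<^sub>\<infinity>u\<in>{0<..t}. remainder (left_lim Z u) (Z u))"
  define I where "I = f (Z t) - f (Z 0) - JA - (1/2) *\<^sub>R JB - JR"

  have Ito_eq: "Ito n = (\<Sum>i<N n. blinfun_apply (Dxf (Z (q n i))) (X (q n (Suc i)) - X (q n i)))" for n
  proof -
    have "Ito n = (\<Sum>i<N n. blinfun_apply (Dxf (A (Inf {\<tau> n i<..\<tau> n (Suc i)}), X (Inf {\<tau> n i<..\<tau> n (Suc i)})))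
        (increment X t {\<tau> n i<..\<tau> n (Suc i)}))"
      unfolding Ito_def ito_foellmer_sum_def
      by (rule infsum_partition[OF \<tau>(2,4)]) (simp add: increment_0)
    also have "\<dots> = (\<Sum>i<N n. blinfun_apply (Dxf (Z (q n i))) (X (q n (Suc i)) - X (q n i)))"
      by (rule sum.cong) (simp_all add: interval increment_t Z_def q_eq)
    finally show ?thesis .
  qed
  have expansion: "f (Z t) - f (Z 0) = SA n + Ito n + (1/2) *\<^sub>R SB n + SR n" for n
  proof -
    have "f (Z t) - f (Z 0) = (\<Sum>i<N n. f (Z (q n (Suc i))) - f (Z (q n i)))"
      using sum_lessThan_telescope[of "\<lambda>i. f (Z (q n i))" "N n"] by (simp add: q_start q_end)
    also have "\<dots> = (\<Sum>i<N n. blinfun_apply (Daf (Z (q n i))) (\<beta>A (Z (q n i)) (Z (q n (Suc i))))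
        + blinfun_apply (Dxf (Z (q n i))) (X (q n (Suc i)) - X (q n i))
        + (1/2) *\<^sub>R blinfun_apply (DBf (Z (q n i))) (\<beta>B (Z (q n i)) (Z (q n (Suc i))))
        + remainder (Z (q n i)) (Z (q n (Suc i))))"
      by (rule sum.cong) (simp_all add: remainder_def \<beta>A_def \<beta>B_def Z_def)
    also have "\<dots> = SA n + Ito n + (1/2) *\<^sub>R SB n + SR n"
      by (simp add: sum.distrib SA_def SB_def SR_def Ito_eq scaleR_sum_right)
    finally show ?thesis .
  qed
  have Ito_split: "Ito n = f (Z t) - f (Z 0) - SA n - (1/2) *\<^sub>R SB n - SR n" for n
    unfolding expansion[of n] by simp

  have little_o: "\<exists>\<delta>>0. \<forall>z\<in>R. \<forall>z'. norm (z' - z) \<le> \<delta> \<longrightarrow> norm (remainder z z') \<le> \<eta> * gauge z z'"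
    if "0 < \<eta>" for \<eta>
    using remainder_little_o[OF compact_R that] .
  have gauge_0: "gauge z z = 0" and gauge_nonneg: "0 \<le> gauge z z'" for z z'
    by (simp_all add: gauge_def)
  note R_lim = sum_little_o[OF continuous_gauge gauge_0 gauge_nonneg bound_gauge continuous_remainder little_o]
  have SR_lim: "SR \<longlonglongrightarrow> JR"
    using R_lim(2) by (simp add: SR_def[abs_def] JR_def)
  have diag_A: "\<beta>A z z = 0" for z
    by (simp add: \<beta>A_def)
  have SA_lim: "SA \<longlonglongrightarrow> JA"
  proof -
    have "(\<lambda>n. blinfun_apply id_blinfun (SA n)) \<longlonglongrightarrow> blinfun_apply id_blinfun JA"
      unfolding SA_def JA_def
      by (rule riemann_sums_tendsto[OF Daf cont_\<beta>A diag_A bound_\<beta>A vA]) (simp add: sum_A)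
    then show ?thesis by simp
  qed
  have diag_B: "\<beta>B z z = 0" for z
    by (simp add: \<beta>B_def B.zero_left)
  have SB_lim: "(\<lambda>n. blinfun_apply \<psi> (SB n)) \<longlonglongrightarrow> blinfun_apply \<psi> JB" for \<psi> :: "'g \<Rightarrow>\<^sub>L real"
    unfolding SB_def JB_def
  proof (rule riemann_sums_tendsto[OF DBf cont_\<beta>B diag_B bound_\<beta>B vQ])
    fix M :: "'e1 \<Rightarrow>\<^sub>L 'g" and x y assume xy: "x \<in> {0..t}" "y \<in> {0..t}"
    have "(\<lambda>n. blinfun_apply (\<psi> o\<^sub>L M) (truncated_sum \<beta>B n y) - blinfun_apply (\<psi> o\<^sub>L M) (truncated_sum \<beta>B n x))
        \<longlonglongrightarrow> blinfun_apply (\<psi> o\<^sub>L M) (Q y) - blinfun_apply (\<psi> o\<^sub>L M) (Q x)"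
      unfolding sum_B[OF xy(1)] sum_B[OF xy(2)] using xy by (intro tendsto_diff Q_lim) auto
    then show "(\<lambda>n. blinfun_apply \<psi> (blinfun_apply M (truncated_sum \<beta>B n y - truncated_sum \<beta>B n x)))
        \<longlonglongrightarrow> blinfun_apply \<psi> (blinfun_apply M (Q y - Q x))"
      by (simp add: blinfun.diff_right)
  qed
  have weak: "limitin weak_topology Ito I sequentially"
    unfolding limitin_weak_topology
  proof
    fix \<psi> :: "'g \<Rightarrow>\<^sub>L real"
    have "(\<lambda>n. blinfun_apply \<psi> (f (Z t) - f (Z 0)) - blinfun_apply \<psi> (SA n) - (1/2) *\<^sub>R blinfun_apply \<psi> (SB n) - blinfun_apply \<psi> (SR n))
        \<longlonglongrightarrow> blinfun_apply \<psi> (f (Z t) - f (Z 0)) - blinfun_apply \<psi> JA - (1/2) *\<^sub>R blinfun_apply \<psi> JB - blinfun_apply \<psi> JR"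
      by (intro tendsto_intros SA_lim SB_lim SR_lim)
    then show "(\<lambda>n. blinfun_apply \<psi> (Ito n)) \<longlonglongrightarrow> blinfun_apply \<psi> I"
      by (simp add: Ito_split I_def blinfun.diff_right blinfun.scaleR_right)
  qed
  have strong: "Ito \<longlonglongrightarrow> I" if "has_strong_quadratic_variation B \<pi>s X Q"
  proof -
    have Q_lim': "(\<lambda>n. \<Sum>\<^sub>\<infinity>I\<in>\<pi>s n. B (increment X s I) (increment X s I)) \<longlonglongrightarrow> Q s" if "0 \<le> s" for s
      using \<open>has_strong_quadratic_variation B \<pi>s X Q\<close> that by (simp add: has_quadratic_variation_def)
    have "(\<lambda>n. blinfun_apply id_blinfun (SB n)) \<longlonglongrightarrow> blinfun_apply id_blinfun JB"
      unfolding SB_def JB_def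
    proof (rule riemann_sums_tendsto[OF DBf cont_\<beta>B diag_B bound_\<beta>B vQ])
      fix M :: "'e1 \<Rightarrow>\<^sub>L 'g" and x y assume xy: "x \<in> {0..t}" "y \<in> {0..t}"
      have "(\<lambda>n. blinfun_apply M (truncated_sum \<beta>B n y - truncated_sum \<beta>B n x)) \<longlonglongrightarrow> blinfun_apply M (Q y - Q x)"
        unfolding sum_B[OF xy(1)] sum_B[OF xy(2)] using xy by (intro tendsto_intros Q_lim') auto
      then show "(\<lambda>n. blinfun_apply id_blinfun (blinfun_apply M (truncated_sum \<beta>B n y - truncated_sum \<beta>B n x)))
          \<longlonglongrightarrow> blinfun_apply id_blinfun (blinfun_apply M (Q y - Q x))"
        by simp
    qed
    then have "SB \<longlonglongrightarrow> JB" by simp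
    then have "(\<lambda>n. f (Z t) - f (Z 0) - SA n - (1/2) *\<^sub>R SB n - SR n) \<longlonglongrightarrow> f (Z t) - f (Z 0) - JA - (1/2) *\<^sub>R JB - JR"
      by (intro tendsto_intros SA_lim SR_lim)
    then show ?thesis
      by (simp add: Ito_split[abs_def] I_def)
  qed

  have approx: "step_approximable (\<lambda>s. \<Phi> (left_lim Z s))" if "continuous_on UNIV \<Phi>"
    for \<Phi> :: "'f \<times> 'e \<Rightarrow> 'h::real_normed_vector"
  proof -
    have "left_lim (\<lambda>s. \<Phi> (Z s)) = (\<lambda>s. \<Phi> (left_lim Z s))"
    proof
      fix s show "left_lim (\<lambda>s. \<Phi> (Z s)) s = \<Phi> (left_lim Z s)"
        using cadlag_compose(2)[OF Z that, of s] by (cases "0 \<le> s") (auto simp: left_lim_def)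
    qed
    then show ?thesis
      using step_approximable_left_lim[OF cadlag_compose(1)[OF Z that]] by simp
  qed
  define jA where "jA u = blinfun_apply (Daf (left_lim Z u)) (jump A u)" for u
  define jB where "jB u = blinfun_apply (DBf (left_lim Z u)) (jump Q u)" for u
  define jf where "jf u = f (A u, X u) - f (left_lim A u, left_lim X u) - blinfun_apply (Dxf (left_lim A u, left_lim X u)) (jump X u)" for u
  note A_split = stieltjes_integral_split_jumps[OF A assms(8) approx[OF Daf] t]
  note Q_split = stieltjes_integral_split_jumps[OF Q approx[OF DBf] t]
  have jA: "jA summable_on {0<..t}" and jB: "jB summable_on {0<..t}"
    using A_split(1) Q_split(1) by (simp_all add: jA_def[abs_def] jB_def[abs_def])
  have r: "(\<lambda>u. remainder (left_lim Z u) (Z u)) summable_on {0<..t}"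
    by (rule abs_summable_summable[OF R_lim(1)])
  \<comment> \<open>Here \<open>jump Q = B (jump X) (jump X)\<close> identifies the second order term of the remainder.\<close>
  have jf_eq: "jf u = remainder (left_lim Z u) (Z u) + jA u + (1/2) *\<^sub>R jB u" if "u \<in> {0<..t}" for u
    using that jump_Q[of u] by (simp add: jf_def jA_def jB_def remainder_def left_Z Z_at jump_def)
  have sum_jf: "((\<lambda>u. remainder (left_lim Z u) (Z u) + jA u + (1/2) *\<^sub>R jB u) has_sum
      (JR + infsum jA {0<..t} + (1/2) *\<^sub>R infsum jB {0<..t})) {0<..t}"
    unfolding JR_def
    by (intro has_sum_add has_sum_scaleR has_sum_infsum r jA jB)
  then have sum_jf: "(jf has_sum (JR + infsum jA {0<..t} + (1/2) *\<^sub>R infsum jB {0<..t})) {0<..t}"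
    by (rule has_sum_cong[THEN iffD2, rotated]) (rule jf_eq)
  have formula: "f (A t, X t) - f (A 0, X 0) =
        stieltjes_integral t (\<lambda>s. Daf (left_lim A s, left_lim X s)) (continuous_part A)
        + I
        + (1/2) *\<^sub>R stieltjes_integral t (\<lambda>s. DBf (left_lim A s, left_lim X s)) (continuous_part Q)
        + infsum jf {0<..t}"
    unfolding infsumI[OF sum_jf]
    using A_split(2) Q_split(2)
    by (simp add: I_def JA_def JB_def jA_def[abs_def] jB_def[abs_def] left_Z Z_at scaleR_add_right)
  show "\<exists>I.
      limitin weak_topology
        (\<lambda>n. ito_foellmer_sum (\<pi>s n) (\<lambda>r. Dxf (A r, X r)) X t)
        I sequentially \<and>
      (\<lambda>s. (f (A s, X s) - f (left_lim A s, left_lim X s))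
             - blinfun_apply (Dxf (left_lim A s, left_lim X s)) (jump X s)) summable_on {0<..t} \<and>
      f (A t, X t) - f (A 0, X 0) =
        stieltjes_integral t (\<lambda>s. Daf (left_lim A s, left_lim X s)) (continuous_part A)
        + I
        + (1/2) *\<^sub>R
          stieltjes_integral t (\<lambda>s. DBf (left_lim A s, left_lim X s)) (continuous_part Q)
        + (\<Sum>\<^sub>\<infinity>s\<in>{0<..t}. (f (A s, X s) - f (left_lim A s, left_lim X s))
             - blinfun_apply (Dxf (left_lim A s, left_lim X s)) (jump X s)) \<and>
      (has_strong_quadratic_variation B \<pi>s X Q \<longrightarrow>
        (\<lambda>n. ito_foellmer_sum (\<pi>s n) (\<lambda>r. Dxf (A r, X r)) X t)
          \<longlonglongrightarrow> I)"
    using weak strong formula has_sum_imp_summable[OF sum_jf]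
    unfolding Ito_def[abs_def] jf_def[abs_def] by blast
qed

end
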